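(* Let $(G_{\mathbb{C}},H_{\mathbb{C}})$ be a non-symmetric reductive spherical pair of rank-one type, i.e. one of the three pairs $(SO(7,\mathbb{C}),G_2(\mathbb{C}))$, $(Spin(7,\mathbb{C}),G_2(\mathbb{C}))$, $(G_2(\mathbb{C}),SL(3,\mathbb{C}))$. Let $\theta$ be a Cartan involution of $G_{\mathbb{C}}$ with $\theta(H_{\mathbb{C}})=H_{\mathbb{C}}$, let $G_u=G_{\mathbb{C}}^{\theta}$ with Lie algebra $\mathfrak{g}_u$, and let $\mathfrak{q}$ be the orthogonal complement of $\mathfrak{h}=\operatorname{Lie}(H_{\mathbb{C}})$ in $\mathfrak{g}=\operatorname{Lie}(G_{\mathbb{C}})$ with respect to the Killing form of $\mathfrak{g}$. Then there exists a one-dimensional (real) abelian subspace $\mathfrak{a}_0\subset \sqrt{-1}\,\mathfrak{g}_u\cap\mathfrak{q}$ such that $$G_{\mathbb{C}}=G_u(\exp\mathfrak{a}_0)H_{\mathbb{C}}.$$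
   Context: Cayley algebra: $\mathfrak{C}$ is the 8-dimensional real algebra with basis $e_0,\dots,e_7$, where $e_0$ is the unit, $e_i^2=-e_0$ for $i\ge 1$, $e_ie_j=-e_je_i$ for distinct $i,j\geq 1$, and $e_1e_2=e_3$, $e_1e_4=e_5$, $e_1e_6=e_7$, $e_2e_5=e_7$, $e_2e_6=e_4$, $e_3e_5=e_6$, $e_3e_4=e_7$ (each listed relation $e_ie_j=e_k$ also gives $e_je_k=e_i$ and $e_ke_i=e_j$). $\mathfrak{C}_{\mathbb{C}}=\mathfrak{C}\otimes_{\mathbb{R}}\mathbb{C}$ carries the complex symmetric bilinear form with $(e_i,e_j)=\delta_{ij}$. Groups: $SO(8,\mathbb{C})=\{g\in SL(8,\mathbb{C}):{}^tgg=I_8\}$ acts on $\mathfrak{C}_{\mathbb{C}}$ via the basis $e_0,\dots,e_7$, and $SO(7,\mathbb{C})=\{g\in SO(8,\mathbb{C}):ge_0=e_0\}$. $G_2(\mathbb{C})=\{g\in SO(8,\mathbb{C}):(gx)(gy)=g(xy)\ \forall x,y\in\mathfrak{C}_{\mathbb{C}}\}\subset SO(7,\mathbb{C})$. $Spin(7,\mathbb{C})=\{g\in SO(8,\mathbb{C}):\exists g_0\in SO(7,\mathbb{C})\text{ with }(g_0x)(gy)=g(xy)\ \forall x,y\in\mathfrak{C}_{\mathbb{C}}\}$; it contains $G_2(\mathbb{C})$ as the stabilizer of $e_0$. $SL(3,\mathbb{C})$ is realized as $\{g\in G_2(\mathbb{C}):ge_1=e_1\}$. A Cartan involution $\theta$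 of the complex group $G_{\mathbb{C}}$ (regarded as a real Lie group) is an involutive automorphism whose fixed point group $G_u$ is a maximal compact subgroup; then $\mathfrak{g}_u$ is a compact real form of $\mathfrak{g}$ and $\mathfrak{g}=\mathfrak{g}_u+\sqrt{-1}\,\mathfrak{g}_u$. *)

theory Defs
  imports "HOL-Analysis.Analysis" "HOL-Algebra.Group"
begin

text \<open>The Cayley algebra. The basis vector \<open>e\<^sub>i\<close> is \<open>axis i 1\<close>, where the eight elements
  \<open>0, \<dots>, 7\<close> of the index type \<^typ>\<open>8\<close> are used literally. Scalars are left
  generic: \<^typ>\<open>real^8\<close> carries the real algebra and \<^typ>\<open>complex^8\<close>, with the same
  structure constants, its complexification.\<close>

definition cayley_triples :: "(8 \<times> 8 \<times> 8) set" where
  "cayley_triples =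
     {(1,2,3), (1,4,5), (1,6,7), (2,5,7), (2,6,4), (3,5,6), (3,4,7)}"

text \<open>\<open>cayley_pos i j k\<close> says \<open>e\<^sub>i e\<^sub>j = e\<^sub>k\<close>, closing the listed relations under cyclic rotation.\<close>

definition cayley_pos :: "8 \<Rightarrow> 8 \<Rightarrow> 8 \<Rightarrow> bool" where
  "cayley_pos i j k \<longleftrightarrow>
     (i,j,k) \<in> cayley_triples \<or> (j,k,i) \<in> cayley_triples \<or> (k,i,j) \<in> cayley_triples"

text \<open>The coefficient of \<open>e\<^sub>k\<close> in \<open>e\<^sub>i e\<^sub>j\<close>.\<close>

definition cayley_coeff :: "8 \<Rightarrow> 8 \<Rightarrow> 8 \<Rightarrow> 'a::comm_ring_1" where
  "cayley_coeff i j k =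
     (if i = 0 then (if k = j then 1 else 0)
      else if j = 0 then (if k = i then 1 else 0)
      else if i = j then (if k = 0 then - 1 else 0)
      else if cayley_pos i j k then 1
      else if cayley_pos j i k then - 1
      else 0)"

definition cayley_mult :: "'a::comm_ring_1^8 \<Rightarrow> 'a^8 \<Rightarrow> 'a^8"  (infixl "\<bullet>\<^sub>C" 70) where
  "x \<bullet>\<^sub>C y = (\<chi> k. \<Sum>i\<in>UNIV. \<Sum>j\<in>UNIV. cayley_coeff i j k * x $ i * y $ j)"

type_synonym cmat = "complex^8^8"

definition SO8 :: "cmat set" where
  "SO8 = {g. det g = 1 \<and> transpose g ** g = mat 1}"

definition SO7 :: "cmat set" where
  "SO7 = {g \<in> SO8. g *v axis 0 1 = axis 0 1}"

definition G2 :: "cmat set" where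
  "G2 = {g \<in> SO8. \<forall>x y. (g *v x) \<bullet>\<^sub>C (g *v y) = g *v (x \<bullet>\<^sub>C y)}"

definition Spin7 :: "cmat set" where
  "Spin7 = {g \<in> SO8. \<exists>g0 \<in> SO7. \<forall>x y. (g0 *v x) \<bullet>\<^sub>C (g *v y) = g *v (x \<bullet>\<^sub>C y)}"

definition SL3 :: "cmat set" where
  "SL3 = {g \<in> G2. g *v axis 1 1 = axis 1 1}"

definition matrix_group :: "cmat set \<Rightarrow> cmat monoid" where
  "matrix_group G = \<lparr>carrier = G, monoid.mult = (**), one = mat 1\<rparr>"

text \<open>The type \<^typ>\<open>complex^8^8\<close> is no instance of \<^class>\<open>real_normed_algebra_1\<close>
  (its \<open>*\<close> is entrywise), so \<^const>\<open>exp\<close> is not available for it.\<close>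

definition mat_exp :: "cmat \<Rightarrow> cmat" where
  "mat_exp X = (\<Sum>n. (((**) X ^^ n) (mat 1)) /\<^sub>R fact n)"

text \<open>The Lie algebra of a closed subgroup of \<open>GL(8,\<complex>)\<close>, regarded as a real Lie group. For the
  complex groups above it is closed under multiplication by \<open>\<i>\<close> and is their complex Lie algebra.\<close>

definition Lie :: "cmat set \<Rightarrow> cmat set" where
  "Lie G = {X. \<forall>t::real. mat_exp (t *\<^sub>R X) \<in> G}"

definition lie_bracket :: "cmat \<Rightarrow> cmat \<Rightarrow> cmat" where
  "lie_bracket X Y = X ** Y - Y ** X"

definition cscale :: "complex \<Rightarrow> cmat \<Rightarrow> cmat" where
  "cscale c X = (\<chi> i j. c * X $ i $ j)"

interpretation cmat: vector_space cscale
  by unfold_locales (simp_all add: cscale_def vec_eq_iff algebra_simps)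

text \<open>The trace of a complex-linear endomorphism \<open>f\<close> of a complex subspace \<open>V\<close> of matrices; the
  value does not depend on the basis chosen.\<close>

definition trace_on :: "cmat set \<Rightarrow> (cmat \<Rightarrow> cmat) \<Rightarrow> complex" where
  "trace_on V f =
     (let B = (SOME B. cmat.independent B \<and> cmat.span B = V)
      in \<Sum>b\<in>B. cmat.representation B (f b) b)"

definition killing :: "cmat set \<Rightarrow> cmat \<Rightarrow> cmat \<Rightarrow> complex" where
  "killing \<gg> X Y = trace_on \<gg> (\<lambda>Z. lie_bracket X (lie_bracket Y Z))"

definition killing_complement :: "cmat set \<Rightarrow> cmat set \<Rightarrow> cmat set" where
  "killing_complement \<gg> \<hh> = {Y \<in> \<gg>. \<forall>X \<in> \<hh>. killing \<gg> X Y = 0}"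

definition compact_subgroup :: "cmat set \<Rightarrow> cmat set \<Rightarrow> bool" where
  "compact_subgroup K G \<longleftrightarrow> subgroup K (matrix_group G) \<and> compact K"

definition maximal_compact_subgroup :: "cmat set \<Rightarrow> cmat set \<Rightarrow> bool" where
  "maximal_compact_subgroup K G \<longleftrightarrow>
     compact_subgroup K G \<and> (\<forall>L. compact_subgroup L G \<and> K \<subseteq> L \<longrightarrow> L = K)"

definition fixed_group :: "cmat set \<Rightarrow> (cmat \<Rightarrow> cmat) \<Rightarrow> cmat set" where
  "fixed_group G \<theta> = {g \<in> G. \<theta> g = g}"

text \<open>Automorphisms of \<open>G\<close> as a real Lie group are its continuous group automorphisms (these are
  automatically real-analytic). Only the values of \<open>\<theta>\<close> on \<open>G\<close> matter.\<close>

definition cartan_involution :: "cmat set \<Rightarrow> (cmat \<Rightarrow> cmat) \<Rightarrow> bool" where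
  "cartan_involution G \<theta> \<longleftrightarrow>
     \<theta> \<in> iso (matrix_group G) (matrix_group G) \<and> continuous_on G \<theta> \<and>
     (\<forall>g \<in> G. \<theta> (\<theta> g) = g) \<and>
     maximal_compact_subgroup (fixed_group G \<theta>) G"

definition rank_one_spherical_pairs :: "(cmat set \<times> cmat set) set" where
  "rank_one_spherical_pairs = {(SO7, G2), (Spin7, G2), (G2, SL3)}"

end

theory Submission
  imports Defs
begin

text \<open>
  \<open>Spin(7,\<complex>)\<close> and \<open>G\<^sub>2(\<complex>)\<close> act on the complex spheres \<open>(z,z) = 1\<close> in \<open>\<complex>\<^sup>8\<close> and \<open>\<complex>\<^sup>7\<close>
  with stabilizers \<open>G\<^sub>2(\<complex>)\<close> and \<open>SL(3,\<complex>)\<close>. Writing \<open>z = cosh t u + \<i> sinh t v\<close> with real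
  orthonormal \<open>u, v\<close> and using that the compact real forms are transitive on real orthonormal pairs
  gives \<open>G = G\<^sub>0 A H\<close> for the standard real form \<open>G\<^sub>0\<close>; the case of \<open>SO(7,\<complex>)\<close> follows by
  lifting to \<open>Spin(7,\<complex>)\<close>.

  For an arbitrary Cartan involution \<open>\<theta>\<close>, a displacement function on the positive matrices in
  \<open>G\<close> has a unique minimum, whence \<open>G\<^sup>\<theta> = g\<inverse> G\<^sub>0 g\<close>. By the decomposition one
  may take \<open>g = a\<^sub>t h\<close>. The involution \<open>\<psi>\<close> obtained from \<open>\<theta>\<close> by transport along \<open>g\<close> fixes exactly
  \<open>G\<^sub>0\<close> and preserves \<open>a\<^sub>t H a\<^sub>t\<inverse>\<close>. The element \<open>c = a\<^sub>t\<inverse> \<psi>(a\<^sub>t)\<close> commutes with the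
  centralizer of \<open>a\<^sub>t\<close> in \<open>G\<^sub>0\<close> and conjugates \<open>H \<inter> G\<^sub>0\<close> into \<open>H\<close>; in each of the three cases this
  forces \<open>c\<close> to be real. Then \<open>c\<^sup>2 = 1\<close> since \<open>\<psi>\<close> is an involution, so \<open>\<psi>\<close> fixes \<open>a\<^sub>t\<^sup>2\<close>, which must
  therefore be real, and \<open>t = 0\<close>. Hence \<open>G\<^sup>\<theta> = h\<inverse> G\<^sub>0 h\<close> with \<open>h \<in> H\<close>, and everything
  is conjugate to the standard situation by an element of \<open>H\<close>.
\<close>

section \<open>The complexified Cayley algebra\<close>

lemma exhaust_8: "(i::8) = 0 \<or> i = 1 \<or> i = 2 \<or> i = 3 \<or> i = 4 \<or> i = 5 \<or> i = 6 \<or> i = 7"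
proof (induct i)
  case (of_int z)
  then have "z = 0 \<or> z = 1 \<or> z = 2 \<or> z = 3 \<or> z = 4 \<or> z = 5 \<or> z = 6 \<or> z = 7" by auto
  then show ?case by auto
qed

lemma UNIV_8: "(UNIV::8 set) = {0,1,2,3,4,5,6,7}"
  using exhaust_8 by auto

lemma forall_8: "(\<forall>i::8. P i) \<longleftrightarrow> P 0 \<and> P 1 \<and> P 2 \<and> P 3 \<and> P 4 \<and> P 5 \<and> P 6 \<and> P 7"
  by (metis exhaust_8)

lemma sum_8: "sum f (UNIV::8 set) = f 0 + f 1 + f 2 + f 3 + f 4 + f 5 + f 6 + f 7"
  unfolding UNIV_8 by (simp add: ac_simps)

lemma vec8_eq_iff: "(x::'a^8) = y \<longleftrightarrow> x$0 = y$0 \<and> x$1 = y$1 \<and> x$2 = y$2 \<and> x$3 = y$3 \<and>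
    x$4 = y$4 \<and> x$5 = y$5 \<and> x$6 = y$6 \<and> x$7 = y$7"
  by (simp add: vec_eq_iff forall_8)

lemma cayley_mult_nth:
  fixes x y :: "'a::comm_ring_1^8"
  shows "(x \<bullet>\<^sub>C y) $ 0 = x$0*y$0 - x$1*y$1 - x$2*y$2 - x$3*y$3 - x$4*y$4 - x$5*y$5 - x$6*y$6 - x$7*y$7"
    and "(x \<bullet>\<^sub>C y) $ 1 = x$0*y$1 + x$1*y$0 + x$2*y$3 - x$3*y$2 + x$4*y$5 - x$5*y$4 + x$6*y$7 - x$7*y$6"
    and "(x \<bullet>\<^sub>C y) $ 2 = x$0*y$2 + x$2*y$0 + x$3*y$1 - x$1*y$3 + x$5*y$7 - x$7*y$5 + x$6*y$4 - x$4*y$6"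
    and "(x \<bullet>\<^sub>C y) $ 3 = x$0*y$3 + x$3*y$0 + x$1*y$2 - x$2*y$1 + x$5*y$6 - x$6*y$5 + x$4*y$7 - x$7*y$4"
    and "(x \<bullet>\<^sub>C y) $ 4 = x$0*y$4 + x$4*y$0 + x$5*y$1 - x$1*y$5 + x$2*y$6 - x$6*y$2 + x$7*y$3 - x$3*y$7"
    and "(x \<bullet>\<^sub>C y) $ 5 = x$0*y$5 + x$5*y$0 + x$1*y$4 - x$4*y$1 + x$7*y$2 - x$2*y$7 + x$6*y$3 - x$3*y$6"
    and "(x \<bullet>\<^sub>C y) $ 6 = x$0*y$6 + x$6*y$0 + x$7*y$1 - x$1*y$7 + x$4*y$2 - x$2*y$4 + x$3*y$5 - x$5*y$3"
    and "(x \<bullet>\<^sub>C y) $ 7 = x$0*y$7 + x$7*y$0 + x$1*y$6 - x$6*y$1 + x$2*y$5 - x$5*y$2 + x$3*y$4 - x$4*y$3"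
  by (simp_all add: cayley_mult_def sum_8 cayley_coeff_def cayley_pos_def cayley_triples_def algebra_simps)

definition bil :: "complex^8 \<Rightarrow> complex^8 \<Rightarrow> complex" where
  "bil x y = (\<Sum>i\<in>UNIV. x$i * y$i)"

abbreviation e :: "8 \<Rightarrow> complex^8" where "e i \<equiv> axis i 1"

lemma bil_8: "bil x y = x$0*y$0 + x$1*y$1 + x$2*y$2 + x$3*y$3 + x$4*y$4 + x$5*y$5 + x$6*y$6 + x$7*y$7"
  by (simp add: bil_def sum_8)

lemma bil_commute: "bil x y = bil y x"
  by (simp add: bil_def mult.commute)

lemma bil_linear [simp]:
  "bil (x + y) z = bil x z + bil y z" "bil z (x + y) = bil z x + bil z y"
  "bil (x - y) z = bil x z - bil y z" "bil z (x - y) = bil z x - bil z y"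
  "bil (c *s x) z = c * bil x z" "bil z (c *s x) = c * bil z x"
  "bil (- x) z = - bil x z" "bil z (- x) = - bil z x"
  "bil 0 z = 0" "bil z 0 = 0"
  by (simp_all add: bil_8 algebra_simps)

lemma bil_axis [simp]: "bil (e i) x = x $ i" "bil x (e i) = x $ i"
  by (simp_all add: bil_def axis_def if_distrib if_distribR sum.delta cong: if_cong)

lemma bil_eqI: "(\<And>y. bil x y = bil x' y) \<Longrightarrow> x = x'"
  by (metis bil_axis(2) vec_eq_iff)

lemma bil_matrix: "bil (A *v x) y = bil x (transpose A *v y)"
  unfolding bil_8 by (simp add: matrix_vector_mult_def sum_8 transpose_def algebra_simps)

lemma cayley_linear [simp]:
  fixes x y z :: "complex^8"
  shows "(x + y) \<bullet>\<^sub>C z = x \<bullet>\<^sub>C z + y \<bullet>\<^sub>C z" "z \<bullet>\<^sub>C (x + y) = z \<bullet>\<^sub>C x + z \<bullet>\<^sub>C y"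
    "(x - y) \<bullet>\<^sub>C z = x \<bullet>\<^sub>C z - y \<bullet>\<^sub>C z" "z \<bullet>\<^sub>C (x - y) = z \<bullet>\<^sub>C x - z \<bullet>\<^sub>C y"
    "(c *s x) \<bullet>\<^sub>C z = c *s (x \<bullet>\<^sub>C z)" "z \<bullet>\<^sub>C (c *s x) = c *s (z \<bullet>\<^sub>C x)"
    "(- x) \<bullet>\<^sub>C z = - (x \<bullet>\<^sub>C z)" "z \<bullet>\<^sub>C (- x) = - (z \<bullet>\<^sub>C x)"
    "0 \<bullet>\<^sub>C z = 0" "z \<bullet>\<^sub>C 0 = 0" "e 0 \<bullet>\<^sub>C z = z" "z \<bullet>\<^sub>C e 0 = z"
  by (simp_all add: vec8_eq_iff cayley_mult_nth axis_def algebra_simps)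

lemma cayley_mult_imaginary_self:
  assumes "a $ 0 = 0" shows "a \<bullet>\<^sub>C a = - bil a a *s e 0"
  using assms by (simp add: vec8_eq_iff cayley_mult_nth bil_8 axis_def)

lemma cayley_mult_imaginary_twice:
  assumes "a $ 0 = 0" shows "a \<bullet>\<^sub>C (a \<bullet>\<^sub>C x) = - bil a a *s x"
  using assms by (simp add: vec8_eq_iff cayley_mult_nth bil_8, simp add: algebra_simps)

lemma cayley_mult_clifford:
  assumes "a $ 0 = 0" "b $ 0 = 0"
  shows "a \<bullet>\<^sub>C (b \<bullet>\<^sub>C x) + b \<bullet>\<^sub>C (a \<bullet>\<^sub>C x) = (- 2 * bil a b) *s x"
proof -
  have "(a + b) \<bullet>\<^sub>C ((a + b) \<bullet>\<^sub>C x) = - bil (a + b) (a + b) *s x"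
    by (rule cayley_mult_imaginary_twice) (simp add: assms)
  then show ?thesis
    using cayley_mult_imaginary_twice[OF assms(1), of x] cayley_mult_imaginary_twice[OF assms(2), of x]
    by (simp add: bil_commute[of b a] vec_eq_iff algebra_simps eq_neg_iff_add_eq_0)
qed

lemma bil_cayley_mult_imaginary:
  assumes "a $ 0 = 0" shows "bil (a \<bullet>\<^sub>C x) y = - bil x (a \<bullet>\<^sub>C y)"
  using assms by (simp add: cayley_mult_nth bil_8, simp add: algebra_simps)

declare transpose_matrix_vector [simp del]

lemma axis_1_nth [simp]: "(axis i 1 :: 'a::zero_neq_one^'n) $ j = (if j = i then 1 else 0)"
  by (simp add: axis_def)

lemma matrix_axis_nth [simp]: "((A::cmat) *v e j) $ i = A $ i $ j"
  by (simp add: matrix_vector_mult_def if_distrib cong: if_cong)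

lemma matrix_vector_uminus [simp]:
  "(- A) *v x = - (A *v x)" "A *v (- x) = - (A *v x)" for A :: cmat
  by (simp_all add: vec_eq_iff matrix_vector_mult_def sum_negf)

definition vcnj :: "complex^8 \<Rightarrow> complex^8" where "vcnj x = (\<chi> i. cnj (x $ i))"

definition mcnj :: "cmat \<Rightarrow> cmat" where "mcnj A = (\<chi> i j. cnj (A $ i $ j))"

lemma vcnj_nth [simp]: "vcnj x $ i = cnj (x $ i)"
  by (simp add: vcnj_def)

lemma mcnj_nth [simp]: "mcnj A $ i $ j = cnj (A $ i $ j)"
  by (simp add: mcnj_def)

lemma vcnj_simps [simp]:
  "vcnj (vcnj x) = x" "vcnj (x + y) = vcnj x + vcnj y" "vcnj (x - y) = vcnj x - vcnj y"
  "vcnj (- x) = - vcnj x" "vcnj (c *s x) = cnj c *s vcnj x" "vcnj (e i) = e i" "vcnj 0 = 0"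
  by (simp_all add: vec_eq_iff)

lemma vcnj_cayley_mult [simp]: "vcnj (x \<bullet>\<^sub>C y) = vcnj x \<bullet>\<^sub>C vcnj y"
  by (simp add: vec8_eq_iff cayley_mult_nth)

lemma mcnj_simps [simp]:
  "mcnj (mcnj A) = A" "mcnj (A + B) = mcnj A + mcnj B" "mcnj (A - B) = mcnj A - mcnj B"
  "mcnj (- A) = - mcnj A" "mcnj 0 = 0" "mcnj (mat 1) = mat 1" "mcnj (r *\<^sub>R A) = r *\<^sub>R mcnj A"
  by (simp_all add: vec_eq_iff mat_def)

lemma mcnj_mult [simp]: "mcnj (A ** B) = mcnj A ** mcnj B"
  by (simp add: vec_eq_iff matrix_matrix_mult_def)

lemma vcnj_mult [simp]: "vcnj (A *v x) = mcnj A *v vcnj x"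
  by (simp add: vec_eq_iff matrix_vector_mult_def)

lemma mcnj_transpose [simp]: "mcnj (transpose A) = transpose (mcnj A)"
  by (simp add: vec_eq_iff transpose_def)

lemma det_mcnj [simp]: "det (mcnj A) = cnj (det A)"
  by (simp add: det_def sign_def)

lemma cnj_bil [simp]: "cnj (bil x y) = bil (vcnj x) (vcnj y)"
  by (simp add: bil_def)

lemma mcnj_eq_iff: "mcnj A = A \<longleftrightarrow> (\<forall>x. vcnj x = x \<longrightarrow> vcnj (A *v x) = A *v x)"
proof
  assume *: "\<forall>x. vcnj x = x \<longrightarrow> vcnj (A *v x) = A *v x"
  have "mcnj A *v e i = A *v e i" for i
    using *[rule_format, of "e i"] by simp
  then have "(mcnj A *v e j) $ i = (A *v e j) $ i" for i j by simp
  then show "mcnj A = A"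
    by (simp add: vec_eq_iff)
qed simp

lemma cmat_eq_iff: "(A::cmat) = B \<longleftrightarrow> (\<forall>x. A *v x = B *v x)"
  by (rule matrix_eq)

lemma SO8_D:
  assumes "g \<in> SO8"
  shows "det g = 1" "transpose g ** g = mat 1" "g ** transpose g = mat 1"
  using assms by (auto simp: SO8_def matrix_left_right_inverse)

lemma SO8_mult: "g \<in> SO8 \<Longrightarrow> h \<in> SO8 \<Longrightarrow> g ** h \<in> SO8"
  by (simp add: SO8_def det_mul matrix_transpose_mul matrix_mul_assoc)
     (metis matrix_mul_assoc matrix_mul_rid)

lemma SO8_transpose: "g \<in> SO8 \<Longrightarrow> transpose g \<in> SO8"
  by (simp add: SO8_def matrix_left_right_inverse)

lemma SO8_one: "mat 1 \<in> SO8"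
  by (simp add: SO8_def)

lemma SO8_mcnj: "g \<in> SO8 \<Longrightarrow> mcnj g \<in> SO8"
  by (simp add: SO8_def flip: mcnj_transpose mcnj_mult)

lemma SO8_bil: "g \<in> SO8 \<Longrightarrow> bil (g *v x) (g *v y) = bil x y"
  by (simp add: bil_matrix matrix_vector_mul_assoc SO8_D)

lemma SO8_cancel [simp]:
  assumes "g \<in> SO8" shows "transpose g *v (g *v x) = x" "g *v (transpose g *v x) = x"
  using assms by (simp_all add: matrix_vector_mul_assoc SO8_D)

lemma orthogonal_of_bil:
  assumes "\<And>x y. bil (g *v x) (g *v y) = bil x y" shows "transpose g ** g = mat 1"
  unfolding matrix_eq by (auto intro!: bil_eqI simp: assms bil_matrix[of "transpose g"] simp flip: matrix_vector_mul_assoc)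

lemma SO7_iff: "g \<in> SO7 \<longleftrightarrow> g \<in> SO8 \<and> g *v e 0 = e 0"
  by (auto simp: SO7_def)

lemma SO7_mult: "g \<in> SO7 \<Longrightarrow> h \<in> SO7 \<Longrightarrow> g ** h \<in> SO7"
  by (simp add: SO7_iff SO8_mult flip: matrix_vector_mul_assoc)

lemma SO7_transpose: "g \<in> SO7 \<Longrightarrow> transpose g \<in> SO7"
  by (metis SO7_iff SO8_cancel(1) SO8_transpose)

lemma SO7_nth_0:
  assumes "g \<in> SO7" shows "(g *v x) $ 0 = x $ 0"
  using SO8_bil[of g "e 0" x] assms by (simp add: SO7_iff)

definition spin_pair :: "cmat \<Rightarrow> cmat \<Rightarrow> bool" where
  "spin_pair g0 g \<longleftrightarrow> g0 \<in> SO7 \<and> g \<in> SO8 \<and> (\<forall>x y. (g0 *v x) \<bullet>\<^sub>C (g *v y) = g *v (x \<bullet>\<^sub>C y))"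

lemma Spin7_iff: "g \<in> Spin7 \<longleftrightarrow> (\<exists>g0. spin_pair g0 g)"
  by (auto simp: Spin7_def spin_pair_def)

lemma spin_pair_mult:
  "spin_pair g0 g \<Longrightarrow> spin_pair h0 h \<Longrightarrow> spin_pair (g0 ** h0) (g ** h)"
  by (simp add: spin_pair_def SO7_mult SO8_mult flip: matrix_vector_mul_assoc)

lemma spin_pair_transpose:
  assumes "spin_pair g0 g" shows "spin_pair (transpose g0) (transpose g)"
  unfolding spin_pair_def
proof (intro conjI allI)
  have g: "g0 \<in> SO7" "g0 \<in> SO8" "g \<in> SO8" "\<And>x y. (g0 *v x) \<bullet>\<^sub>C (g *v y) = g *v (x \<bullet>\<^sub>C y)"
    using assms by (auto simp: spin_pair_def SO7_iff)
  show "transpose g0 \<in> SO7" "transpose g \<in> SO8"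
    using g SO7_transpose SO8_transpose by auto
  show "(transpose g0 *v x) \<bullet>\<^sub>C (transpose g *v y) = transpose g *v (x \<bullet>\<^sub>C y)" for x y
    using g(4)[of "transpose g0 *v x" "transpose g *v y"] g(2,3) by (metis SO8_cancel)
qed

lemma spin_pair_one: "spin_pair (mat 1) (mat 1)"
  by (simp add: spin_pair_def SO7_iff SO8_one)

lemma SO7_mcnj: "g \<in> SO7 \<Longrightarrow> mcnj g \<in> SO7"
  unfolding SO7_iff using SO8_mcnj vcnj_mult vcnj_simps(6) by metis

lemma spin_pair_mcnj:
  assumes "spin_pair g0 g" shows "spin_pair (mcnj g0) (mcnj g)"
proof -
  have "(mcnj g0 *v x) \<bullet>\<^sub>C (mcnj g *v y) = mcnj g *v (x \<bullet>\<^sub>C y)" for x y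
  proof -
    have "vcnj ((g0 *v vcnj x) \<bullet>\<^sub>C (g *v vcnj y)) = vcnj (g *v (vcnj x \<bullet>\<^sub>C vcnj y))"
      using assms by (simp add: spin_pair_def)
    then show ?thesis by simp
  qed
  then show ?thesis using assms by (simp add: spin_pair_def SO7_mcnj SO8_mcnj)
qed

lemma spin_pair_vector:
  assumes "spin_pair g0 g" shows "g0 *v x = g *v (x \<bullet>\<^sub>C (transpose g *v e 0))"
proof -
  have "(g0 *v x) \<bullet>\<^sub>C (g *v (transpose g *v e 0)) = g *v (x \<bullet>\<^sub>C (transpose g *v e 0))"
    using assms by (simp only: spin_pair_def)
  then show ?thesis using assms by (simp add: spin_pair_def)
qed

lemma spin_pair_unique:
  assumes "spin_pair g0 g" "spin_pair h0 g" shows "g0 = h0"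
  using spin_pair_vector assms by (metis cmat_eq_iff)

lemma spin_pair_real:
  assumes "spin_pair g0 g" "mcnj g = g" shows "mcnj g0 = g0"
  using spin_pair_mcnj[OF assms(1)] assms spin_pair_unique by metis

text \<open>For a unit imaginary \<open>a\<close> the Clifford relations give \<open>L\<^sub>a L\<^sub>x L\<^sub>a\<inverse> = L\<^sub>y\<close> for imaginary \<open>x\<close>, where
  \<open>y\<close> is the negative of the reflection of \<open>x\<close> in \<open>a\<close>; \<open>Rm a\<close> is this map, extended by \<open>e\<^sub>0 \<mapsto> e\<^sub>0\<close>.\<close>

definition Lm :: "complex^8 \<Rightarrow> cmat" where "Lm a = matrix (\<lambda>x. a \<bullet>\<^sub>C x)"

definition Rm :: "complex^8 \<Rightarrow> cmat" where
  "Rm a = matrix (\<lambda>x. (2 * bil a x) *s a - x + (2 * x $ 0) *s e 0)"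

lemma Lm_mult [simp]: "Lm a *v x = a \<bullet>\<^sub>C x"
  unfolding Lm_def by (rule matrix_works) (simp add: Vector_Spaces.linear_iff vec.vector_space_axioms)

lemma Rm_mult [simp]: "Rm a *v x = (2 * bil a x) *s a - x + (2 * x $ 0) *s e 0"
  unfolding Rm_def by (rule matrix_works)
    (simp add: Vector_Spaces.linear_iff vec.vector_space_axioms vec_eq_iff algebra_simps)

locale imaginary_unit =
  fixes a :: "complex^8"
  assumes imag [simp]: "a $ 0 = 0" and unit [simp]: "bil a a = 1"
begin

lemma Lm_sq: "Lm a ** Lm a = - mat 1"
  unfolding cmat_eq_iff
  by (simp add: cayley_mult_imaginary_twice vec_eq_iff flip: matrix_vector_mul_assoc)

lemma bil_Lm: "bil (a \<bullet>\<^sub>C x) (a \<bullet>\<^sub>C y) = bil x y"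
  by (simp add: bil_cayley_mult_imaginary cayley_mult_imaginary_twice)

lemma Lm_orth: "transpose (Lm a) ** Lm a = mat 1"
  by (rule orthogonal_of_bil) (simp add: bil_Lm)

lemma bil_Rm: "bil (Rm a *v x) (Rm a *v y) = bil x y"
  by (simp add: algebra_simps bil_commute[of x a] bil_commute[of y a])

lemma Rm_orth: "transpose (Rm a) ** Rm a = mat 1"
  by (rule orthogonal_of_bil) (rule bil_Rm)

lemma Rm_e0 [simp]: "Rm a *v e 0 = e 0"
  by (simp add: vec_eq_iff)

lemma Rm_nth_0: "(Rm a *v x) $ 0 = x $ 0"
  by simp

lemma Rm_Lm: "(Rm a *v x) \<bullet>\<^sub>C (Lm a *v y) = Lm a *v (x \<bullet>\<^sub>C y)"
proof -
  define x' where "x' = x - x$0 *s e 0"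
  have x: "x = x' + x$0 *s e 0" and [simp]: "x' $ 0 = 0" by (simp_all add: x'_def)
  have "Rm a *v x = (2 * bil a x') *s a - x' + x$0 *s e 0"
    by (subst x) (simp add: vec_eq_iff algebra_simps)
  then have "(Rm a *v x) \<bullet>\<^sub>C (Lm a *v y) =
     (2 * bil a x') *s (a \<bullet>\<^sub>C (a \<bullet>\<^sub>C y)) - x' \<bullet>\<^sub>C (a \<bullet>\<^sub>C y) + x$0 *s (a \<bullet>\<^sub>C y)"
    by simp
  also have "\<dots> = a \<bullet>\<^sub>C (x' \<bullet>\<^sub>C y) + x$0 *s (a \<bullet>\<^sub>C y)"
    using cayley_mult_clifford[of a x' y]
    by (simp add: cayley_mult_imaginary_twice vec_eq_iff algebra_simps eq_neg_iff_add_eq_0 eq_diff_eq)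
  also have "\<dots> = a \<bullet>\<^sub>C ((x' + x$0 *s e 0) \<bullet>\<^sub>C y)"
    by simp
  finally show ?thesis using x by simp
qed

lemma det_Lm_sq: "det (Lm a) * det (Lm a) = 1"
  using arg_cong[OF Lm_orth, of det] by (simp add: det_mul)

lemma det_Rm_sq: "det (Rm a) * det (Rm a) = 1"
  using arg_cong[OF Rm_orth, of det] by (simp add: det_mul)

lemma det_Lm_Rm: "det (Lm (Rm a *v x)) = det (Lm x)"
proof -
  have "Lm (Rm a *v x) ** Lm a = Lm a ** Lm x"
    unfolding cmat_eq_iff using Rm_Lm[of x] by (simp flip: matrix_vector_mul_assoc)
  from arg_cong[OF this, of det] show ?thesis
    using det_Lm_sq by (simp add: det_mul) (metis mult.commute mult_cancel_right zero_neq_one mult_zero_left)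
qed

lemma det_Rm_Rm: "det (Rm (Rm a *v x)) = det (Rm x)"
proof -
  have "Rm (Rm a *v x) ** Rm a = Rm a ** Rm x"
    unfolding cmat_eq_iff
    by (simp add: bil_Rm del: Rm_mult flip: matrix_vector_mul_assoc)
       (simp only: Rm_mult[of "Rm a *v x"] bil_Rm Rm_mult[of x] matrix_vector_right_distrib
         matrix_vector_mult_diff_distrib vector_scalar_commute Rm_e0 Rm_nth_0 simp_thms)
  from arg_cong[OF this, of det] show ?thesis
    using det_Rm_sq by (simp add: det_mul) (metis mult.commute mult_cancel_right zero_neq_one mult_zero_left)
qed

lemma imaginary_unit_uminus: "imaginary_unit (- a)"
  by unfold_locales simp_all

lemma det_Lm_uminus: "det (Lm (- a)) = det (Lm a)"
proof -
  have "Lm (- a) = Lm a ** (Lm a ** Lm a)"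
    by (simp add: Lm_sq cmat_eq_iff flip: matrix_vector_mul_assoc)
  then show ?thesis using det_Lm_sq by (simp add: det_mul)
qed

lemma det_Rm_uminus: "det (Rm (- a)) = det (Rm a)"
proof -
  have "Rm (- a) = Rm a" by (simp add: cmat_eq_iff vec_eq_iff)
  then show ?thesis by simp
qed

end

lemma Rm_swap:
  assumes "imaginary_unit a" "imaginary_unit b" "c * c * (2 + 2 * bil a b) = 1"
  shows "imaginary_unit (c *s (a + b))" "Rm (c *s (a + b)) *v a = b"
proof -
  interpret a: imaginary_unit a by fact
  interpret b: imaginary_unit b by fact
  show "imaginary_unit (c *s (a + b))"
    using assms(3) by unfold_locales (simp_all add: bil_commute[of b a] algebra_simps)
  have "2 * bil (c *s (a + b)) a * c = 1"
    using assms(3) by (simp add: algebra_simps bil_commute[of b a])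
  then show "Rm (c *s (a + b)) *v a = b"
    by (simp only: Rm_mult vector_smult_assoc) (simp add: vec_eq_iff)
qed

text \<open>Any two of the \<open>L\<^sub>a\<close>, up to the sign of \<open>a\<close>, are conjugate, so \<open>L\<^sub>a L\<^sub>b\<close> has determinant
  \<open>det(L\<^sub>a)\<^sup>2 = 1\<close>.\<close>

lemma det_Lm_Rm_const:
  assumes "imaginary_unit a" "imaginary_unit b"
  shows "det (Lm a) = det (Lm b) \<and> det (Rm a) = det (Rm b)"
proof -
  have *: "det (Lm a) = det (Lm b) \<and> det (Rm a) = det (Rm b)"
    if "imaginary_unit b" "bil a b \<noteq> - 1" for b
  proof -
    define c where "c = 1 / csqrt (2 + 2 * bil a b)"
    have "2 * (1 + bil a b) \<noteq> 0" using that(2)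
      by (metis add_eq_0_iff mult_eq_0_iff zero_neq_numeral)
    then have "2 + 2 * bil a b \<noteq> 0" by (metis distrib_left mult.right_neutral)
    then have "c * c * (2 + 2 * bil a b) = 1"
      by (simp add: c_def power_divide flip: power2_eq_square)
    with Rm_swap[OF assms(1) that(1)] show ?thesis
      by (metis imaginary_unit.det_Lm_Rm imaginary_unit.det_Rm_Rm)
  qed
  interpret b: imaginary_unit b by fact
  show ?thesis
  proof (cases "bil a b = -1")
    case True
    then show ?thesis using *[of "- b"]
      by (simp add: b.imaginary_unit_uminus b.det_Lm_uminus b.det_Rm_uminus)
  qed (use * assms in auto)
qed

lemma spin_pair_Lm_Lm:
  assumes "imaginary_unit a" "imaginary_unit b"
  shows "spin_pair (Rm a ** Rm b) (Lm a ** Lm b)"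
proof -
  interpret a: imaginary_unit a by fact
  interpret b: imaginary_unit b by fact
  have "det (Lm a ** Lm b) = 1" "det (Rm a ** Rm b) = 1"
    using det_Lm_Rm_const[OF assms] b.det_Lm_sq b.det_Rm_sq by (simp_all add: det_mul)
  moreover have "transpose (Lm a ** Lm b) ** (Lm a ** Lm b) = mat 1"
    by (rule orthogonal_of_bil) (simp add: a.bil_Lm b.bil_Lm flip: matrix_vector_mul_assoc)
  moreover have "transpose (Rm a ** Rm b) ** (Rm a ** Rm b) = mat 1"
    by (rule orthogonal_of_bil) (simp add: a.bil_Rm b.bil_Rm del: Rm_mult flip: matrix_vector_mul_assoc)
  ultimately show ?thesis
    by (simp add: spin_pair_def SO7_iff SO8_def a.Rm_Lm b.Rm_Lm del: Rm_mult Lm_mult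
        flip: matrix_vector_mul_assoc)
qed

lemma Lm_real: "vcnj a = a \<Longrightarrow> mcnj (Lm a) = Lm a"
  by (simp add: mcnj_eq_iff)

section \<open>Spin pairs and real frames\<close>

abbreviation real_vector :: "complex^8 \<Rightarrow> bool" where "real_vector x \<equiv> vcnj x = x"

lemma real_vector_Reals: "real_vector x \<longleftrightarrow> (\<forall>i. x $ i \<in> \<real>)"
  by (simp add: vec_eq_iff Reals_cnj_iff)

lemma real_vector_bil:
  assumes "real_vector x" "real_vector y"
  shows "bil x y = of_real (Re (bil x y))"
  using assms cnj_bil[of x y] by (metis Reals_cnj_iff of_real_Re)

lemma real_vector_bil_self:
  assumes "real_vector x"
  shows "bil x x = of_real (\<Sum>i\<in>UNIV. (Re (x $ i))\<^sup>2)"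
proof -
  have "x $ i = of_real (Re (x $ i))" for i
    using assms by (simp add: real_vector_Reals)
  then show ?thesis
    by (simp add: bil_def power2_eq_square)
qed

lemma real_vector_bil_nonneg: "real_vector x \<Longrightarrow> Re (bil x x) \<ge> 0"
  by (simp add: real_vector_bil_self sum_nonneg)

lemma real_vector_bil_eq_0: 
  assumes "real_vector x" "bil x x = 0" shows "x = 0"
proof -
  have "(\<Sum>i\<in>UNIV. (Re (x $ i))\<^sup>2) = 0"
    using real_vector_bil_self[OF assms(1)] assms(2) by (metis of_real_eq_0_iff)
  then have "Re (x $ i) = 0" for i by (simp add: sum_nonneg_eq_0_iff)
  then show ?thesis
    using assms(1) by (metis (no_types, lifting) complex_is_Real_iff complex_eqI real_vector_Reals vec_eq_iff zero_complex.sel zero_index)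
qed

lemma real_vector_csqrt:
  assumes "real_vector x" shows "cnj (csqrt (bil x x)) = csqrt (bil x x)"
  using real_vector_bil_self[OF assms]
  by (simp add: csqrt_of_real_nonneg sum_nonneg)

lemma imaginary_unit_axis: "i \<noteq> 0 \<Longrightarrow> imaginary_unit (e i)"
  by unfold_locales simp_all

lemma imaginary_unit_normalize:
  assumes "a $ 0 = 0" "bil a a \<noteq> 0"
  shows "imaginary_unit ((1 / csqrt (bil a a)) *s a)"
  using assms by unfold_locales (simp_all add: power_divide flip: power2_eq_square)

text \<open>The spare index \<open>l\<close> is only used when \<open>u + e\<^sub>j\<close> is isotropic: then \<open>u - e\<^sub>j\<close> is not, and
  \<open>e\<^sub>l\<close> corrects the sign. Factors come in pairs because each \<open>Rm a\<close> negates the \<open>e\<^sub>i\<close> orthogonal to \<open>a\<close>.\<close>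

lemma spin_step:
  assumes "imaginary_unit u" "\<And>i. i \<in> I \<Longrightarrow> u $ i = 0"
    and "j \<notin> I" "l \<notin> I" "j \<noteq> 0" "l \<noteq> 0" "j \<noteq> l"
  obtains p0 p where "spin_pair p0 p" "p0 *v u = e j" "\<And>i. i \<in> I \<Longrightarrow> p0 *v e i = e i"
    "real_vector u \<Longrightarrow> mcnj p = p"
proof -
  interpret u: imaginary_unit u by fact
  have "\<exists>a b. imaginary_unit a \<and> imaginary_unit b \<and> Rm b *v (Rm a *v u) = e j
     \<and> (\<forall>i\<in>I. a $ i = 0 \<and> b $ i = 0) \<and> (real_vector u \<longrightarrow> real_vector a \<and> real_vector b)"
  proof (cases "u $ j = -1")
    case False
    define s where "s = u + e j"
    define a where "a = (1 / csqrt (bil s s)) *s s"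
    have s: "s $ 0 = 0" "bil s s = 2 + 2 * u $ j" using assms by (simp_all add: s_def algebra_simps)
    have "2 * (1 + u $ j) \<noteq> 0" using False
      by (metis add_eq_0_iff mult_eq_0_iff zero_neq_numeral)
    then have "bil s s \<noteq> 0" unfolding s by (metis distrib_left mult.right_neutral)
    then have "imaginary_unit a" unfolding a_def by (intro imaginary_unit_normalize s)
    moreover have "Rm a *v u = e j"
      unfolding a_def s_def
      by (rule Rm_swap(2)[OF assms(1) imaginary_unit_axis[OF \<open>j \<noteq> 0\<close>]])
         (use s \<open>bil s s \<noteq> 0\<close> in \<open>simp add: power_divide flip: s_def power2_eq_square\<close>)
    moreover have "Rm (e j) *v e j = e j" using assms by (simp add: vec_eq_iff)
    moreover have "real_vector a" if "real_vector u"
      using that real_vector_csqrt[of s] by (simp add: a_def) (simp add: s_def)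
    ultimately show ?thesis using imaginary_unit_axis[OF \<open>j \<noteq> 0\<close>] assms
      by (intro exI[of _ a] exI[of _ "e j"]) (auto simp: a_def s_def simp del: Rm_mult)
  next
    case True
    define a where "a = (1/2) *s (u - e j)"
    have "imaginary_unit a" using assms True by unfold_locales (simp_all add: a_def)
    moreover have "Rm (e l) *v (Rm a *v u) = e j"
      using assms True by (simp add: a_def vec_eq_iff)
    ultimately show ?thesis using imaginary_unit_axis[OF \<open>l \<noteq> 0\<close>] assms
      by (intro exI[of _ a] exI[of _ "e l"]) (auto simp: a_def simp del: Rm_mult)
  qed
  then obtain a b where ab: "imaginary_unit a" "imaginary_unit b" "Rm b *v (Rm a *v u) = e j"
    "\<forall>i\<in>I. a $ i = 0 \<and> b $ i = 0" "real_vector u \<longrightarrow> real_vector a \<and> real_vector b" by blast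
  show ?thesis
  proof
    show "spin_pair (Rm b ** Rm a) (Lm b ** Lm a)" using ab by (simp add: spin_pair_Lm_Lm)
    show "(Rm b ** Rm a) *v u = e j" using ab by (simp flip: matrix_vector_mul_assoc)
    show "(Rm b ** Rm a) *v e i = e i" if "i \<in> I" for i
      using ab that imaginary_unit.imag[OF ab(1)] imaginary_unit.imag[OF ab(2)]
      by (cases "i = 0") (simp_all add: vec_eq_iff flip: matrix_vector_mul_assoc)
    show "mcnj (Lm b ** Lm a) = Lm b ** Lm a" if "real_vector u"
      using that ab by (simp add: Lm_real)
  qed
qed

lemma SO7_spin_step:
  assumes "g \<in> SO7" "\<And>i. i \<in> I \<Longrightarrow> g *v e i = e i"
    and "j \<notin> I" "l \<notin> I" "j \<noteq> 0" "l \<noteq> 0" "j \<noteq> l"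
  obtains p0 p where "spin_pair p0 p" "\<And>i. i \<in> insert j I \<Longrightarrow> (p0 ** g) *v e i = e i"
proof -
  have g: "g \<in> SO8" using assms by (simp add: SO7_iff)
  have "imaginary_unit (g *v e j)"
    using SO8_bil[OF g, of "e j" "e j"] SO7_nth_0[OF assms(1), of "e j"] assms
    by unfold_locales (simp_all del: matrix_axis_nth)
  moreover have "(g *v e j) $ i = 0" if "i \<in> I" for i
    using SO8_bil[OF g, of "e j" "e i"] assms that
    by (metis axis_1_nth bil_axis(2))
  ultimately obtain p0 p where "spin_pair p0 p" "p0 *v (g *v e j) = e j" "\<And>i. i \<in> I \<Longrightarrow> p0 *v e i = e i"
    using spin_step[of "g *v e j" I j l] assms by metis
  then have "spin_pair p0 p" "\<And>i. i \<in> insert j I \<Longrightarrow> (p0 ** g) *v e i = e i"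
    using assms by (auto simp flip: matrix_vector_mul_assoc)
  then show ?thesis by (rule that)
qed

lemma SO7_fix_six:
  assumes "g \<in> SO7" "\<And>i. i \<in> {1,2,3,4,5,6} \<Longrightarrow> g *v e i = e i"
  shows "g = mat 1"
proof -
  have g: "g \<in> SO8" "g *v e 0 = e 0" using assms by (auto simp: SO7_iff)
  have fixed: "g *v e i = e i" if "i \<noteq> 7" for i
    using that assms(2)[of i] g exhaust_8[of i] by auto
  have 7: "g $ i $ 7 = 0" if "i \<noteq> 7" for i
    using SO8_bil[OF g(1), of "e i" "e 7"] fixed[OF that] that by simp
  have col: "g $ i $ j = (if i = j then 1 else 0)" if "j \<noteq> 7" for i j
    using fixed[OF that] by (metis axis_1_nth matrix_axis_nth)
  have "det g = (\<Prod>i\<in>UNIV. g $ i $ i)"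
    by (rule det_diagonal) (metis 7 col)
  also have "\<dots> = g $ 7 $ 7"
    unfolding UNIV_8 by (simp add: col)
  finally have "g $ 7 $ 7 = 1" using g by (simp add: SO8_D)
  with 7 col show ?thesis by (auto simp: vec_eq_iff mat_def) metis+
qed

lemma SO7_lift:
  assumes "g \<in> SO7" obtains g' where "spin_pair g g'"
proof -
  have step: "\<exists>p0 p. spin_pair p0 p \<and> (\<forall>i\<in>insert j I. (p0 ** g) *v e i = e i)"
    if I: "\<exists>p0 p. spin_pair p0 p \<and> (\<forall>i\<in>I. (p0 ** g) *v e i = e i)" and j: "j \<notin> I" "7 \<notin> I" "j \<noteq> 0" "j \<noteq> 7" for I j
  proof -
    obtain p0 p where p: "spin_pair p0 p" "\<forall>i\<in>I. (p0 ** g) *v e i = e i" using I by blast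
    then have "p0 ** g \<in> SO7" using assms by (simp add: spin_pair_def SO7_mult)
    then obtain q0 q where "spin_pair q0 q" "\<And>i. i \<in> insert j I \<Longrightarrow> (q0 ** (p0 ** g)) *v e i = e i"
    proof (rule SO7_spin_step[of "p0 ** g" I j 7])
      show "(p0 ** g) *v e i = e i" if "i \<in> I" for i using p that by blast
    qed (use j in auto)
    then show ?thesis using p spin_pair_mult by (metis matrix_mul_assoc)
  qed
  have "\<exists>p0 p. spin_pair p0 p \<and> (\<forall>i\<in>{6,5,4,3,2,1}. (p0 ** g) *v e i = e i)"
    by (intro step) (use spin_pair_one in auto)
  then obtain p0 p where p: "spin_pair p0 p" "\<forall>i\<in>{6,5,4,3,2,1}. (p0 ** g) *v e i = e i" by blast
  have "p0 ** g = mat 1"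
    using p assms by (intro SO7_fix_six) (auto simp: spin_pair_def SO7_mult)
  then have "g = transpose p0"
    using p by (metis SO7_iff SO8_D(2) matrix_mul_assoc matrix_mul_lid matrix_mul_rid spin_pair_def)
  with p spin_pair_transpose that show ?thesis by blast
qed

lemma real_orthonormal_exists:
  assumes "finite S" "card S < 8" "\<And>x. x \<in> S \<Longrightarrow> real_vector x"
  obtains b where "real_vector b" "bil b b = 1" "\<And>x. x \<in> S \<Longrightarrow> bil x b = 0"
proof -
  define re :: "complex^8 \<Rightarrow> real^8" where "re x = (\<chi> i. Re (x $ i))" for x
  have "dim (re ` S) \<le> card (re ` S)" using assms by (intro dim_le_card') auto
  also have "\<dots> < DIM(real^8)" using assms card_image_le[of S re] by simp
  finally obtain y where y: "y \<noteq> 0" "\<And>x. x \<in> span (re ` S) \<Longrightarrow> orthogonal y x"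
    using orthogonal_to_subspace_exists by metis
  define b where "b = (\<chi> i. complex_of_real (y $ i / norm y))"
  show ?thesis
  proof
    show "real_vector b" by (simp add: b_def vec_eq_iff)
    have "bil b b = of_real (\<Sum>i\<in>UNIV. y $ i * y $ i) / of_real (norm y * norm y)"
      by (simp add: bil_def b_def flip: sum_divide_distrib)
    also have "(\<Sum>i\<in>UNIV. y $ i * y $ i) = norm y * norm y"
      using power2_norm_eq_inner[of y] by (simp add: inner_vec_def power2_eq_square)
    finally show "bil b b = 1" using y by simp
    show "bil x b = 0" if "x \<in> S" for x
    proof -
      have "x $ i = of_real (Re (x $ i))" for i
        using assms(3)[OF that] by (simp add: real_vector_Reals)
      then have "bil x b = (\<Sum>i\<in>UNIV. of_real (Re (x $ i)) * of_real (y $ i / norm y))"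
        unfolding bil_def b_def vec_lambda_beta by metis
      also have "\<dots> = of_real (inner y (re x)) / of_real (norm y)"
        by (simp add: re_def inner_vec_def mult.commute flip: sum_divide_distrib)
      also have "inner y (re x) = 0"
        using y(2)[of "re x"] that by (simp add: span_base orthogonal_def)
      finally show ?thesis by simp
    qed
  qed
qed

lemma G2_iff_spin_pair: "g \<in> G2 \<longleftrightarrow> spin_pair g g"
proof
  assume g: "g \<in> G2"
  then have "(g *v e 0) \<bullet>\<^sub>C (g *v (transpose g *v e 0)) = g *v (e 0 \<bullet>\<^sub>C (transpose g *v e 0))"
    unfolding G2_def by blast
  then have "g *v e 0 = e 0" using g by (simp add: G2_def)
  with g show "spin_pair g g" by (simp add: spin_pair_def G2_def SO7_iff)
qed (auto simp: spin_pair_def G2_def)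

lemma spin_pair_fix_e0:
  assumes "spin_pair g0 g" "g *v e 0 = e 0" shows "g0 = g"
proof -
  have "transpose g *v e 0 = e 0"
    using assms by (metis SO8_cancel(1) spin_pair_def)
  then show ?thesis
    using spin_pair_vector[OF assms(1)] by (simp add: cmat_eq_iff)
qed

lemma G2_iff_Spin7: "g \<in> G2 \<longleftrightarrow> g \<in> Spin7 \<and> g *v e 0 = e 0"
  unfolding G2_iff_spin_pair Spin7_iff using spin_pair_fix_e0 by (auto simp: spin_pair_def SO7_iff)

text \<open>A spin pair whose first component moves \<open>(e\<^sub>1, e\<^sub>2)\<close> to \<open>(u, v)\<close> sends \<open>e\<^sub>0\<close> to some \<open>w\<close> in the second;
  multiplying by \<open>L\<^sub>a L\<^sub>b\<close> with \<open>a, b\<close> orthogonal to \<open>u, v\<close> and \<open>a = - b w\<close> brings \<open>w\<close> back to \<open>e\<^sub>0\<close>.\<close>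

lemma G2_real_frame:
  assumes "imaginary_unit u" "imaginary_unit v" "bil u v = 0" "real_vector u" "real_vector v"
  obtains h where "h \<in> G2" "mcnj h = h" "h *v e 1 = u" "h *v e 2 = v"
proof -
  interpret u: imaginary_unit u by fact
  interpret v: imaginary_unit v by fact
  obtain p0 p where p: "spin_pair p0 p" "p0 *v u = e 1" "mcnj p = p"
    using spin_step[OF assms(1), of "{}" 1 7] assms(4) by auto
  then have p0: "mcnj p0 = p0" "p0 \<in> SO7" "p0 \<in> SO8"
    using spin_pair_real by (auto simp: spin_pair_def SO7_iff)
  have "imaginary_unit (p0 *v v)"
    using p0 by unfold_locales (simp_all add: SO7_nth_0 SO8_bil)
  moreover have "(p0 *v v) $ 1 = 0"
    using SO8_bil[OF p0(3), of u v] assms p by simp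
  moreover have "real_vector (p0 *v v)" using assms p0 by simp
  ultimately obtain q0 q where q: "spin_pair q0 q" "q0 *v (p0 *v v) = e 2" "q0 *v e 1 = e 1" "mcnj q = q"
    using spin_step[of "p0 *v v" "{1}" 2 7] by auto
  define g0 g where "g0 = transpose (q0 ** p0)" and "g = transpose (q ** p)"
  have g: "spin_pair g0 g" unfolding g_def g0_def
    by (intro spin_pair_transpose spin_pair_mult p q)
  have g_real: "mcnj g = g" using p q by (simp add: g_def)
  have SO8: "q0 \<in> SO8" "p0 \<in> SO8" "g \<in> SO8" using p q g by (auto simp: spin_pair_def SO7_iff)
  have g0: "g0 *v e 1 = u" "g0 *v e 2 = v"
    unfolding g0_def matrix_transpose_mul using p q SO8
    by (metis SO8_cancel(1) matrix_vector_mul_assoc)+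
  define w where "w = g *v e 0"
  have w: "real_vector w" "bil w w = 1" using g_real SO8 by (simp_all add: w_def SO8_bil)
  obtain b where b: "real_vector b" "bil b b = 1"
    "\<And>x. x \<in> {e 0, u, v, w, u \<bullet>\<^sub>C w, v \<bullet>\<^sub>C w} \<Longrightarrow> bil x b = 0"
  proof (rule real_orthonormal_exists)
    show "card {e 0, u, v, w, u \<bullet>\<^sub>C w, v \<bullet>\<^sub>C w} < 8"
      using card_length[of "[e 0, u, v, w, u \<bullet>\<^sub>C w, v \<bullet>\<^sub>C w]"] by simp
  qed (use w assms in auto)
  interpret b: imaginary_unit b using b(2) b(3)[of "e 0"] by unfold_locales auto
  define a where "a = - (b \<bullet>\<^sub>C w)"
  have bil_w: "bil w b = 0" "bil u b = 0" "bil v b = 0" "bil (u \<bullet>\<^sub>C w) b = 0" "bil (v \<bullet>\<^sub>C w) b = 0"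
    using b(3) by blast+
  have perp: "bil a x = 0" if x: "x $ 0 = 0" "bil x b = 0" "bil (x \<bullet>\<^sub>C w) b = 0" for x
  proof -
    have "b \<bullet>\<^sub>C x = - (x \<bullet>\<^sub>C b)"
      using cayley_mult_clifford[of b x "e 0"] x by (simp add: eq_neg_iff_add_eq_0 bil_commute[of b x])
    then have "bil a x = - bil w (x \<bullet>\<^sub>C b)"
      by (simp add: a_def bil_cayley_mult_imaginary)
    also have "\<dots> = 0"
      using x bil_cayley_mult_imaginary[OF x(1), of w b] by simp
    finally show ?thesis .
  qed
  have "bil (b \<bullet>\<^sub>C w) (e 0) = - bil w b"
    by (subst bil_cayley_mult_imaginary) (simp_all del: bil_axis)
  then have a0: "(b \<bullet>\<^sub>C w) $ 0 = 0" using bil_w by simp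
  interpret a: imaginary_unit a
    using a0 w by unfold_locales (simp_all add: a_def b.bil_Lm)
  define h where "h = Lm a ** Lm b ** g"
  have h: "spin_pair (Rm a ** Rm b ** g0) h" unfolding h_def
    by (intro spin_pair_mult spin_pair_Lm_Lm g a.imaginary_unit_axioms b.imaginary_unit_axioms)
  have "h *v e 0 = a \<bullet>\<^sub>C (b \<bullet>\<^sub>C w)" by (simp add: h_def w_def flip: matrix_vector_mul_assoc)
  also have "\<dots> = e 0"
    using cayley_mult_imaginary_self[OF a0] w by (simp add: a_def b.bil_Lm)
  finally have "h *v e 0 = e 0" .
  then have "Rm a ** Rm b ** g0 = h" using h spin_pair_fix_e0 by blast
  then have h0: "h *v x = Rm a *v (Rm b *v (g0 *v x))" for x
    by (metis matrix_vector_mul_assoc)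
  show ?thesis
  proof
    show "h \<in> G2" using h \<open>h *v e 0 = e 0\<close> by (auto simp: G2_iff_Spin7 Spin7_iff)
    show "mcnj h = h" using g_real w b by (simp add: h_def a_def Lm_real)
    show "h *v e 1 = u"
      unfolding h0 g0 using perp[of u] bil_w by (simp add: bil_commute[of b u] vec_eq_iff)
    show "h *v e 2 = v"
      unfolding h0 g0 using perp[of v] bil_w by (simp add: bil_commute[of b v] vec_eq_iff)
  qed
qed

lemma Spin7_real_frame:
  assumes "bil u u = 1" "bil v v = 1" "bil u v = 0" "real_vector u" "real_vector v"
  obtains h where "h \<in> Spin7" "mcnj h = h" "h *v e 0 = u" "h *v e 1 = v"
proof -
  obtain a where a: "real_vector a" "bil a a = 1" "\<And>x. x \<in> {e 0, u} \<Longrightarrow> bil x a = 0"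
  proof (rule real_orthonormal_exists[of "{e 0, u}"])
    show "card {e 0, u} < 8" using card_length[of "[e 0, u]"] by simp
  qed (use assms in auto)
  interpret a: imaginary_unit a using a(2) a(3)[of "e 0"] by unfold_locales auto
  define b where "b = - (a \<bullet>\<^sub>C u)"
  have "bil (a \<bullet>\<^sub>C u) (e 0) = 0"
    using a(3)[of u] unfolding bil_cayley_mult_imaginary[OF a.imag] by (simp del: bil_axis)
  then interpret b: imaginary_unit b
    using assms by unfold_locales (simp_all add: b_def a.bil_Lm)
  define k where "k = Lm a ** Lm b"
  have k: "spin_pair (Rm a ** Rm b) k" unfolding k_def
    by (intro spin_pair_Lm_Lm a.imaginary_unit_axioms b.imaginary_unit_axioms)
  have k_real: "mcnj k = k" using a assms by (simp add: k_def b_def Lm_real)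
  have ke0: "k *v e 0 = u"
    by (simp add: k_def b_def cayley_mult_imaginary_twice flip: matrix_vector_mul_assoc)
  have k_SO8: "k \<in> SO8" using k by (simp add: spin_pair_def)
  define v' where "v' = transpose k *v v"
  have v': "k *v v' = v" using k_SO8 by (simp add: v'_def)
  have "real_vector v'" using k_real assms by (simp add: v'_def)
  moreover interpret v': imaginary_unit v'
  proof
    show "v' $ 0 = 0" using SO8_bil[OF k_SO8, of "e 0" v'] ke0 v' assms by simp
    show "bil v' v' = 1" using SO8_bil[OF k_SO8, of v' v'] v' assms by simp
  qed
  obtain c where c: "real_vector c" "bil c c = 1" "\<And>x. x \<in> {e 0, v'} \<Longrightarrow> bil x c = 0"
  proof (rule real_orthonormal_exists[of "{e 0, v'}"])
    show "card {e 0, v'} < 8" using card_length[of "[e 0, v']"] by simp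
  qed (use \<open>real_vector v'\<close> in auto)
  have "imaginary_unit c" using c(2) c(3)[of "e 0"] by unfold_locales auto
  moreover have "bil v' c = 0" using c(3) by blast
  ultimately obtain h where "h \<in> G2" "mcnj h = h" "h *v e 1 = v'"
    using G2_real_frame[OF v'.imaginary_unit_axioms _ _ _ c(1)] by metis
  moreover have "k ** h \<in> Spin7" using \<open>h \<in> G2\<close> k spin_pair_mult
    unfolding G2_iff_spin_pair Spin7_iff by blast
  ultimately show ?thesis
    using that[of "k ** h"] k_real ke0 v' G2_iff_Spin7 by (simp flip: matrix_vector_mul_assoc)
qed

lemma complex_sphere_frame:
  assumes "bil z z = 1"
  obtains t u v where "real_vector u" "real_vector v" "bil u u = 1" "bil v v = 1" "bil u v = 0"
    "z = of_real (cosh t) *s u + (\<i> * of_real (sinh t)) *s v"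
    "z $ 0 = 0 \<Longrightarrow> u $ 0 = 0 \<and> v $ 0 = 0"
proof -
  define x y :: "complex^8" where "x = (\<chi> i. of_real (Re (z $ i)))" and "y = (\<chi> i. of_real (Im (z $ i)))"
  have z: "z = x + \<i> *s y"
    by (simp add: vec_eq_iff x_def y_def complex_eq[symmetric])
  have real: "real_vector x" "real_vector y" by (simp_all add: x_def y_def vec_eq_iff)
  obtain p where p: "bil x x = of_real p" using real real_vector_bil by blast
  obtain q where q: "bil y y = of_real q" "q \<ge> 0" using real real_vector_bil real_vector_bil_nonneg by blast
  obtain r where r: "bil x y = of_real r" using real real_vector_bil by blast
  have "of_real (p - q) + \<i> * of_real (2 * r) = (1::complex)"
    using assms p q r by (simp add: z bil_commute[of y x] algebra_simps)
  then have "p = 1 + q" "r = 0" by (auto simp: complex_eq_iff)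
  define t where "t = arsinh (sqrt q)"
  have sinh: "sinh t = sqrt q" by (simp add: t_def)
  have cosh: "cosh t = sqrt p"
    using cosh_square_eq[of t] cosh_real_nonneg[of t] q \<open>p = 1 + q\<close> sinh
    by (metis add.commute real_sqrt_pow2 real_sqrt_unique)
  define u where "u = of_real (1 / cosh t) *s x"
  have x: "x = of_real (cosh t) *s u" by (simp add: u_def)
  have cc: "cosh t * cosh t = p" using cosh q \<open>p = 1 + q\<close> by simp
  have u: "real_vector u" "bil u u = 1"
    using real p by (simp_all add: u_def cc[symmetric])
  obtain v where v: "real_vector v" "bil v v = 1" "bil u v = 0" "y = of_real (sinh t) *s v"
    "z $ 0 = 0 \<Longrightarrow> v $ 0 = 0"
  proof (cases "q = 0")
    case True
    obtain v where v: "real_vector v" "bil v v = 1" "\<And>x. x \<in> {e 0, u} \<Longrightarrow> bil x v = 0"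
    proof (rule real_orthonormal_exists[of "{e 0, u}"])
      show "card {e 0, u} < 8" using card_length[of "[e 0, u]"] by simp
    qed (use u in auto)
    moreover have "y = 0" using True q real real_vector_bil_eq_0 by simp
    ultimately show ?thesis using that[of v] v(3)[of "e 0"] v(3)[of u] True sinh by simp
  next
    case False
    define v where "v = of_real (1 / sinh t) *s y"
    have ss: "sinh t * sinh t = q" "sinh t \<noteq> 0" using sinh q False by simp_all
    show ?thesis
    proof (rule that[of v])
      show "real_vector v" "bil u v = 0" using real r \<open>r = 0\<close> by (simp_all add: v_def u_def)
      show "y = of_real (sinh t) *s v" using ss by (simp add: v_def)
      show "bil v v = 1" using q ss False by (simp add: v_def flip: of_real_mult)
      show "v $ 0 = 0" if "z $ 0 = 0" using that by (simp add: v_def y_def)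
    qed
  qed
  show ?thesis
  proof (rule that[of u v t])
    show "z = of_real (cosh t) *s u + (\<i> * of_real (sinh t)) *s v"
      using z x v by (simp add: vec_eq_iff)
    show "u $ 0 = 0 \<and> v $ 0 = 0" if "z $ 0 = 0" using that v by (simp add: u_def x_def)
  qed (use u v in auto)
qed

section \<open>The matrix exponential and Lie algebras\<close>

lemma bounded_bilinear_matrix_vector: "bounded_bilinear ((*v) :: cmat \<Rightarrow> complex^8 \<Rightarrow> complex^8)"
  unfolding bilinear_conv_bounded_bilinear[symmetric] bilinear_def
  by (auto intro!: linearI simp: matrix_vector_mult_def vec_eq_iff sum.distrib distrib_left distrib_right scaleR_sum_right)

lemma bounded_bilinear_matrix: "bounded_bilinear ((**) :: cmat \<Rightarrow> cmat \<Rightarrow> cmat)"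
  unfolding bilinear_conv_bounded_bilinear[symmetric] bilinear_def
  by (auto intro!: linearI simp: matrix_matrix_mult_def vec_eq_iff sum.distrib distrib_left distrib_right scaleR_sum_right)

interpretation mv: bounded_bilinear "(*v) :: cmat \<Rightarrow> complex^8 \<Rightarrow> complex^8"
  by (rule bounded_bilinear_matrix_vector)

interpretation mm: bounded_bilinear "(**) :: cmat \<Rightarrow> cmat \<Rightarrow> cmat"
  by (rule bounded_bilinear_matrix)

definition mpow :: "cmat \<Rightarrow> nat \<Rightarrow> cmat" where "mpow X n = (((**) X) ^^ n) (mat 1)"

lemma mpow_simps [simp]: "mpow X 0 = mat 1" "mpow X (Suc n) = X ** mpow X n"
  by (simp_all add: mpow_def)

lemma mpow_commute: "mpow X n ** X = X ** mpow X n"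
  by (induction n) (simp_all flip: matrix_mul_assoc)

lemma mpow_scaleR: "mpow (t *\<^sub>R X) n = (t ^ n) *\<^sub>R mpow X n"
  by (induction n) (simp_all add: mm.scaleR_left mm.scaleR_right)

lemma norm_mpow_nth_le: "norm (mpow X n $ i $ j) \<le> (\<Sum>i\<in>UNIV. \<Sum>j\<in>UNIV. norm (X $ i $ j)) ^ n"
proof (induction n arbitrary: i)
  case 0
  then show ?case by (simp add: mat_def)
next
  case (Suc n)
  define M where "M = (\<Sum>i\<in>UNIV. \<Sum>j\<in>UNIV. norm (X $ i $ j))"
  have "norm (mpow X (Suc n) $ i $ j) \<le> (\<Sum>k\<in>UNIV. norm (X $ i $ k) * norm (mpow X n $ k $ j))"
    by (simp add: matrix_matrix_mult_def norm_mult[symmetric] norm_sum)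
  also have "\<dots> \<le> (\<Sum>k\<in>UNIV. norm (X $ i $ k) * M ^ n)"
    using Suc unfolding M_def by (intro sum_mono mult_left_mono) auto
  also have "\<dots> = (\<Sum>k\<in>UNIV. norm (X $ i $ k)) * M ^ n"
    by (simp add: sum_distrib_right)
  also have "\<dots> \<le> M * M ^ n"
    unfolding M_def by (intro mult_right_mono member_le_sum) (auto intro!: sum_nonneg zero_le_power)
  finally show ?case by (simp add: M_def)
qed

lemma summable_mpow:
  "summable (\<lambda>n. (mpow X n $ i $ j / fact n) * z ^ n)"
proof (rule summable_comparison_test')
  define M where "M = (\<Sum>i\<in>UNIV. \<Sum>j\<in>UNIV. norm (X $ i $ j))"
  show "summable (\<lambda>n. inverse (fact n) * (M * norm z) ^ n)" by (rule summable_exp)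
  show "norm ((mpow X n $ i $ j / fact n) * z ^ n) \<le> inverse (fact n) * (M * norm z) ^ n" for n
    using mult_left_mono[OF norm_mpow_nth_le[of X n i j], of "norm z ^ n"]
    by (simp add: norm_mult norm_divide norm_power power_mult_distrib M_def field_simps)
qed

lemma mat_exp_sums: "(\<lambda>n. (t ^ n / fact n) *\<^sub>R mpow X n) sums mat_exp (t *\<^sub>R X)"
  and mat_exp_nth: "mat_exp (t *\<^sub>R X) $ i $ j = (\<Sum>n. (mpow X n $ i $ j / fact n) * of_real t ^ n)"
proof -
  define E where "E = (\<chi> i j. \<Sum>n. (mpow X n $ i $ j / fact n) * of_real t ^ n)"
  have "(\<lambda>n. (mpow X n $ i $ j / fact n) * of_real t ^ n) sums (E $ i $ j)" for i j
    using summable_mpow by (simp add: E_def summable_sums)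
  then have *: "(\<lambda>n. (t ^ n / fact n) *\<^sub>R mpow X n) sums E"
    unfolding sums_def by (intro vec_tendstoI) (simp add: scaleR_conv_of_real[where 'a=complex] mult.commute)
  moreover have "mat_exp (t *\<^sub>R X) = (\<Sum>n. (t ^ n / fact n) *\<^sub>R mpow X n)"
    by (simp add: mat_exp_def mpow_def[symmetric] mpow_scaleR field_simps)
  ultimately have "mat_exp (t *\<^sub>R X) = E" using sums_unique[OF *] by simp
  with * show "(\<lambda>n. (t ^ n / fact n) *\<^sub>R mpow X n) sums mat_exp (t *\<^sub>R X)"
    "mat_exp (t *\<^sub>R X) $ i $ j = (\<Sum>n. (mpow X n $ i $ j / fact n) * of_real t ^ n)"
    by (simp_all add: E_def)
qed

lemma has_vector_derivative_vecI:
  assumes "\<And>i. ((\<lambda>t. f t $ i) has_vector_derivative (f' $ i)) (at t within S)"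
  shows "(f has_vector_derivative (f' :: 'a::euclidean_space^'n)) (at t within S)"
proof -
  have ax: "axis i (x + y) = axis i x + axis i y" "axis i (r *\<^sub>R x) = r *\<^sub>R axis i x"
    for i and x y :: 'a and r
    by (rule vec_eq_iff[THEN iffD2], rule allI, simp only: axis_def vec_lambda_beta vector_add_component
        vector_scaleR_component, simp split: if_split)+
  have "bounded_linear (axis i :: 'a \<Rightarrow> 'a^'n)" for i
    by (rule linear_conv_bounded_linear[THEN iffD1], rule linearI, rule ax, rule ax)
  from bounded_linear.has_vector_derivative[OF this assms]
  have "((\<lambda>t. \<Sum>i\<in>UNIV. axis i (f t $ i)) has_vector_derivative (\<Sum>i\<in>UNIV. axis i (f' $ i))) (at t within S)"
    by (rule has_vector_derivative_sum)
  moreover have "(\<Sum>i\<in>UNIV. axis i (x $ i)) = x" for x :: "'a^'n"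
    by (simp add: vec_eq_iff axis_def if_distrib cong: if_cong)
  ultimately show ?thesis by simp
qed

lemma mat_exp_has_vector_derivative:
  "((\<lambda>t. mat_exp (t *\<^sub>R X)) has_vector_derivative (X ** mat_exp (t *\<^sub>R X))) (at t)"
proof (intro has_vector_derivative_vecI)
  fix i j
  define c where "c i n = mpow X n $ i $ j / fact n" for i n
  have summ: "summable (\<lambda>n. c i n * z ^ n)" for i z
    unfolding c_def by (rule summable_mpow)
  have "((\<lambda>z. \<Sum>n. c i n * z ^ n) has_field_derivative (\<Sum>n. diffs (c i) n * of_real t ^ n)) (at (of_real t))"
    by (rule termdiffs_strong_converges_everywhere) (rule summ)
  then have "((\<lambda>t. mat_exp (t *\<^sub>R X) $ i $ j) has_vector_derivative (\<Sum>n. diffs (c i) n * of_real t ^ n)) (at t)"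
    unfolding mat_exp_nth c_def by (rule has_vector_derivative_real_field)
  moreover have "(\<Sum>n. diffs (c i) n * of_real t ^ n) = (X ** mat_exp (t *\<^sub>R X)) $ i $ j"
  proof -
    have "diffs (c i) n = (\<Sum>k\<in>UNIV. X $ i $ k * c k n)" for n
      by (simp add: diffs_def c_def matrix_matrix_mult_def sum_divide_distrib sum_distrib_left field_simps del: of_nat_Suc)
    then have "(\<Sum>n. diffs (c i) n * of_real t ^ n) = (\<Sum>n. \<Sum>k\<in>UNIV. X $ i $ k * (c k n * of_real t ^ n))"
      by (simp add: sum_distrib_right mult.assoc)
    also have "\<dots> = (\<Sum>k\<in>UNIV. \<Sum>n. X $ i $ k * (c k n * of_real t ^ n))"
      by (intro suminf_sum summable_mult summ)
    also have "\<dots> = (\<Sum>k\<in>UNIV. X $ i $ k * mat_exp (t *\<^sub>R X) $ k $ j)"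
      unfolding mat_exp_nth c_def[symmetric] by (intro sum.cong refl suminf_mult summ)
    finally show ?thesis by (simp add: matrix_matrix_mult_def)
  qed
  ultimately show "((\<lambda>t. mat_exp (t *\<^sub>R X) $ i $ j) has_vector_derivative (X ** mat_exp (t *\<^sub>R X)) $ i $ j) (at t)"
    by simp
qed

lemma mat_exp_commute: "mat_exp (t *\<^sub>R X) ** X = X ** mat_exp (t *\<^sub>R X)"
proof -
  interpret l: bounded_linear "\<lambda>A::cmat. A ** X" by (rule mm.bounded_linear_left)
  interpret r: bounded_linear "\<lambda>A::cmat. X ** A" by (rule mm.bounded_linear_right)
  show ?thesis
    using l.sums[OF mat_exp_sums[of t X]] r.sums[OF mat_exp_sums[of t X]] sums_unique2
    by (simp add: l.scaleR r.scaleR mpow_commute)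
qed

lemma mat_exp_0 [simp]: "mat_exp 0 = mat 1"
proof -
  have "(\<Sum>n. (mpow 0 n $ i $ j / fact n) * 0 ^ n) = mat 1 $ i $ j" for i j :: 8
    using powser_zero[of "\<lambda>n. mpow 0 n $ i $ j / fact n"] by simp
  then have "mat_exp (0 *\<^sub>R 0) = mat 1"
    unfolding vec_eq_iff mat_exp_nth by simp
  then show ?thesis by simp
qed

lemma mat_exp_deriv:
  "((\<lambda>t. mat_exp (t *\<^sub>R X) *v y) has_vector_derivative (X *v (mat_exp (t *\<^sub>R X) *v y))) (at t)"
  using bounded_linear.has_vector_derivative[OF mv.bounded_linear_left
      mat_exp_has_vector_derivative[of X t], of y]
  by (simp add: matrix_vector_mul_assoc)

lemma mat_exp_neg_ode:
  assumes "\<And>t. (y has_vector_derivative (X *v y t)) (at t)"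
  shows "mat_exp (t *\<^sub>R (- X)) *v y t = y 0"
proof -
  have "((\<lambda>t. mat_exp (t *\<^sub>R (- X)) *v y t) has_vector_derivative 0) (at t)" for t
  proof -
    have "((\<lambda>t. mat_exp (t *\<^sub>R (- X)) *v y t) has_vector_derivative
      (mat_exp (t *\<^sub>R (- X)) *v (X *v y t) + (- X ** mat_exp (t *\<^sub>R (- X))) *v y t)) (at t)"
      by (rule mv.has_vector_derivative[OF mat_exp_has_vector_derivative assms])
    moreover have "mat_exp (t *\<^sub>R (- X)) *v (X *v y t) = - (mat_exp (t *\<^sub>R (- X)) *v ((- X) *v y t))"
      by simp
    ultimately show ?thesis
      using mat_exp_commute[of t "- X"] by (simp only: matrix_vector_mul_assoc) simp
  qed
  then obtain c where "\<And>t. mat_exp (t *\<^sub>R (- X)) *v y t = c"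
    using has_vector_derivative_zero_constant[of UNIV "\<lambda>t. mat_exp (t *\<^sub>R (- X)) *v y t"] by auto
  then show ?thesis by (metis mat_exp_0 matrix_vector_mul_lid scaleR_zero_left)
qed

lemma mat_exp_neg: "mat_exp (t *\<^sub>R (- X)) ** mat_exp (t *\<^sub>R X) = mat 1"
  "mat_exp (t *\<^sub>R X) ** mat_exp (t *\<^sub>R (- X)) = mat 1"
proof -
  show "mat_exp (t *\<^sub>R (- X)) ** mat_exp (t *\<^sub>R X) = mat 1"
    unfolding cmat_eq_iff
    using mat_exp_neg_ode[OF mat_exp_deriv, of t X] by (simp flip: matrix_vector_mul_assoc)
  then show "mat_exp (t *\<^sub>R X) ** mat_exp (t *\<^sub>R (- X)) = mat 1"
    by (simp add: matrix_left_right_inverse)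
qed

lemma mat_exp_ode:
  assumes "\<And>t. (y has_vector_derivative (X *v y t)) (at t)"
  shows "y t = mat_exp (t *\<^sub>R X) *v y 0"
  using mat_exp_neg_ode[OF assms] mat_exp_neg(2)[of t X]
  by (metis matrix_vector_mul_assoc matrix_vector_mul_lid)

lemma mat_exp_add: "mat_exp (s *\<^sub>R X) ** mat_exp (t *\<^sub>R X) = mat_exp ((s + t) *\<^sub>R X)"
proof -
  have "mat_exp ((s + t) *\<^sub>R X) *v v = mat_exp (s *\<^sub>R X) *v (mat_exp (t *\<^sub>R X) *v v)" for v
  proof -
    have "((\<lambda>s. mat_exp ((s + t) *\<^sub>R X) *v v) has_vector_derivative (X *v (mat_exp ((s + t) *\<^sub>R X) *v v))) (at s)" for s
      using vector_diff_chain_at[of "\<lambda>s. s + t" 1 s, OF _ mat_exp_deriv[of X v]]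
      by (simp add: o_def has_vector_derivative_add_const)
    from mat_exp_ode[OF this, of s] show ?thesis by simp
  qed
  then show ?thesis by (simp add: cmat_eq_iff flip: matrix_vector_mul_assoc)
qed

lemma mat_exp_conjugate:
  assumes "S ** T = mat 1"
  shows "S ** mat_exp (t *\<^sub>R X) ** T = mat_exp (t *\<^sub>R (S ** X ** T))"
proof -
  have "T ** S = mat 1" using assms by (simp add: matrix_left_right_inverse)
  then have TS: "T *v (S *v u) = u" and ST: "S *v (T *v u) = u" for u
    using assms by (simp_all add: matrix_vector_mul_assoc)
  have *: "(S ** A ** T) *v u = S *v (A *v (T *v u))" for A u
    by (simp only: matrix_vector_mul_assoc matrix_mul_assoc)
  have "((\<lambda>t. S *v (mat_exp (t *\<^sub>R X) *v (T *v v))) has_vector_derivative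
       ((S ** X ** T) *v (S *v (mat_exp (t *\<^sub>R X) *v (T *v v))))) (at t)" for t v
    unfolding * TS
    by (rule bounded_linear.has_vector_derivative[OF mv.bounded_linear_right
          mat_exp_deriv])
  from mat_exp_ode[OF this]
  have "S *v (mat_exp (t *\<^sub>R X) *v (T *v v)) = mat_exp (t *\<^sub>R (S ** X ** T)) *v v" for v
    by (simp only: scaleR_zero_left mat_exp_0 matrix_vector_mul_lid ST)
  then show ?thesis unfolding cmat_eq_iff * by blast
qed

lemma mat_exp_mcnj: "mat_exp (t *\<^sub>R mcnj X) = mcnj (mat_exp (t *\<^sub>R X))"
proof -
  have lin: "bounded_linear vcnj"
    unfolding linear_conv_bounded_linear[symmetric] by (intro linearI) (simp_all add: vec_eq_iff)
  have "vcnj (mat_exp (t *\<^sub>R X) *v vcnj v) = mat_exp (t *\<^sub>R mcnj X) *v v" for v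
  proof -
    have "((\<lambda>t. vcnj (mat_exp (t *\<^sub>R X) *v vcnj v)) has_vector_derivative
       (vcnj (X *v (mat_exp (t *\<^sub>R X) *v vcnj v)))) (at t)" for t
      by (rule bounded_linear.has_vector_derivative[OF lin mat_exp_deriv])
    then have "((\<lambda>t. vcnj (mat_exp (t *\<^sub>R X) *v vcnj v)) has_vector_derivative
       (mcnj X *v (vcnj (mat_exp (t *\<^sub>R X) *v vcnj v)))) (at t)" for t by simp
    from mat_exp_ode[OF this, of t] show ?thesis by simp
  qed
  then have "mat_exp (t *\<^sub>R mcnj X) *v v = mcnj (mat_exp (t *\<^sub>R X)) *v v" for v
    unfolding vcnj_mult vcnj_simps by (rule sym)
  then show ?thesis unfolding cmat_eq_iff by blast
qed

lemma mat_exp_hyperbolic_rotation: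
  assumes "X *v v = \<mu> *s w" "X *v w = - (\<mu> *s v)" "\<mu> = of_real m"
  shows "mat_exp (t *\<^sub>R cscale \<i> X) *v v = of_real (cosh (m * t)) *s v + (\<i> * of_real (sinh (m * t))) *s w"
proof -
  let ?y = "\<lambda>t. of_real (cosh (m * t)) *s v + (\<i> * of_real (sinh (m * t))) *s w"
  have iX: "cscale \<i> X *v u = \<i> *s (X *v u)" for u
    by (simp add: cscale_def vec_eq_iff matrix_vector_mult_def sum_distrib_left mult.assoc)
  have "(?y has_vector_derivative (cscale \<i> X *v ?y t)) (at t)" for t
  proof (rule has_vector_derivative_vecI)
    fix i
    have "((\<lambda>t. complex_of_real (cosh (m * t)) * v $ i + (\<i> * of_real (sinh (m * t))) * w $ i) has_vector_derivative
        of_real (m * sinh (m * t)) * v $ i + (\<i> * of_real (m * cosh (m * t))) * w $ i) (at t)"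
      by (auto intro!: derivative_eq_intros has_vector_derivative_mult_left has_vector_derivative_mult_right
          has_vector_derivative_of_real simp flip: has_real_derivative_iff_has_vector_derivative)
    moreover have "(cscale \<i> X *v ?y t) $ i =
        of_real (m * sinh (m * t)) * v $ i + (\<i> * of_real (m * cosh (m * t))) * w $ i"
      unfolding iX by (simp add: matrix_vector_right_distrib vector_scalar_commute assms algebra_simps)
    ultimately show "((\<lambda>t. ?y t $ i) has_vector_derivative (cscale \<i> X *v ?y t) $ i) (at t)" by simp
  qed
  from mat_exp_ode[OF this, of t] show ?thesis by simp
qed

lemma bounded_bilinear_bil: "bounded_bilinear bil"
  unfolding bilinear_conv_bounded_bilinear[symmetric] bilinear_def
  by (auto intro!: linearI simp: bil_def sum.distrib distrib_left distrib_right scaleR_sum_right)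

lemma bounded_bilinear_cayley: "bounded_bilinear ((\<bullet>\<^sub>C) :: complex^8 \<Rightarrow> complex^8 \<Rightarrow> complex^8)"
  unfolding bilinear_conv_bounded_bilinear[symmetric] bilinear_def
  by (auto intro!: linearI simp: cayley_mult_def vec_eq_iff sum.distrib distrib_left distrib_right scaleR_sum_right)

interpretation bil: bounded_bilinear bil
  by (rule bounded_bilinear_bil)

interpretation cayley: bounded_bilinear "(\<bullet>\<^sub>C) :: complex^8 \<Rightarrow> complex^8 \<Rightarrow> complex^8"
  by (rule bounded_bilinear_cayley)

lemma mat_exp_deriv_0: "((\<lambda>t. mat_exp (t *\<^sub>R X) *v y) has_vector_derivative (X *v y)) (at 0)"
  using mat_exp_deriv[of X y 0] by simp

lemma constant_of_derivative_0:
  fixes f :: "real \<Rightarrow> 'a::real_normed_vector"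
  assumes "\<And>t. (f has_vector_derivative 0) (at t)"
  shows "f t = f 0"
proof -
  obtain c where "\<And>x. x \<in> UNIV \<Longrightarrow> f x = c"
    by (rule has_vector_derivative_zero_constant[of UNIV f]) (use assms in simp_all)
  then show ?thesis by simp
qed

definition skew :: "cmat \<Rightarrow> bool" where "skew X \<longleftrightarrow> transpose X = - X"

lemma skew_iff: "skew X \<longleftrightarrow> (\<forall>x y. bil (X *v x) y + bil x (X *v y) = 0)"
proof
  assume "\<forall>x y. bil (X *v x) y + bil x (X *v y) = 0"
  then have "bil (transpose X *v x) y = bil (- X *v x) y" for x y
    using bil_matrix[of "transpose X" x y] by (simp add: eq_neg_iff_add_eq_0 add.commute)
  then show "skew X" unfolding skew_def cmat_eq_iff using bil_eqI by blast
qed (simp add: skew_def bil_matrix)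

lemma skew_mat_exp:
  assumes "skew X" shows "mat_exp (t *\<^sub>R X) \<in> SO8"
proof -
  have orth: "transpose (mat_exp (t *\<^sub>R X)) ** mat_exp (t *\<^sub>R X) = mat 1" for t
  proof (rule orthogonal_of_bil)
    fix x y
    have "((\<lambda>t. bil (mat_exp (t *\<^sub>R X) *v x) (mat_exp (t *\<^sub>R X) *v y)) has_vector_derivative 0) (at t)" for t
      using bil.has_vector_derivative[OF mat_exp_deriv[of X x t] mat_exp_deriv[of X y t]] assms
      by (simp add: skew_iff add.commute)
    from constant_of_derivative_0[OF this, of t]
    show "bil (mat_exp (t *\<^sub>R X) *v x) (mat_exp (t *\<^sub>R X) *v y) = bil x y" by simp
  qed
  have "det (mat_exp (t *\<^sub>R X)) = det (mat_exp ((t/2) *\<^sub>R X)) * det (mat_exp ((t/2) *\<^sub>R X))"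
    using mat_exp_add[of "t/2" X "t/2"] by (simp flip: det_mul)
  also have "\<dots> = 1"
    using arg_cong[OF orth[of "t/2"], of det] by (simp add: det_mul)
  finally show ?thesis using orth by (simp add: SO8_def)
qed

lemma transpose_mat_exp:
  assumes "mat_exp (t *\<^sub>R X) \<in> SO8" shows "transpose (mat_exp (t *\<^sub>R X)) = mat_exp (t *\<^sub>R (- X))"
proof -
  have "transpose (mat_exp (t *\<^sub>R X)) =
      transpose (mat_exp (t *\<^sub>R X)) ** (mat_exp (t *\<^sub>R X) ** mat_exp (t *\<^sub>R (- X)))"
    by (simp only: mat_exp_neg(2) matrix_mul_rid)
  also have "\<dots> = mat_exp (t *\<^sub>R (- X))"
    by (simp only: matrix_mul_assoc SO8_D(2)[OF assms] matrix_mul_lid)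
  finally show ?thesis .
qed

lemma skew_of_orthogonal_curve:
  assumes "\<And>t. bil (f t) (g t) = bil (f 0) (g 0)"
    and "(f has_vector_derivative f') (at 0)" "(g has_vector_derivative g') (at 0)"
  shows "bil f' (g 0) + bil (f 0) g' = 0"
proof -
  have "((\<lambda>t. bil (f t) (g t)) has_vector_derivative (bil (f 0) g' + bil f' (g 0))) (at 0)"
    by (rule bil.has_vector_derivative[OF assms(2,3)])
  then have "((\<lambda>t::real. bil (f 0) (g 0)) has_vector_derivative (bil (f 0) g' + bil f' (g 0))) (at 0)"
    by (subst (asm) assms(1))
  then show ?thesis
    using vector_derivative_unique_at has_vector_derivative_const by (metis add.commute)
qed

lemma skew_of_mat_exp:
  assumes "\<And>t. mat_exp (t *\<^sub>R X) \<in> SO8" shows "skew X"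
  unfolding skew_iff
  using skew_of_orthogonal_curve[OF _ mat_exp_deriv_0 mat_exp_deriv_0, of X _ X] assms
  by (simp add: SO8_bil)

lemma mat_exp_fix:
  assumes "X *v v = 0" shows "mat_exp (t *\<^sub>R X) *v v = v"
  using mat_exp_ode[of "\<lambda>t. v" X t] assms by simp

lemma kernel_of_mat_exp_fix:
  assumes "\<And>t. mat_exp (t *\<^sub>R X) *v v = v" shows "X *v v = 0"
  using mat_exp_deriv_0[of X v] unfolding assms
  by (metis vector_derivative_unique_at has_vector_derivative_const)

lemma Lie_SO7: "Lie SO7 = {X. skew X \<and> X *v e 0 = 0}"
  by (auto simp: Lie_def SO7_iff skew_mat_exp mat_exp_fix intro: skew_of_mat_exp kernel_of_mat_exp_fix)

definition spin_derivation :: "cmat \<Rightarrow> cmat \<Rightarrow> bool" where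
  "spin_derivation X0 X \<longleftrightarrow> skew X0 \<and> X0 *v e 0 = 0 \<and> skew X \<and>
     (\<forall>x y. (X0 *v x) \<bullet>\<^sub>C y + x \<bullet>\<^sub>C (X *v y) = X *v (x \<bullet>\<^sub>C y))"

lemma spin_derivation_mat_exp:
  assumes "spin_derivation X0 X" shows "spin_pair (mat_exp (t *\<^sub>R X0)) (mat_exp (t *\<^sub>R X))"
proof -
  have "(mat_exp (t *\<^sub>R X0) *v x) \<bullet>\<^sub>C (mat_exp (t *\<^sub>R X) *v y) = mat_exp (t *\<^sub>R X) *v (x \<bullet>\<^sub>C y)" for x y
  proof -
    let ?f = "\<lambda>t. (mat_exp (t *\<^sub>R X0) *v x) \<bullet>\<^sub>C (mat_exp (t *\<^sub>R X) *v y)"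
    have "(?f has_vector_derivative (X *v ?f t)) (at t)" for t
      using cayley.has_vector_derivative[OF mat_exp_deriv[of X0 x t] mat_exp_deriv[of X y t]] assms
      by (simp add: spin_derivation_def add.commute)
    from mat_exp_ode[OF this, of t] show ?thesis by simp
  qed
  then show ?thesis using assms
    by (simp add: spin_pair_def spin_derivation_def SO7_iff skew_mat_exp mat_exp_fix)
qed

lemma spin_derivation_of_curve:
  assumes pair: "\<And>t. spin_pair (g0 t) (mat_exp (t *\<^sub>R X))"
    and deriv: "\<And>x. ((\<lambda>t. g0 t *v x) has_vector_derivative (X0 *v x)) (at 0)"
    and one: "g0 0 = mat 1"
  shows "spin_derivation X0 X"
  unfolding spin_derivation_def
proof (intro conjI allI)
  have *: "g0 t \<in> SO8" "g0 t *v e 0 = e 0" "mat_exp (t *\<^sub>R X) \<in> SO8"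
    "(g0 t *v x) \<bullet>\<^sub>C (mat_exp (t *\<^sub>R X) *v y) = mat_exp (t *\<^sub>R X) *v (x \<bullet>\<^sub>C y)" for t x y
    using pair[of t] by (auto simp: spin_pair_def SO7_iff)
  show "skew X" by (rule skew_of_mat_exp) (rule *)
  show "skew X0"
    unfolding skew_iff using skew_of_orthogonal_curve[OF _ deriv deriv] * one by (simp add: SO8_bil)
  show "X0 *v e 0 = 0"
    using deriv[of "e 0"] unfolding * by (metis vector_derivative_unique_at has_vector_derivative_const)
  show "(X0 *v x) \<bullet>\<^sub>C y + x \<bullet>\<^sub>C (X *v y) = X *v (x \<bullet>\<^sub>C y)" for x y
  proof -
    have "((\<lambda>t. (g0 t *v x) \<bullet>\<^sub>C (mat_exp (t *\<^sub>R X) *v y)) has_vector_derivative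
        (g0 0 *v x) \<bullet>\<^sub>C (X *v y) + (X0 *v x) \<bullet>\<^sub>C (mat_exp (0 *\<^sub>R X) *v y)) (at 0)"
      by (rule cayley.has_vector_derivative[OF deriv mat_exp_deriv_0])
    then show ?thesis
      using vector_derivative_unique_at[OF _ mat_exp_deriv_0[of X "x \<bullet>\<^sub>C y"]] one
      unfolding * by (simp add: add.commute)
  qed
qed

lemma Lie_G2: "Lie G2 = {X. spin_derivation X X}"
  using spin_derivation_mat_exp spin_derivation_of_curve[of "\<lambda>t. mat_exp (t *\<^sub>R X)" X X for X]
  by (auto simp: Lie_def G2_iff_spin_pair mat_exp_deriv_0)

lemma Lie_Spin7: "Lie Spin7 = {X. \<exists>X0. spin_derivation X0 X}"
proof (intro equalityI subsetI CollectI)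
  fix X assume X: "X \<in> Lie Spin7"
  let ?E = "\<lambda>t. mat_exp (t *\<^sub>R X)"
  define X0 where "X0 = matrix (\<lambda>x. X *v x - x \<bullet>\<^sub>C (X *v e 0))"
  have X0: "X0 *v x = X *v x - x \<bullet>\<^sub>C (X *v e 0)" for x
    unfolding X0_def
    by (rule matrix_works) (simp add: Vector_Spaces.linear_iff vec.vector_space_axioms matrix_vector_right_distrib vector_scalar_commute vec_eq_iff algebra_simps)
  have "\<forall>t. \<exists>g0. spin_pair g0 (?E t)" using X by (simp add: Lie_def Spin7_iff)
  then obtain g0 where g0: "\<And>t. spin_pair (g0 t) (?E t)" by (auto dest!: choice)
  have vec: "g0 t *v x = ?E t *v (x \<bullet>\<^sub>C (mat_exp (t *\<^sub>R (- X)) *v e 0))" for t x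
    using spin_pair_vector[OF g0[of t], of x] g0[of t] transpose_mat_exp[of t X]
    by (simp add: spin_pair_def)
  have "spin_derivation X0 X"
  proof (rule spin_derivation_of_curve[OF g0])
    show "g0 0 = mat 1" unfolding cmat_eq_iff vec by simp
    show "((\<lambda>t. g0 t *v x) has_vector_derivative X0 *v x) (at 0)" for x
    proof -
      have "((\<lambda>t. x \<bullet>\<^sub>C (mat_exp (t *\<^sub>R (- X)) *v e 0)) has_vector_derivative x \<bullet>\<^sub>C (- X *v e 0)) (at 0)"
        by (rule bounded_linear.has_vector_derivative[OF cayley.bounded_linear_right mat_exp_deriv_0])
      moreover have "(?E has_vector_derivative X) (at 0)"
        using mat_exp_has_vector_derivative[of X 0] by simp
      ultimately have "((\<lambda>t. ?E t *v (x \<bullet>\<^sub>C (mat_exp (t *\<^sub>R (- X)) *v e 0))) has_vector_derivative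
         ?E 0 *v (x \<bullet>\<^sub>C (- X *v e 0)) + X *v (x \<bullet>\<^sub>C (mat_exp (0 *\<^sub>R (- X)) *v e 0))) (at 0)"
        by (intro mv.has_vector_derivative)
      then show ?thesis unfolding vec X0 by simp
    qed
  qed
  then show "\<exists>X0. spin_derivation X0 X" by blast
next
  fix X assume "X \<in> {X. \<exists>X0. spin_derivation X0 X}"
  then show "X \<in> Lie Spin7"
    using spin_derivation_mat_exp by (auto simp: Lie_def Spin7_iff)
qed

lemma Lie_SL3: "Lie SL3 = {X \<in> Lie G2. X *v e 1 = 0}"
  by (auto simp: Lie_def SL3_def mat_exp_fix intro: kernel_of_mat_exp_fix)

definition lie_algebra :: "cmat set \<Rightarrow> bool" where
  "lie_algebra V \<longleftrightarrow> cmat.subspace V \<and> (\<forall>X\<in>V. \<forall>Y\<in>V. lie_bracket X Y \<in> V)"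

lemma cscale_mult_vector: "cscale c X *v v = c *s (X *v v)"
  by (simp add: cscale_def vec_eq_iff matrix_vector_mult_def sum_distrib_left mult.assoc)

lemma lie_bracket_mult_vector: "lie_bracket X Y *v v = X *v (Y *v v) - Y *v (X *v v)"
  by (simp add: lie_bracket_def matrix_vector_mult_diff_rdistrib flip: matrix_vector_mul_assoc)

lemma transpose_linear [simp]:
  "transpose (0::cmat) = 0" "transpose (X + Y :: cmat) = transpose X + transpose Y"
  "transpose (X - Y :: cmat) = transpose X - transpose Y" "transpose (cscale c X) = cscale c (transpose X)"
  by (simp_all add: vec_eq_iff transpose_def cscale_def)

lemma skew_0: "skew 0"
  by (simp add: skew_def)

lemma skew_add: "skew X \<Longrightarrow> skew Y \<Longrightarrow> skew (X + Y)"
  by (simp add: skew_def)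

lemma skew_cscale: "skew X \<Longrightarrow> skew (cscale c X)"
  by (simp add: skew_def)

lemma skew_lie_bracket: "skew X \<Longrightarrow> skew Y \<Longrightarrow> skew (lie_bracket X Y)"
  by (simp add: skew_def lie_bracket_def matrix_transpose_mul mm.minus_left mm.minus_right)

lemma spin_derivation_0: "spin_derivation 0 0"
  by (simp add: spin_derivation_def skew_0)

lemma spin_derivation_add:
  "spin_derivation X0 X \<Longrightarrow> spin_derivation Y0 Y \<Longrightarrow> spin_derivation (X0 + Y0) (X + Y)"
  unfolding spin_derivation_def matrix_vector_mult_add_rdistrib
  by (simp add: skew_add) (metis (no_types, lifting) add.assoc add.commute)

lemma spin_derivation_cscale:
  "spin_derivation X0 X \<Longrightarrow> spin_derivation (cscale c X0) (cscale c X)"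
  unfolding spin_derivation_def cscale_mult_vector
  by (simp add: skew_cscale flip: vector_add_ldistrib)

lemma spin_derivation_lie_bracket:
  assumes "spin_derivation X0 X" "spin_derivation Y0 Y"
  shows "spin_derivation (lie_bracket X0 Y0) (lie_bracket X Y)"
proof -
  have X: "X *v (x \<bullet>\<^sub>C y) = (X0 *v x) \<bullet>\<^sub>C y + x \<bullet>\<^sub>C (X *v y)"
    and Y: "Y *v (x \<bullet>\<^sub>C y) = (Y0 *v x) \<bullet>\<^sub>C y + x \<bullet>\<^sub>C (Y *v y)" for x y
    using assms by (simp_all add: spin_derivation_def)
  show ?thesis
    using assms unfolding spin_derivation_def
    by (simp add: skew_lie_bracket lie_bracket_mult_vector X Y matrix_vector_right_distrib)
qed

lemma lie_algebra_SO7: "lie_algebra (Lie SO7)"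
  unfolding lie_algebra_def Lie_SO7
  by (auto simp: cmat.subspace_def skew_0 skew_add skew_cscale skew_lie_bracket cscale_mult_vector
      lie_bracket_mult_vector matrix_vector_mult_add_rdistrib)

lemma lie_algebra_Spin7: "lie_algebra (Lie Spin7)"
  unfolding lie_algebra_def Lie_Spin7 cmat.subspace_def
  using spin_derivation_0 spin_derivation_add spin_derivation_cscale spin_derivation_lie_bracket
  by (simp only: mem_Collect_eq Ball_def) blast

lemma lie_algebra_G2: "lie_algebra (Lie G2)"
  unfolding lie_algebra_def Lie_G2 cmat.subspace_def
  using spin_derivation_0 spin_derivation_add spin_derivation_cscale spin_derivation_lie_bracket
  by (simp only: mem_Collect_eq Ball_def) blast

section \<open>Invariance of the Killing form\<close>

lemma cmat_independent_finite:
  assumes "cmat.independent B" shows "finite B"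
proof -
  define E :: "8 \<times> 8 \<Rightarrow> cmat" where "E p = (\<chi> i j. if (i, j) = p then 1 else 0)" for p
  have "A \<in> cmat.span (range E)" for A
  proof -
    have "(\<Sum>p\<in>UNIV. cscale (A $ fst p $ snd p) (E p)) $ i $ j = A $ i $ j" for i j
    proof -
      have "(\<Sum>p\<in>UNIV. cscale (A $ fst p $ snd p) (E p)) $ i $ j
          = (\<Sum>p\<in>UNIV. A $ fst p $ snd p * (if p = (i, j) then 1 else 0))"
        by (simp add: cscale_def E_def eq_commute[of "(i, j)"])
      also have "\<dots> = A $ i $ j" by (simp add: if_distrib cong: if_cong)
      finally show ?thesis .
    qed
    then have "A = (\<Sum>p\<in>UNIV. cscale (A $ fst p $ snd p) (E p))"
      by (simp add: vec_eq_iff)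
    also have "\<dots> \<in> cmat.span (range E)"
      by (intro cmat.span_sum cmat.span_scale cmat.span_base) auto
    finally show ?thesis .
  qed
  then show ?thesis
    using cmat.independent_span_bound[of "range E" B] assms by auto
qed

lemma trace_basis_independent:
  assumes B: "cmat.independent B" "cmat.span B = V" and C: "cmat.independent C" "cmat.span C = V"
    and f: "Vector_Spaces.linear cscale cscale f" "f ` V \<subseteq> V"
  shows "(\<Sum>b\<in>B. cmat.representation B (f b) b) = (\<Sum>c\<in>C. cmat.representation C (f c) c)"
proof -
  interpret f: Vector_Spaces.linear cscale cscale f by (rule f)
  have fin: "finite B" "finite C" using B C cmat_independent_finite by auto
  have BV: "b \<in> V" "f b \<in> V" if "b \<in> B" for b
    using that B f cmat.span_base by auto
  have CV: "c \<in> V" "f c \<in> V" if "c \<in> C" for c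
    using that C f cmat.span_base by auto
  have "cmat.representation B (f b) b =
      (\<Sum>c\<in>C. cmat.representation C (f b) c * cmat.representation B c b)" if "b \<in> B" for b
  proof -
    have "cmat.representation B (f b) b =
       cmat.representation B (\<Sum>c\<in>C. cscale (cmat.representation C (f b) c) c) b"
      using cmat.sum_representation_eq[OF C(1) _ fin(2), of "f b"] C BV[OF that] by simp
    also have "\<dots> = (\<Sum>c\<in>C. cmat.representation C (f b) c * cmat.representation B c b)"
      using B CV by (subst cmat.representation_sum) (auto simp: cmat.representation_scale cmat.span_scale)
    finally show ?thesis .
  qed
  then have "(\<Sum>b\<in>B. cmat.representation B (f b) b)
      = (\<Sum>c\<in>C. \<Sum>b\<in>B. cmat.representation C (f b) c * cmat.representation B c b)"
    using sum.swap[of "\<lambda>b c. cmat.representation C (f b) c * cmat.representation B c b" C B] by simp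
  also have "\<dots> = (\<Sum>c\<in>C. cmat.representation C (f c) c)"
  proof (rule sum.cong[OF refl])
    fix c assume c: "c \<in> C"
    have "f c = f (\<Sum>b\<in>B. cscale (cmat.representation B c b) b)"
      using cmat.sum_representation_eq[OF B(1) _ fin(1), of c] B CV[OF c] by simp
    also have "\<dots> = (\<Sum>b\<in>B. cscale (cmat.representation B c b) (f b))"
      by (simp add: f.sum f.scale)
    finally have "cmat.representation C (f c) c =
        cmat.representation C (\<Sum>b\<in>B. cscale (cmat.representation B c b) (f b)) c" by simp
    also have "\<dots> = (\<Sum>b\<in>B. cmat.representation B c b * cmat.representation C (f b) c)"
      using C BV by (subst cmat.representation_sum) (auto simp: cmat.representation_scale cmat.span_scale)
    finally show "(\<Sum>b\<in>B. cmat.representation C (f b) c * cmat.representation B c b) = cmat.representation C (f c) c"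
      by (simp add: mult.commute)
  qed
  finally show ?thesis .
qed

lemma basis_exists_cmat:
  assumes "cmat.subspace V" obtains B where "cmat.independent B" "cmat.span B = V"
  using cmat.basis_exists[of V] cmat.span_minimal[OF _ assms] by (metis subset_antisym)

lemma trace_on_eq:
  assumes B: "cmat.independent B" "cmat.span B = V"
    and f: "Vector_Spaces.linear cscale cscale f" "f ` V \<subseteq> V"
  shows "trace_on V f = (\<Sum>b\<in>B. cmat.representation B (f b) b)"
proof -
  define C where "C = (SOME B. cmat.independent B \<and> cmat.span B = V)"
  have "cmat.independent C \<and> cmat.span C = V"
    unfolding C_def by (rule someI[of _ B]) (use B in simp)
  then show ?thesis
    using trace_basis_independent[OF _ _ B f, of C] by (simp add: trace_on_def C_def[symmetric])
qed

lemma linear_lie_bracket_twice: "Vector_Spaces.linear cscale cscale (\<lambda>Z. lie_bracket X (lie_bracket Y Z))"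
proof -
  have [simp]: "A ** cscale c Z = cscale c (A ** Z)" "cscale c Z ** A = cscale c (Z ** A)" for A Z c
    by (simp_all add: cmat_eq_iff cscale_mult_vector vector_scalar_commute flip: matrix_vector_mul_assoc)
  have [simp]: "cscale c (A - B) = cscale c A - cscale c B" for c A B
    by (rule cmat.scale_right_diff_distrib)
  show ?thesis
    by (simp add: Vector_Spaces.linear_iff cmat.vector_space_axioms lie_bracket_def
        mm.add_left mm.add_right mm.diff_left mm.diff_right algebra_simps del: cmat.scale_right_diff_distrib)
qed

lemma killing_add:
  assumes "lie_algebra V" "X \<in> V" "X' \<in> V" "Y \<in> V"
  shows "killing V (X + X') Y = killing V X Y + killing V X' Y"
proof -
  obtain B where B: "cmat.independent B" "cmat.span B = V"
    using assms basis_exists_cmat by (auto simp: lie_algebra_def)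
  have V: "lie_bracket U W \<in> V" if "U \<in> V" "W \<in> V" for U W
    using assms that by (auto simp: lie_algebra_def)
  have BV: "b \<in> V" if "b \<in> B" for b using that B cmat.span_base by auto
  have *: "killing V U Y = (\<Sum>b\<in>B. cmat.representation B (lie_bracket U (lie_bracket Y b)) b)" if "U \<in> V" for U
    unfolding killing_def using V that assms
    by (intro trace_on_eq[OF B linear_lie_bracket_twice]) auto
  have "X + X' \<in> V" using assms cmat.subspace_add by (auto simp: lie_algebra_def)
  moreover have "cmat.representation B (lie_bracket (X + X') (lie_bracket Y b)) b =
     cmat.representation B (lie_bracket X (lie_bracket Y b)) b +
     cmat.representation B (lie_bracket X' (lie_bracket Y b)) b" if "b \<in> B" for b
  proof -
    have "lie_bracket (X + X') (lie_bracket Y b) = lie_bracket X (lie_bracket Y b) + lie_bracket X' (lie_bracket Y b)"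
      by (simp add: lie_bracket_def mm.add_left mm.add_right)
    then show ?thesis
      using cmat.representation_add[OF B(1)] B V BV[OF that] assms by simp
  qed
  ultimately show ?thesis
    using assms by (simp add: * sum.distrib)
qed

lemma killing_conjugate:
  assumes V: "lie_algebra V" "X \<in> V" "Y \<in> V" and ST: "S ** T = mat 1" and VV: "(\<lambda>Z. S ** Z ** T) ` V = V"
  shows "killing V (S ** X ** T) (S ** Y ** T) = killing V X Y"
proof -
  define \<phi> where "\<phi> Z = S ** Z ** T" for Z :: cmat
  have TS: "T ** S = mat 1" using ST by (simp add: matrix_left_right_inverse)
  have lin: "Vector_Spaces.linear cscale cscale \<phi>"
  proof -
    have "S ** cscale c Z ** T = cscale c (S ** Z ** T)" for Z c
      by (simp add: cmat_eq_iff cscale_mult_vector vector_scalar_commute flip: matrix_vector_mul_assoc)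
    then show ?thesis
      by (simp add: Vector_Spaces.linear_iff cmat.vector_space_axioms \<phi>_def mm.add_left mm.add_right)
  qed
  interpret \<phi>: Vector_Spaces.linear cscale cscale \<phi> by (rule lin)
  have inv: "T ** \<phi> Z ** S = Z" for Z
  proof -
    have "T ** \<phi> Z ** S = (T ** S) ** Z ** (T ** S)" by (simp only: \<phi>_def matrix_mul_assoc)
    then show ?thesis by (simp add: TS)
  qed
  have inj: "inj \<phi>" by (metis inv injI)
  have mult: "\<phi> Z ** \<phi> W = \<phi> (Z ** W)" for Z W
  proof -
    have "\<phi> Z ** \<phi> W = S ** Z ** (T ** S) ** W ** T" by (simp only: \<phi>_def matrix_mul_assoc)
    then show ?thesis by (simp add: TS \<phi>_def matrix_mul_assoc)
  qed
  have br: "lie_bracket (\<phi> Z) (\<phi> W) = \<phi> (lie_bracket Z W)" for Z W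
    by (simp add: lie_bracket_def mult \<phi>.diff)
  obtain B where B: "cmat.independent B" "cmat.span B = V"
    using V basis_exists_cmat by (auto simp: lie_algebra_def)
  have fin: "finite B" using B cmat_independent_finite by auto
  have C: "cmat.independent (\<phi> ` B)" "cmat.span (\<phi> ` B) = V"
    using \<phi>.independent_injective_image[OF B(1)] inj \<phi>.span_image[of B] B VV
    by (auto simp: inj_on_def inj_def \<phi>_def[abs_def])
  have br_V: "lie_bracket U W \<in> V" if "U \<in> V" "W \<in> V" for U W
    using V that by (auto simp: lie_algebra_def)
  have \<phi>_V: "\<phi> Z \<in> V" if "Z \<in> V" for Z using VV that by (auto simp: \<phi>_def)
  have rep: "cmat.representation (\<phi> ` B) (\<phi> v) (\<phi> b) = cmat.representation B v b" if "v \<in> V" "b \<in> B" for v b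
  proof -
    have "\<phi> v = \<phi> (\<Sum>b\<in>B. cscale (cmat.representation B v b) b)"
      using cmat.sum_representation_eq[OF B(1) _ fin, of v] B that by simp
    also have "\<dots> = (\<Sum>b\<in>B. cscale (cmat.representation B v b) (\<phi> b))"
      by (simp add: \<phi>.sum \<phi>.scale)
    finally have "cmat.representation (\<phi> ` B) (\<phi> v) (\<phi> b) =
       cmat.representation (\<phi> ` B) (\<Sum>b\<in>B. cscale (cmat.representation B v b) (\<phi> b)) (\<phi> b)" by simp
    also have "\<dots> = (\<Sum>b'\<in>B. cmat.representation B v b' * cmat.representation (\<phi> ` B) (\<phi> b') (\<phi> b))"
    proof -
      have "\<phi> b' \<in> cmat.span (\<phi> ` B)" if "b' \<in> B" for b'
        using that by (simp add: cmat.span_base)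
      then show ?thesis
        by (subst cmat.representation_sum[OF C(1)])
          (simp_all add: cmat.representation_scale[OF C(1)] cmat.span_scale)
    qed
    finally have "cmat.representation (\<phi> ` B) (\<phi> v) (\<phi> b) =
       (\<Sum>b'\<in>B. cmat.representation B v b' * cmat.representation (\<phi> ` B) (\<phi> b') (\<phi> b))" .
    also have "\<dots> = (\<Sum>b'\<in>B. if b' = b then cmat.representation B v b' else 0)"
      using C inj by (intro sum.cong refl) (auto simp: cmat.representation_basis inj_eq)
    finally show ?thesis using fin that by simp
  qed
  have "killing V (\<phi> X) (\<phi> Y) =
     (\<Sum>c\<in>\<phi> ` B. cmat.representation (\<phi> ` B) (lie_bracket (\<phi> X) (lie_bracket (\<phi> Y) c)) c)"
    unfolding killing_def using br_V \<phi>_V V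
    by (intro trace_on_eq[OF C linear_lie_bracket_twice]) auto
  also have "\<dots> = (\<Sum>b\<in>B. cmat.representation (\<phi> ` B) (\<phi> (lie_bracket X (lie_bracket Y b))) (\<phi> b))"
    using inj by (subst sum.reindex) (auto simp: br inj_on_def inj_def)
  also have "\<dots> = (\<Sum>b\<in>B. cmat.representation B (lie_bracket X (lie_bracket Y b)) b)"
    using B V br_V cmat.span_base by (intro sum.cong refl rep) auto
  also have "\<dots> = killing V X Y"
    unfolding killing_def using br_V V
    by (intro trace_on_eq[OF B linear_lie_bracket_twice, symmetric]) auto
  finally show ?thesis by (simp add: \<phi>_def)
qed

section \<open>Positive matrices and the fixed point of a compact group\<close>

lemma cmat_eqI: "(\<And>x. A *v x = B *v x) \<Longrightarrow> A = (B::cmat)"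
  by (subst cmat_eq_iff) (rule allI)

definition madj :: "cmat \<Rightarrow> cmat" where "madj A = transpose (mcnj A)"

lemma madj_simps [simp]: "madj (madj A) = A" "madj (A ** B) = madj B ** madj A" "madj (mat 1) = mat 1"
  "mcnj (transpose A) = transpose (mcnj A)" "madj (transpose A) = transpose (madj A)"
  by (simp_all add: madj_def matrix_transpose_mul flip: mcnj_transpose)

lemma inner_complex_mult: "inner (a * b) c = inner b (cnj a * (c::complex))"
  by (simp add: inner_complex_def algebra_simps)

lemma inner_madj: "inner (A *v x) y = inner x (madj A *v y)"
proof -
  have "inner (A *v x) y = (\<Sum>i\<in>UNIV. \<Sum>j\<in>UNIV. inner (x $ j) (cnj (A $ i $ j) * y $ i))"
    by (simp add: inner_vec_def matrix_vector_mult_def inner_sum_left inner_complex_mult)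
  also have "\<dots> = (\<Sum>j\<in>UNIV. \<Sum>i\<in>UNIV. inner (x $ j) (cnj (A $ i $ j) * y $ i))"
    by (rule sum.swap)
  also have "\<dots> = inner x (madj A *v y)"
    by (simp add: inner_vec_def matrix_vector_mult_def inner_sum_right madj_def transpose_def)
  finally show ?thesis .
qed

lemma inner_matrix_madj: "inner (M ** A) B = inner A (madj M ** (B::cmat))"
proof -
  have "inner A' B' = (\<Sum>j\<in>UNIV. inner (A' *v e j) (B' *v e j))" for A' B' :: cmat
    unfolding inner_vec_def by (subst sum.swap) simp
  then show ?thesis by (simp add: inner_madj flip: matrix_vector_mul_assoc)
qed

lemma hermitian_iff: "madj A = A \<longleftrightarrow> (\<forall>x y. inner (A *v x) y = inner x (A *v y))"
proof
  assume "\<forall>x y. inner (A *v x) y = inner x (A *v y)"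
  then have "inner x (madj A *v y) = inner x (A *v y)" for x y by (simp flip: inner_madj)
  then have "madj A *v y = A *v y" for y
    using vector_eq_ldot by blast
  then show "madj A = A" by (simp add: cmat_eq_iff)
qed (simp add: inner_madj)

lemma scaleR_vector_complex: "r *\<^sub>R x = of_real r *s (x :: complex^8)"
  by (simp add: vec_eq_iff scaleR_conv_of_real[where 'a=complex])

lemma inner_cnj_scale: "inner (c *s x) (y :: complex^8) = inner x (cnj c *s y)"
  by (simp add: inner_vec_def inner_complex_mult)

lemma self_adjoint_eigenvector:
  fixes f :: "'a::euclidean_space \<Rightarrow> 'a"
  assumes "linear f" and adj: "\<And>x y. inner (f x) y = inner x (f y)"
    and U: "subspace U" "f ` U \<subseteq> U" "x0 \<in> U" "x0 \<noteq> 0"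
  obtains x r where "x \<in> U" "x \<noteq> 0" "f x = r *\<^sub>R x"
proof -
  interpret linear f by fact
  define S where "S = U \<inter> sphere 0 1"
  have "compact S" unfolding S_def
    using closed_subspace[OF U(1)] by (simp add: closed_Int_compact)
  moreover have "(1 / norm x0) *\<^sub>R x0 \<in> S"
    using U by (simp add: S_def subspace_scale)
  then have "S \<noteq> {}" by auto
  moreover have "continuous_on S (\<lambda>x. inner (f x) x)"
    using linear_continuous_on[OF linear_conv_bounded_linear[THEN iffD1, OF assms(1)]]
    by (intro continuous_on_inner continuous_on_id) auto
  ultimately obtain x where x: "x \<in> S" "\<And>y. y \<in> S \<Longrightarrow> inner (f y) y \<le> inner (f x) x"
    using continuous_attains_sup[of S "\<lambda>x. inner (f x) x"] by blast
  define r where "r = inner (f x) x"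
  have xU: "x \<in> U" "norm x = 1" using x by (auto simp: S_def)
  have max: "inner (f y) y \<le> r * (norm y)\<^sup>2" if "y \<in> U" for y
  proof (cases "y = 0")
    case False
    then have "(1 / norm y) *\<^sub>R y \<in> S" using that U by (simp add: S_def subspace_scale)
    from x(2)[OF this] False show ?thesis
      by (simp add: scale r_def field_simps power2_eq_square)
  qed (simp add: zero)
  define y where "y = f x - r *\<^sub>R x"
  have yU: "y \<in> U" unfolding y_def using U xU by (auto intro!: subspace_diff subspace_scale)
  have xy: "inner x y = 0" using xU
    by (simp add: y_def r_def inner_diff_right inner_commute flip: power2_norm_eq_inner)
  have fxy: "inner (f x) y = (norm y)\<^sup>2"
    using xy by (simp add: power2_norm_eq_inner) (simp add: y_def inner_diff_left)
  have "2 * \<epsilon> * (norm y)\<^sup>2 \<le> \<epsilon>\<^sup>2 * (r * (norm y)\<^sup>2 - inner (f y) y)" for \<epsilon>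
  proof -
    have "inner (f (x + \<epsilon> *\<^sub>R y)) (x + \<epsilon> *\<^sub>R y) \<le> r * (norm (x + \<epsilon> *\<^sub>R y))\<^sup>2"
      using U xU yU by (intro max subspace_add subspace_scale)
    moreover have "inner (f (x + \<epsilon> *\<^sub>R y)) (x + \<epsilon> *\<^sub>R y) = r + 2 * \<epsilon> * (norm y)\<^sup>2 + \<epsilon>\<^sup>2 * inner (f y) y"
      using fxy adj[of y x] by (simp add: add scale inner_add_left inner_add_right r_def inner_commute power2_eq_square algebra_simps)
    moreover have "(norm (x + \<epsilon> *\<^sub>R y))\<^sup>2 = 1 + \<epsilon>\<^sup>2 * (norm y)\<^sup>2"
      using xU xy unfolding power2_norm_eq_inner
      by (simp add: inner_add_left inner_add_right inner_commute power2_eq_square norm_eq_1)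
    ultimately show ?thesis by (simp add: algebra_simps)
  qed
  note * = this
  have "norm y = 0"
  proof (rule ccontr)
    assume "norm y \<noteq> 0"
    define A where "A = (norm y)\<^sup>2"
    define B where "B = \<bar>r * (norm y)\<^sup>2 - inner (f y) y\<bar> + 1"
    have "A > 0" "B > 0" using \<open>norm y \<noteq> 0\<close> by (auto simp: A_def B_def)
    have "2 * (A / B) * A \<le> (A / B)\<^sup>2 * (r * (norm y)\<^sup>2 - inner (f y) y)"
      unfolding A_def by (rule *)
    also have "\<dots> \<le> (A / B)\<^sup>2 * B"
      by (intro mult_left_mono) (auto simp: B_def)
    also have "\<dots> = (A / B) * A"
      using \<open>B > 0\<close> by (simp add: power2_eq_square)
    finally have "2 * ((A / B) * A) \<le> (A / B) * A" by (simp only: mult.assoc)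
    moreover have "(A / B) * A > 0" using \<open>A > 0\<close> \<open>B > 0\<close> by simp
    ultimately show False by linarith
  qed
  then have "f x = r *\<^sub>R x" by (simp add: y_def)
  with xU that show ?thesis by force
qed

abbreviation real_eigenvectors :: "cmat \<Rightarrow> (complex^8) set" where
  "real_eigenvectors D \<equiv> {v. \<exists>r::real. D *v v = of_real r *s v}"

lemma linear_matrix: "linear ((*v) (A::cmat))"
  by (rule bounded_linear.linear) (rule mv.bounded_linear_right)

lemma hermitian_eigenvectors_span:
  assumes "madj D = D" shows "vec.span (real_eigenvectors D) = UNIV"
proof (rule ccontr)
  define W where "W = vec.span (real_eigenvectors D)"
  assume "vec.span (real_eigenvectors D) \<noteq> UNIV"
  have sub: "subspace W" unfolding subspace_def W_def scaleR_vector_complex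
    by (auto intro: vec.span_zero vec.span_add vec.span_scale)
  have DW: "D *v w \<in> W" if "w \<in> W" for w
    using that unfolding W_def
  proof (induction rule: vec.span_induct)
    case base
    show ?case
      by (auto simp: vec.subspace_def matrix_vector_right_distrib vector_scalar_commute
          intro: vec.span_zero vec.span_add vec.span_scale)
  next
    case (step v)
    then obtain r where "D *v v = of_real r *s v" by blast
    then show ?case using step by (auto intro: vec.span_scale vec.span_base)
  qed
  define U where "U = {x. \<forall>w\<in>W. inner x w = 0}"
  have "span W \<subset> span UNIV"
    using sub \<open>vec.span (real_eigenvectors D) \<noteq> UNIV\<close> by (auto simp: W_def span_eq_iff[THEN iffD2])
  then obtain x0 where "x0 \<noteq> 0" "\<And>y. y \<in> span W \<Longrightarrow> orthogonal x0 y"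
    using orthogonal_to_subspace_exists_gen[of W UNIV] by metis
  then have "x0 \<noteq> 0" "x0 \<in> U" by (auto simp: U_def orthogonal_def span_base)
  moreover have "subspace U" by (auto simp: subspace_def U_def inner_add_left)
  moreover have "(*v) D ` U \<subseteq> U"
    using DW assms by (auto simp: U_def inner_madj)
  ultimately obtain x r where x: "x \<in> U" "x \<noteq> 0" "D *v x = r *\<^sub>R x"
    using self_adjoint_eigenvector[OF linear_matrix, of D U x0] assms hermitian_iff by metis
  then have "x \<in> W" unfolding W_def scaleR_vector_complex by (auto intro: vec.span_base)
  with x show False by (auto simp: U_def)
qed

lemma matrix_eq_on_eigenvectors:
  assumes "madj D = D" "\<And>v r. D *v v = of_real r *s v \<Longrightarrow> A *v v = B *v v"
  shows "A = (B::cmat)"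
proof -
  have "A *v v = B *v v" if "v \<in> vec.span (real_eigenvectors D)" for v
    using that
    by (induction rule: vec.span_induct)
       (use assms in \<open>auto simp: vec.subspace_def matrix_vector_right_distrib vector_scalar_commute\<close>)
  then have "A *v v = B *v v" for v
    using hermitian_eigenvectors_span[OF assms(1)] UNIV_I by metis
  then show ?thesis by (rule cmat_eqI)
qed

lemma eigenvectors_orthogonal:
  assumes "madj D = D" "D *v v = of_real r *s v" "D *v w = of_real s *s w" "r \<noteq> s"
  shows "inner v w = 0"
proof -
  have "r * inner v w = inner (D *v v) w" unfolding assms(2) by (simp flip: scaleR_vector_complex)
  also have "\<dots> = inner v (D *v w)" using assms(1) by (simp add: inner_madj)
  also have "\<dots> = s * inner v w" unfolding assms(3) by (simp flip: scaleR_vector_complex)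
  finally show ?thesis using assms(4) by simp
qed

lemma hermitian_functional_calculus:
  assumes D: "madj D = D"
  shows "\<exists>E. madj E = E \<and> (\<forall>v r. D *v v = of_real r *s v \<longrightarrow> E *v v = of_real (f r) *s v)"
proof -
  obtain B where B: "B \<subseteq> real_eigenvectors D" "vec.independent B" "real_eigenvectors D \<subseteq> vec.span B"
    by (rule vec.maximal_independent_subset)
  have span: "vec.span B = UNIV"
    using hermitian_eigenvectors_span[OF D] vec.span_mono[OF B(3)] by (auto simp: vec.span_span)
  have "\<forall>b\<in>B. \<exists>r. D *v b = of_real r *s b" using B by auto
  then obtain r where "\<forall>b\<in>B. D *v b = of_real (r b) *s b" by (rule bchoice[THEN exE])
  then have r: "\<And>b. b \<in> B \<Longrightarrow> D *v b = of_real (r b) *s b" by blast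
  obtain g where g: "Vector_Spaces.linear (*s) (*s) g" "\<And>b. b \<in> B \<Longrightarrow> g b = of_real (f (r b)) *s b"
    using vec.linear_independent_extend[OF B(2), of "\<lambda>b. of_real (f (r b)) *s b"] by auto
  define E where "E = matrix g"
  have E: "E *v b = of_real (f (r b)) *s b" if "b \<in> B" for b
    using matrix_works[OF g(1)] g(2) that by (simp add: E_def)
  have comm: "c *s (of_real s *s x) = of_real s *s (c *s x)" for c s and x :: "complex^8"
    by (simp add: vec_eq_iff)
  have Ecb: "E *v (c *s b) = f (r b) *\<^sub>R (c *s b)" if "b \<in> B" for b c
    using that by (simp only: vector_scalar_commute E comm scaleR_vector_complex)
  have E1: "inner (E *v (c *s b)) (c' *s b') = inner (c *s b) (E *v (c' *s b'))" if "b \<in> B" "b' \<in> B" for b b' c c'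
  proof (cases "r b = r b'")
    case True
    then show ?thesis using that by (simp add: Ecb)
  next
    case False
    then have "inner (c *s b) (c' *s b') = 0"
      using that r by (intro eigenvectors_orthogonal[OF D]) (auto simp: vector_scalar_commute comm)
    then show ?thesis using that by (simp add: Ecb)
  qed
  have E2: "inner (E *v x) (c' *s b') = inner x (E *v (c' *s b'))" if "b' \<in> B" for x b' c'
  proof -
    have "x \<in> vec.span B" using span by simp
    then have "\<forall>c'. inner (E *v x) (c' *s b') = inner x (E *v (c' *s b'))"
    proof (induction rule: vec.span_induct)
      case base
      show ?case
        by (auto simp: vec.subspace_def matrix_vector_right_distrib vector_scalar_commute inner_add_left
            inner_cnj_scale vector_smult_assoc)
    next
      case (step x)
      then show ?case using E1[OF step that, of 1] by simp
    qed
    then show ?thesis by blast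
  qed
  have E3: "inner (E *v x) y = inner x (E *v y)" for x y
  proof -
    have "y \<in> vec.span B" using span by simp
    then have "\<forall>x. inner (E *v x) y = inner x (E *v y)"
    proof (induction rule: vec.span_induct)
      case base
      have "inner u (c *s y) = inner (cnj c *s u) y" for u y :: "complex^8" and c
        by (simp add: inner_cnj_scale)
      then show ?case
        by (auto simp: vec.subspace_def matrix_vector_right_distrib inner_add_right vector_scalar_commute[symmetric])
           (metis vector_scalar_commute)
    next
      case (step y)
      then show ?case using E2[OF step, of _ 1] by simp
    qed
    then show ?thesis by blast
  qed
  have "madj E = E" using E3 by (simp add: hermitian_iff)
  moreover have "E *v v = of_real (f s) *s v" if v: "D *v v = of_real s *s v" for v s
  proof -
    have "inner (E *v v - of_real (f s) *s v) (c *s b) = 0" if b: "b \<in> B" for b c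
    proof -
      have "inner (E *v v) (c *s b) = f (r b) * inner v (c *s b)"
        using E3[of v "c *s b"] b by (simp add: Ecb)
      moreover have "f (r b) * inner v (c *s b) = f s * inner v (c *s b)"
        using eigenvectors_orthogonal[OF D v, of "c *s b" "r b"] r[OF b]
        by (cases "r b = s") (auto simp: vector_scalar_commute comm)
      ultimately show ?thesis by (simp add: inner_diff_left flip: scaleR_vector_complex)
    qed
    note * = this
    define u where "u = E *v v - of_real (f s) *s v"
    have "u \<in> vec.span B" using span by simp
    have "inner u x = 0" if "x \<in> vec.span B" for x
    proof -
      have "\<forall>c. inner u (c *s x) = 0" using that
      proof (induction rule: vec.span_induct)
        case base
        show ?case by (auto simp: vec.subspace_def vector_add_ldistrib inner_add_right vector_smult_assoc)
      qed (use * in \<open>auto simp: u_def\<close>)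
      from this[rule_format, of 1] show ?thesis by simp
    qed
    then have "inner u u = 0" using span by simp
    then show ?thesis by (simp add: u_def)
  qed
  ultimately show ?thesis by blast
qed

definition psd :: "cmat \<Rightarrow> bool" where
  "psd P \<longleftrightarrow> madj P = P \<and> (\<forall>x. 0 \<le> inner (P *v x) x)"

lemma psd_madj_mult: "psd (madj A ** A)"
  by (simp add: psd_def inner_madj[of "madj A"] flip: matrix_vector_mul_assoc)

lemma psd_congruence: "psd P \<Longrightarrow> psd (madj A ** P ** A)"
  by (simp add: psd_def matrix_mul_assoc) (simp add: inner_madj[of "madj A"] flip: matrix_vector_mul_assoc)

lemma psd_eigenvalue_nonneg:
  assumes "psd P" "P *v v = of_real r *s v" "v \<noteq> 0" shows "r \<ge> 0"
proof -
  have "0 \<le> inner (P *v v) v" using assms(1) by (simp add: psd_def)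
  also have "\<dots> = r * inner v v" unfolding assms(2) by (simp flip: scaleR_vector_complex)
  finally have "0 \<le> r * inner v v" .
  moreover have "inner v v > 0" using assms(3) by simp
  ultimately show ?thesis by (simp add: zero_le_mult_iff)
qed

lemma psd_sqrt:
  assumes P: "psd P"
  shows "\<exists>E. psd E \<and> E ** E = P \<and> (\<forall>v r. P *v v = of_real r *s v \<longrightarrow> E *v v = of_real (sqrt r) *s v)"
proof -
  have P': "madj P = P" using P by (simp add: psd_def)
  obtain F where F: "madj F = F" "\<And>v r. P *v v = of_real r *s v \<Longrightarrow> F *v v = of_real (sqrt (sqrt r)) *s v"
    using hermitian_functional_calculus[OF P', of "\<lambda>r. sqrt (sqrt r)"] by blast
  define E where "E = F ** F"
  have E: "E *v v = of_real (sqrt r) *s v" if v: "P *v v = of_real r *s v" for v r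
  proof (cases "v = 0")
    case False
    then have "r \<ge> 0" using psd_eigenvalue_nonneg[OF P v] by simp
    then have "sqrt (sqrt r) * sqrt (sqrt r) = sqrt r" by simp
    then show ?thesis
      by (simp add: E_def F(2)[OF v] vector_scalar_commute vector_smult_assoc flip: matrix_vector_mul_assoc of_real_mult)
  qed simp
  have "E ** E = P"
  proof (rule matrix_eq_on_eigenvectors[OF P'])
    fix v r assume v: "P *v v = of_real r *s v"
    show "(E ** E) *v v = P *v v"
    proof (cases "v = 0")
      case False
      then have "sqrt r * sqrt r = r" using psd_eigenvalue_nonneg[OF P v] by simp
      then show ?thesis
        by (simp add: E[OF v] v vector_scalar_commute vector_smult_assoc flip: matrix_vector_mul_assoc of_real_mult)
    qed simp
  qed
  moreover have "psd E" using psd_madj_mult[of F] F by (simp add: E_def)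
  ultimately show ?thesis using E by blast
qed

lemma psd_orthogonal_sqrt:
  assumes P: "psd P" "transpose P ** P = mat 1"
    and E: "madj E = E" "\<And>v r. P *v v = of_real r *s v \<Longrightarrow> E *v v = of_real (sqrt r) *s v"
  shows "transpose E ** E = mat 1"
proof -
  have P': "madj P = P" using P by (simp add: psd_def)
  have "mcnj P ** P = mat 1" "transpose E = mcnj E"
    using P P' E(1) by (metis madj_def mcnj_simps(1) mcnj_transpose)+
  have "mcnj E ** E = mat 1"
  proof (rule matrix_eq_on_eigenvectors[OF P'])
    fix v r assume v: "P *v v = of_real r *s v"
    show "(mcnj E ** E) *v v = mat 1 *v v"
    proof (cases "v = 0")
      case False
      have *: "of_real r *s (mcnj P *v v) = v"
        using \<open>mcnj P ** P = mat 1\<close> v by (metis matrix_vector_mul_assoc matrix_vector_mul_lid vector_scalar_commute)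
      with False have "r \<noteq> 0" by auto
      have "of_real (1 / r) *s (of_real r *s (mcnj P *v v)) = of_real (1 / r) *s v" using * by simp
      then have "mcnj P *v v = of_real (1 / r) *s v"
        using \<open>r \<noteq> 0\<close> by (simp add: vector_smult_assoc flip: of_real_mult)
      from arg_cong[OF this, of vcnj] have "P *v vcnj v = of_real (1 / r) *s vcnj v" by simp
      from arg_cong[OF E(2)[OF this], of vcnj] have "mcnj E *v v = of_real (sqrt (1 / r)) *s v" by simp
      moreover have "sqrt r * sqrt (1 / r) = 1"
        using \<open>r \<noteq> 0\<close> psd_eigenvalue_nonneg[OF P(1) v False] by (simp add: real_sqrt_divide)
      ultimately show ?thesis
        by (simp add: E(2)[OF v] vector_scalar_commute vector_smult_assoc flip: matrix_vector_mul_assoc of_real_mult)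
    qed simp
  qed
  then show ?thesis using \<open>transpose E = mcnj E\<close> by simp
qed

lemma SO8_sqrt:
  assumes P: "P \<in> SO8" "psd P" and E: "psd E" "E ** E = P"
    "\<And>v r. P *v v = of_real r *s v \<Longrightarrow> E *v v = of_real (sqrt r) *s v"
  shows "E \<in> SO8"
proof -
  have orth: "transpose E ** E = mat 1"
    using E(1) by (intro psd_orthogonal_sqrt[OF P(2) SO8_D(2)[OF P(1)] _ E(3)]) (simp add: psd_def)
  obtain F where F: "psd F" "F ** F = E" "\<And>v r. E *v v = of_real r *s v \<Longrightarrow> F *v v = of_real (sqrt r) *s v"
    using psd_sqrt[OF E(1)] by blast
  have "transpose F ** F = mat 1"
    using F(1) by (intro psd_orthogonal_sqrt[OF E(1) orth _ F(3)]) (simp add: psd_def)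
  from arg_cong[OF this, of det] have "det F * det F = 1" by (simp add: det_mul)
  then have "det E = 1" using F(2) by (metis det_mul)
  with orth show ?thesis by (simp add: SO8_def)
qed

lemma bounded_linear_transpose: "bounded_linear (transpose :: cmat \<Rightarrow> cmat)"
  by (rule linear_conv_bounded_linear[THEN iffD1], rule linearI)
     (simp_all add: vec_eq_iff transpose_def)

lemma bounded_linear_mcnj: "bounded_linear mcnj"
  by (rule linear_conv_bounded_linear[THEN iffD1], rule linearI) simp_all

lemmas continuous_on_transpose [continuous_intros] = bounded_linear.continuous_on[OF bounded_linear_transpose]
lemmas continuous_on_mcnj [continuous_intros] = bounded_linear.continuous_on[OF bounded_linear_mcnj]

lemma continuous_on_madj [continuous_intros]:
  "continuous_on S f \<Longrightarrow> continuous_on S (\<lambda>x. madj (f x))"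
  unfolding madj_def by (rule continuous_on_transpose[OF continuous_on_mcnj])

lemma continuous_on_det: "continuous_on UNIV (det :: cmat \<Rightarrow> complex)"
  unfolding det_def by (intro continuous_intros)

lemma closed_orthogonal: "closed {g :: cmat. transpose g ** g = mat 1}"
proof -
  have "continuous_on UNIV (\<lambda>g::cmat. transpose g ** g)"
    by (rule mm.continuous_on, rule continuous_on_transpose, rule continuous_on_id, rule continuous_on_id)
  then show ?thesis by (rule closed_Collect_eq[OF _ continuous_on_const])
qed

lemma closed_SO8: "closed SO8"
proof -
  have "SO8 = {g. det g = 1} \<inter> {g. transpose g ** g = mat 1}" by (auto simp: SO8_def)
  then show ?thesis
    using closed_Int[OF closed_Collect_eq[OF continuous_on_det continuous_on_const[of _ 1]] closed_orthogonal] by simp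
qed

lemma closed_fix: "closed {g :: cmat. g *v v = w}"
proof -
  have "continuous_on UNIV (\<lambda>g::cmat. g *v v)"
    by (rule linear_continuous_on[OF mv.bounded_linear_left])
  then show ?thesis by (rule closed_Collect_eq[OF _ continuous_on_const])
qed

lemma closed_SO7: "closed SO7"
proof -
  have "SO7 = SO8 \<inter> {g. g *v e 0 = e 0}" by (auto simp: SO7_iff)
  then show ?thesis using closed_Int[OF closed_SO8 closed_fix[of "e 0" "e 0"]] by simp
qed

definition right_mult :: "complex^8 \<Rightarrow> cmat" where "right_mult w = matrix (\<lambda>x. x \<bullet>\<^sub>C w)"

lemma right_mult_vector [simp]: "right_mult w *v x = x \<bullet>\<^sub>C w"
  unfolding right_mult_def by (rule matrix_works) (simp add: Vector_Spaces.linear_iff vec.vector_space_axioms)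

lemma bounded_linear_right_mult: "bounded_linear right_mult"
proof (rule linear_conv_bounded_linear[THEN iffD1], rule linearI)
  fix x y :: "complex^8" and r :: real
  show "right_mult (x + y) = right_mult x + right_mult y"
    by (rule cmat_eqI) (simp add: matrix_vector_mult_add_rdistrib)
  show "right_mult (r *\<^sub>R x) = r *\<^sub>R right_mult x"
    by (rule cmat_eqI) (simp add: cayley.scaleR_right mv.scaleR_left)
qed

lemma Spin7_iff_matrix: "g \<in> Spin7 \<longleftrightarrow> spin_pair (g ** right_mult (transpose g *v e 0)) g"
proof
  assume "g \<in> Spin7"
  then obtain g0 where g0: "spin_pair g0 g" by (auto simp: Spin7_iff)
  have "g0 = g ** right_mult (transpose g *v e 0)"
    by (rule cmat_eqI) (simp add: spin_pair_vector[OF g0] flip: matrix_vector_mul_assoc)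
  with g0 show "spin_pair (g ** right_mult (transpose g *v e 0)) g" by simp
qed (auto simp: Spin7_iff)

lemma closed_Spin7: "closed Spin7"
proof -
  define G where "G g = g ** right_mult (transpose g *v e 0)" for g
  have G: "continuous_on UNIV G" unfolding G_def
    by (rule mm.continuous_on, rule continuous_on_id, rule bounded_linear.continuous_on[OF bounded_linear_right_mult],
        rule mv.continuous_on, rule continuous_on_transpose, rule continuous_on_id, rule continuous_on_const)
  have "continuous_on UNIV (\<lambda>g. (G g *v x) \<bullet>\<^sub>C (g *v y))" for x y
    by (rule cayley.continuous_on, rule mv.continuous_on, rule G, rule continuous_on_const,
        rule linear_continuous_on[OF mv.bounded_linear_left])
  then have "closed {g. (G g *v x) \<bullet>\<^sub>C (g *v y) = g *v (x \<bullet>\<^sub>C y)}" for x y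
    by (rule closed_Collect_eq[OF _ linear_continuous_on[OF mv.bounded_linear_left]])
  then have 1: "closed {g. \<forall>x y. (G g *v x) \<bullet>\<^sub>C (g *v y) = g *v (x \<bullet>\<^sub>C y)}"
    by (intro closed_Collect_all)
  have 2: "Spin7 = {g. \<forall>x y. (G g *v x) \<bullet>\<^sub>C (g *v y) = g *v (x \<bullet>\<^sub>C y)} \<inter> (G -` SO7 \<inter> SO8)"
    by (auto simp: Spin7_iff_matrix spin_pair_def G_def)
  show ?thesis
    unfolding 2 by (rule closed_Int[OF 1 closed_Int[OF closed_vimage[OF closed_SO7 G] closed_SO8]])
qed

lemma closed_G2: "closed G2"
proof -
  have "G2 = Spin7 \<inter> {g. g *v e 0 = e 0}" by (auto simp: G2_iff_Spin7)
  then show ?thesis using closed_Int[OF closed_Spin7 closed_fix[of "e 0" "e 0"]] by simp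
qed

lemma closed_psd: "closed {P. psd P}"
proof -
  have "{P. psd P} = {P. madj P = P} \<inter> {P. \<forall>x. 0 \<le> inner (P *v x) x}" by (auto simp: psd_def)
  moreover have "closed {P. madj P = P}"
    by (rule closed_Collect_eq, rule continuous_on_madj, rule continuous_on_id, rule continuous_on_id)
  moreover have "closed {P :: cmat. 0 \<le> inner (P *v x) x}" for x
    by (rule closed_Collect_le, rule continuous_on_const, rule continuous_on_inner,
        rule linear_continuous_on[OF mv.bounded_linear_left], rule continuous_on_const)
  then have "closed {P :: cmat. \<forall>x. 0 \<le> inner (P *v x) x}" by (rule closed_Collect_all)
  ultimately show ?thesis by (simp add: closed_Int)
qed

locale self_adjoint_group =
  fixes G :: "cmat set"
  assumes SO8: "g \<in> G \<Longrightarrow> g \<in> SO8"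
    and one: "mat 1 \<in> G"
    and mult: "g \<in> G \<Longrightarrow> h \<in> G \<Longrightarrow> g ** h \<in> G"
    and transp: "g \<in> G \<Longrightarrow> transpose g \<in> G"
    and cnj_closed: "g \<in> G \<Longrightarrow> mcnj g \<in> G"
    and closed: "closed G"
    and sqrt: "P \<in> G \<Longrightarrow> psd P \<Longrightarrow> \<exists>E\<in>G. psd E \<and> E ** E = P"
begin

lemma adj: "g \<in> G \<Longrightarrow> madj g \<in> G"
  by (simp add: madj_def transp cnj_closed)

text \<open>With \<open>P = E\<^sup>2\<close>, \<open>Q = E F\<^sup>2 E\<close> and \<open>M = E F E\<close>, the difference of the two sides is \<open>\<parallel>E k - F E k\<parallel>\<^sup>2\<close>.\<close>

lemma midpoint:
  assumes P: "P \<in> G" "psd P" and Q: "Q \<in> G" "psd Q" and "P \<noteq> Q"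
  shows "\<exists>M\<in>G. psd M \<and> (\<forall>k\<in>G. 2 * inner (M ** k) k < inner (P ** k) k + inner (Q ** k) k)"
proof -
  obtain E where E: "E \<in> G" "psd E" "E ** E = P" using sqrt P by blast
  define T where "T = transpose E"
  have T: "T \<in> G" "T ** E = mat 1" "E ** T = mat 1"
    using transp E SO8 SO8_D by (auto simp: T_def)
  have aE: "madj E = E" "madj T = T" using E by (simp_all add: psd_def T_def)
  have "psd (T ** Q ** T)" using psd_congruence[OF Q(2), of T] aE by simp
  then obtain F where F: "F \<in> G" "psd F" "F ** F = T ** Q ** T"
    using sqrt[of "T ** Q ** T"] mult T Q by blast
  have aF: "madj F = F" using F by (simp add: psd_def)
  have "E ** (F ** F) ** E = (E ** T) ** Q ** (T ** E)"
    unfolding F(3) by (simp only: matrix_mul_assoc)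
  then have EFFE: "E ** (F ** F) ** E = Q" by (simp add: T)
  have "F \<noteq> mat 1" using EFFE E(3) \<open>P \<noteq> Q\<close> by auto
  show ?thesis
  proof (intro bexI[of _ "E ** F ** E"] conjI ballI)
    show "E ** F ** E \<in> G" by (intro mult E F)
    show "psd (E ** F ** E)" using psd_congruence[OF F(2), of E] aE by simp
    fix k assume k: "k \<in> G"
    define A where "A = E ** k"
    have 1: "inner (P ** k) k = inner A A"
      using inner_matrix_madj[of E "E ** k" k] aE by (simp add: A_def E(3)[symmetric] matrix_mul_assoc)
    have "Q ** k = E ** (F ** (F ** A))"
      unfolding EFFE[symmetric] A_def by (simp only: matrix_mul_assoc)
    then have 2: "inner (Q ** k) k = inner (F ** A) (F ** A)"
      using inner_matrix_madj[of E "F ** (F ** A)" k] inner_matrix_madj[of F "F ** A" A] aE aF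
      by (simp add: A_def)
    have "(E ** F ** E) ** k = E ** (F ** A)" unfolding A_def by (simp only: matrix_mul_assoc)
    then have 3: "inner ((E ** F ** E) ** k) k = inner (F ** A) A"
      using inner_matrix_madj[of E "F ** A" k] aE by (simp add: A_def)
    have "A \<noteq> F ** A"
    proof
      assume eq: "A = F ** A"
      have "A \<in> G" unfolding A_def by (intro mult E k)
      then have "A ** transpose A = mat 1" using SO8 SO8_D by blast
      then have "F = F ** (A ** transpose A)" by simp
      also have "\<dots> = (F ** A) ** transpose A" by (simp only: matrix_mul_assoc)
      also have "\<dots> = mat 1" using eq \<open>A ** transpose A = mat 1\<close> by simp
      finally show False using \<open>F \<noteq> mat 1\<close> by simp
    qed
    then have "0 < inner (A - F ** A) (A - F ** A)" by simp
    also have "\<dots> = inner A A + inner (F ** A) (F ** A) - 2 * inner (F ** A) A"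
      by (simp add: inner_diff_left inner_diff_right inner_commute)
    finally show "2 * inner ((E ** F ** E) ** k) k < inner (P ** k) k + inner (Q ** k) k"
      by (simp add: 1 2 3)
  qed
qed

lemma psd_inner_nonneg:
  assumes "psd P" shows "0 \<le> inner (P ** k) (k::cmat)"
proof -
  obtain E where E: "psd E" "E ** E = P" using psd_sqrt[OF assms] by blast
  have "inner (P ** k) k = inner (E ** k) (E ** k)"
    using inner_matrix_madj[of E "E ** k" k] E by (simp add: psd_def matrix_mul_assoc)
  then show ?thesis by simp
qed

lemma cartan_fixed_point:
  assumes K: "compact K" "K \<subseteq> G" "mat 1 \<in> K" "\<And>g h. g \<in> K \<Longrightarrow> h \<in> K \<Longrightarrow> g ** h \<in> K"
  shows "\<exists>P\<in>G. psd P \<and> (\<forall>k\<in>K. madj k ** P ** k = P)"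
proof -
  define T :: "cmat \<Rightarrow> cmat \<Rightarrow> real" where "T P k = inner (P ** k) k" for P k
  define C where "C r = {P \<in> G. psd P \<and> (\<forall>k\<in>K. T P k \<le> r)}" for r
  have T_cont: "continuous_on S (\<lambda>P. T P k)" "continuous_on S (T P)" for S k P
    unfolding T_def
    by (rule continuous_on_inner, rule linear_continuous_on[OF mm.bounded_linear_left], rule continuous_on_const)
      (rule continuous_on_inner, rule linear_continuous_on[OF mm.bounded_linear_right], rule continuous_on_id)
  have C_compact: "compact (C r)" for r
  proof -
    have "C r = G \<inter> {P. psd P} \<inter> {P. \<forall>k\<in>K. T P k \<le> r}" by (auto simp: C_def)
    moreover have "closed {P. \<forall>k\<in>K. T P k \<le> r}"
    proof -
      have "closed (\<Inter>k\<in>K. {P. T P k \<le> r})"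
        by (rule closed_INT, rule ballI, rule closed_Collect_le[OF T_cont(1) continuous_on_const])
      moreover have "{P. \<forall>k\<in>K. T P k \<le> r} = (\<Inter>k\<in>K. {P. T P k \<le> r})" by auto
      ultimately show ?thesis by simp
    qed
    ultimately have "closed (C r)" using closed closed_psd by (simp add: closed_Int)
    moreover have "bounded (C r)"
    proof -
      obtain c where c: "\<forall>(A::cmat) (B::cmat). norm (A ** B) \<le> norm A * norm B * c" "c > 0"
        using mm.pos_bounded by blast
      have "norm P \<le> \<bar>r\<bar> * c" if "P \<in> C r" for P
      proof -
        have P: "psd P" "T P (mat 1) \<le> r" using that K by (auto simp: C_def)
        obtain E where E: "psd E" "E ** E = P" using psd_sqrt[OF P(1)] by blast
        have "T P (mat 1) = (norm E)\<^sup>2"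
          using inner_matrix_madj[of E E "mat 1"] E by (simp add: T_def psd_def power2_norm_eq_inner)
        then have "norm E * norm E \<le> \<bar>r\<bar>" using P(2) by (simp add: power2_eq_square)
        then have "norm E * norm E * c \<le> \<bar>r\<bar> * c" using c(2) by (intro mult_right_mono) auto
        then show ?thesis using c(1)[rule_format, of E E] E(2) by simp
      qed
      then show ?thesis by (auto simp: bounded_iff)
    qed
    ultimately show ?thesis by (simp add: compact_eq_bounded_closed)
  qed
  define R where "R = {r. C r \<noteq> {}}"
  define m where "m = Inf R"
  have R_lower: "0 \<le> r" if r: "r \<in> R" for r
  proof -
    obtain P where "psd P" "T P (mat 1) \<le> r" using r K by (auto simp: R_def C_def)
    then show ?thesis using psd_inner_nonneg[of P "mat 1"] by (simp add: T_def)
  qed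
  then have bdd: "bdd_below R" by (rule bdd_belowI)
  have attains: "\<exists>r\<in>R. M \<in> C r \<and> (\<exists>k\<in>K. r = T M k)" if "M \<in> G" "psd M" for M
  proof -
    obtain k where k: "k \<in> K" "\<And>k'. k' \<in> K \<Longrightarrow> T M k' \<le> T M k"
      using continuous_attains_sup[OF K(1) _ T_cont(2), of M] K(3) by auto
    then have "M \<in> C (T M k)" using that by (auto simp: C_def)
    with k show ?thesis by (auto simp: R_def)
  qed
  have "psd (mat 1)" using psd_madj_mult[of "mat 1"] by simp
  then have "R \<noteq> {}" using attains[OF one] by auto
  have C_mono: "C r \<subseteq> C s" if "r \<le> s" for r s using that by (force simp: C_def)
  have nonempty: "C r \<noteq> {}" if r: "m < r" for r
  proof -
    obtain s where "s \<in> R" "s < r" using r cInf_lessD[OF \<open>R \<noteq> {}\<close>] by (auto simp: m_def)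
    then show ?thesis using C_mono[of s r] by (auto simp: R_def)
  qed
  have "(\<Inter>n. C (m + 1 / real (Suc n))) \<noteq> {}"
  proof (rule compact_nest)
    show "C (m + 1 / real (Suc n)) \<subseteq> C (m + 1 / real (Suc l))" if "l \<le> n" for l n
      using that by (intro C_mono add_left_mono divide_left_mono) auto
  qed (use C_compact nonempty in auto)
  then obtain P where P: "\<And>n. P \<in> C (m + 1 / real (Suc n))" by blast
  have "T P k \<le> m" if "k \<in> K" for k
  proof (rule field_le_epsilon)
    fix \<epsilon> :: real assume "0 < \<epsilon>"
    then obtain n where "1 / real (Suc n) < \<epsilon>" using nat_approx_posE by blast
    then show "T P k \<le> m + \<epsilon>" using P[of n] that by (force simp: C_def)
  qed
  then have Pm: "P \<in> C m" using P[of 0] by (auto simp: C_def)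
  have unique: "P = Q" if "Q \<in> C m" for Q
  proof (rule ccontr)
    assume "P \<noteq> Q"
    have PQ: "P \<in> G" "psd P" "Q \<in> G" "psd Q" "\<And>k. k \<in> K \<Longrightarrow> T P k \<le> m \<and> T Q k \<le> m"
      using that Pm by (auto simp: C_def)
    obtain M where M: "M \<in> G" "psd M" "\<And>k. k \<in> G \<Longrightarrow> 2 * T M k < T P k + T Q k"
      unfolding T_def using midpoint[OF PQ(1-4) \<open>P \<noteq> Q\<close>] by blast
    obtain k where k: "T M k \<in> R" "k \<in> K" using attains[OF M(1,2)] by auto
    have "m \<le> T M k" unfolding m_def by (rule cInf_lower[OF k(1) bdd])
    moreover have "2 * T M k < m + m" using M(3)[of k] PQ(5)[of k] k K(2) by force
    ultimately show False by simp
  qed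
  have "madj k ** P ** k = P" if k: "k \<in> K" for k
  proof -
    have "madj k ** P ** k \<in> C m" unfolding C_def
    proof (intro CollectI conjI ballI)
      show "madj k ** P ** k \<in> G" using k K(2) Pm by (intro mult adj) (auto simp: C_def)
      show "psd (madj k ** P ** k)" using Pm by (intro psd_congruence) (auto simp: C_def)
      fix k' assume k': "k' \<in> K"
      have "T (madj k ** P ** k) k' = T P (k ** k')"
        using inner_matrix_madj[of "madj k" "P ** (k ** k')" k'] by (simp add: T_def matrix_mul_assoc)
      then show "T (madj k ** P ** k) k' \<le> m" using Pm K(4)[OF k k'] by (auto simp: C_def)
    qed
    from unique[OF this] show ?thesis by simp
  qed
  with Pm show ?thesis by (auto simp: C_def)
qed

lemma compact_conjugate_real:
  assumes K: "compact K" "K \<subseteq> G" "mat 1 \<in> K" "\<And>g h. g \<in> K \<Longrightarrow> h \<in> K \<Longrightarrow> g ** h \<in> K"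
  shows "\<exists>E\<in>G. \<forall>k\<in>K. mcnj (E ** k ** transpose E) = E ** k ** transpose E"
proof -
  obtain P where P: "P \<in> G" "psd P" "\<And>k. k \<in> K \<Longrightarrow> madj k ** P ** k = P"
    using cartan_fixed_point[OF K] by blast
  obtain E where E: "E \<in> G" "psd E" "E ** E = P" using sqrt P by blast
  define T where "T = transpose E"
  have T: "T \<in> G" "T ** E = mat 1" "E ** T = mat 1"
    using transp E SO8 SO8_D by (auto simp: T_def)
  have aE: "madj E = E" "madj T = T" using E by (simp_all add: psd_def T_def)
  have "mcnj (E ** k ** T) = E ** k ** T" if k: "k \<in> K" for k
  proof -
    define u where "u = E ** k ** T"
    have "u \<in> G" unfolding u_def using k K(2) by (intro mult E T) auto
    have "madj u ** u = T ** (madj k ** (E ** E) ** k) ** T"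
      by (simp add: u_def aE matrix_mul_assoc)
    also have "\<dots> = T ** (E ** E) ** T" using P(3)[OF k] E(3) by simp
    also have "\<dots> = (T ** E) ** (E ** T)" by (simp only: matrix_mul_assoc)
    also have "\<dots> = mat 1" by (simp add: T)
    finally have 1: "madj u ** u = mat 1" .
    have 2: "u ** transpose u = mat 1" using SO8[OF \<open>u \<in> G\<close>] SO8_D by blast
    have "madj u = madj u ** (u ** transpose u)" using 2 by simp
    also have "\<dots> = transpose u" using 1 by (simp add: matrix_mul_assoc)
    finally have "transpose (mcnj u) = transpose u" by (simp add: madj_def)
    from arg_cong[OF this, of transpose] have "mcnj u = u" by simp
    then show ?thesis by (simp add: u_def)
  qed
  then show ?thesis using E(1) by (auto simp: T_def)
qed

end

lemma self_adjoint_group_SO7: "self_adjoint_group SO7"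
proof
  fix P assume P: "P \<in> SO7" "psd P"
  obtain E where E: "psd E" "E ** E = P" "\<And>v r. P *v v = of_real r *s v \<Longrightarrow> E *v v = of_real (sqrt r) *s v"
    using psd_sqrt[OF P(2)] by blast
  have "E \<in> SO8" using SO8_sqrt[OF _ P(2) E] P(1) by (simp add: SO7_iff)
  moreover have "E *v e 0 = e 0" using E(3)[of "e 0" 1] P(1) by (simp add: SO7_iff)
  ultimately show "\<exists>E\<in>SO7. psd E \<and> E ** E = P" using E by (auto simp: SO7_iff)
qed (simp_all add: SO7_mult SO7_transpose SO7_mcnj closed_SO7, simp_all add: SO7_iff SO8_one)

definition octonion_cnj :: "complex^8 \<Rightarrow> complex^8" where
  "octonion_cnj x = (2 * x $ 0) *s e 0 - x"

lemma octonion_cnj_inverse [simp]: "octonion_cnj (octonion_cnj x) = x"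
  by (simp add: octonion_cnj_def vec_eq_iff)

lemma transpose_Lm: "transpose (Lm x) = Lm (octonion_cnj x)"
proof (rule cmat_eqI, rule bil_eqI)
  fix y z
  define x' where "x' = x - x $ 0 *s e 0"
  have x: "x = x $ 0 *s e 0 + x'" "octonion_cnj x = x $ 0 *s e 0 - x'" and x': "x' $ 0 = 0"
    by (simp_all add: x'_def octonion_cnj_def vec_eq_iff)
  have "bil (transpose (Lm x) *v y) z = bil y ((x $ 0 *s e 0 + x') \<bullet>\<^sub>C z)"
    using bil_matrix[of "transpose (Lm x)" y z] x(1) by simp
  also have "\<dots> = bil ((x $ 0 *s e 0 - x') \<bullet>\<^sub>C y) z"
    using bil_cayley_mult_imaginary[OF x', of y z] by simp
  finally show "bil (transpose (Lm x) *v y) z = bil (Lm (octonion_cnj x) *v y) z"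
    by (simp add: x(2))
qed

lemma mcnj_Lm: "mcnj (Lm x) = Lm (vcnj x)"
proof (rule cmat_eqI)
  fix y
  have "mcnj (Lm x) *v y = vcnj (Lm x *v vcnj y)" by (simp only: vcnj_mult vcnj_simps)
  also have "\<dots> = Lm (vcnj x) *v y" by (simp only: Lm_mult vcnj_cayley_mult vcnj_simps)
  finally show "mcnj (Lm x) *v y = Lm (vcnj x) *v y" .
qed

lemma madj_Lm: "madj (Lm x) = Lm (octonion_cnj (vcnj x))"
  by (simp add: madj_def mcnj_Lm transpose_Lm)

lemma Lm_inject: "Lm x = Lm y \<Longrightarrow> x = y"
  by (drule arg_cong[of _ _ "\<lambda>A. A *v e 0"]) simp

text \<open>Taking adjoints in \<open>P L\<^sub>x P\<inverse> = L\<^bsub>P\<^sub>0 x\<^esub>\<close> replaces \<open>P\<close> by its inverse and \<open>x\<close> by its conjugate.\<close>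

lemma spin_pair_hermitian:
  assumes pair: "spin_pair P0 P" and P: "madj P = P"
  shows "madj P0 = P0"
proof -
  have PP: "P \<in> SO8" "P0 \<in> SO7" "P0 \<in> SO8" using pair by (auto simp: spin_pair_def SO7_iff)
  have L: "P ** Lm x = Lm (P0 *v x) ** P" for x
    by (rule cmat_eqI) (use pair in \<open>simp add: spin_pair_def flip: matrix_vector_mul_assoc\<close>)
  have cancel: "A = B" if "A ** P = B ** P" for A B
  proof -
    have "A ** (P ** transpose P) = B ** (P ** transpose P)" using that by (simp only: matrix_mul_assoc)
    then show ?thesis by (simp add: SO8_D[OF PP(1)])
  qed
  have comm: "P0 *v octonion_cnj x = octonion_cnj (P0 *v x)" for x
    using PP(2) SO7_nth_0[OF PP(2), of x]
    by (simp add: octonion_cnj_def SO7_iff matrix_vector_mult_diff_distrib vector_scalar_commute)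
  have "P0 ** mcnj P0 = mat 1"
  proof (rule cmat_eqI)
    fix y
    define x where "x = vcnj y"
    have "Lm (octonion_cnj (vcnj x)) ** P = madj (P ** Lm x)" by (simp add: P madj_Lm)
    also have "\<dots> = madj (Lm (P0 *v x) ** P)" by (simp only: L)
    also have "\<dots> = P ** Lm (octonion_cnj (vcnj (P0 *v x)))" by (simp only: madj_simps P madj_Lm)
    also have "\<dots> = Lm (P0 *v octonion_cnj (vcnj (P0 *v x))) ** P" by (rule L)
    finally have "octonion_cnj (vcnj x) = P0 *v octonion_cnj (vcnj (P0 *v x))"
      by (rule Lm_inject[OF cancel])
    then have "octonion_cnj (vcnj x) = octonion_cnj (P0 *v vcnj (P0 *v x))" by (simp only: comm)
    then have "vcnj x = P0 *v vcnj (P0 *v x)" by (metis octonion_cnj_inverse)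
    then show "(P0 ** mcnj P0) *v y = mat 1 *v y" by (simp add: x_def flip: matrix_vector_mul_assoc)
  qed
  have "mcnj P0 = (transpose P0 ** P0) ** mcnj P0" by (simp add: SO8_D[OF PP(3)])
  also have "\<dots> = transpose P0 ** (P0 ** mcnj P0)" by (simp only: matrix_mul_assoc)
  also have "\<dots> = transpose P0" by (simp add: \<open>P0 ** mcnj P0 = mat 1\<close>)
  finally show ?thesis by (simp add: madj_def)
qed

lemma spin_pair_psd:
  assumes pair: "spin_pair P0 P" and P: "psd P"
  shows "psd P0"
proof -
  have P': "madj P = P" using P by (simp add: psd_def)
  have P0: "madj P0 = P0" using spin_pair_hermitian[OF pair P'] .
  have nonneg: "r \<ge> 0" if x: "P0 *v x = of_real r *s x" "x \<noteq> 0" for x r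
  proof -
    have "Lm x \<noteq> 0"
    proof
      assume "Lm x = 0"
      then have "Lm x *v e 0 = 0" by simp
      with \<open>x \<noteq> 0\<close> show False by simp
    qed
    then obtain y s where y: "P *v y = of_real s *s y" "x \<bullet>\<^sub>C y \<noteq> 0"
      using matrix_eq_on_eigenvectors[OF P', of "Lm x" 0] by auto
    have "y \<noteq> 0" using y(2) by auto
    have "s \<ge> 0" using psd_eigenvalue_nonneg[OF P y(1) \<open>y \<noteq> 0\<close>] .
    have "s \<noteq> 0"
    proof
      assume "s = 0"
      then have "transpose P *v (P *v y) = 0" using y(1) by simp
      then show False using pair \<open>y \<noteq> 0\<close> by (simp add: spin_pair_def)
    qed
    have "(P0 *v x) \<bullet>\<^sub>C (P *v y) = P *v (x \<bullet>\<^sub>C y)" using pair by (simp add: spin_pair_def)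
    then have "P *v (x \<bullet>\<^sub>C y) = of_real (r * s) *s (x \<bullet>\<^sub>C y)" using x y by (simp add: mult.commute)
    from psd_eigenvalue_nonneg[OF P this y(2)] have "0 \<le> r * s" .
    with \<open>s \<ge> 0\<close> \<open>s \<noteq> 0\<close> show ?thesis by (simp add: zero_le_mult_iff)
  qed
  obtain F where F: "madj F = F" "\<And>v r. P0 *v v = of_real r *s v \<Longrightarrow> F *v v = of_real (sqrt r) *s v"
    using hermitian_functional_calculus[OF P0, of sqrt] by blast
  have "F ** F = P0"
  proof (rule matrix_eq_on_eigenvectors[OF P0])
    fix v r assume v: "P0 *v v = of_real r *s v"
    show "(F ** F) *v v = P0 *v v"
    proof (cases "v = 0")
      case False
      then have "sqrt r * sqrt r = r" using nonneg[OF v] by simp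
      then show ?thesis
        by (simp add: F(2)[OF v] v vector_scalar_commute vector_smult_assoc flip: matrix_vector_mul_assoc of_real_mult)
    qed simp
  qed
  then show ?thesis using psd_madj_mult[of F] F by simp
qed

lemma spin_pair_sqrt:
  assumes pair: "spin_pair P0 P" and P: "psd P"
    and E: "psd E" "E ** E = P" "\<And>v r. P *v v = of_real r *s v \<Longrightarrow> E *v v = of_real (sqrt r) *s v"
  shows "\<exists>E0. spin_pair E0 E"
proof -
  have PP: "P \<in> SO8" "P0 \<in> SO7" "P0 \<in> SO8" "P0 *v e 0 = e 0" using pair by (auto simp: spin_pair_def SO7_iff)
  have P0: "psd P0" by (rule spin_pair_psd[OF pair P])
  have herm: "madj P = P" "madj P0 = P0" using P P0 by (simp_all add: psd_def)
  obtain E0 where E0: "psd E0" "E0 ** E0 = P0"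
    "\<And>v r. P0 *v v = of_real r *s v \<Longrightarrow> E0 *v v = of_real (sqrt r) *s v"
    using psd_sqrt[OF P0] by blast
  have "E \<in> SO8" by (rule SO8_sqrt[OF PP(1) P E])
  moreover have "E0 \<in> SO8" by (rule SO8_sqrt[OF PP(3) P0 E0])
  moreover have "E0 *v e 0 = e 0" using E0(3)[of "e 0" 1] PP(4) by simp
  moreover have "(E0 *v x) \<bullet>\<^sub>C (E *v y) = E *v (x \<bullet>\<^sub>C y)" for x y
  proof -
    have 1: "(E0 *v x) \<bullet>\<^sub>C (E *v y) = E *v (x \<bullet>\<^sub>C y)"
      if x: "P0 *v x = of_real r *s x" and y: "P *v y = of_real s *s y" for x y r s
    proof -
      have "(P0 *v x) \<bullet>\<^sub>C (P *v y) = P *v (x \<bullet>\<^sub>C y)" using pair by (simp add: spin_pair_def)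
      then have "P *v (x \<bullet>\<^sub>C y) = of_real (r * s) *s (x \<bullet>\<^sub>C y)" using x y by (simp add: mult.commute)
      from E(3)[OF this] show ?thesis
        by (simp add: E(3)[OF y] E0(3)[OF x] real_sqrt_mult mult.commute)
    qed
    have 2: "Lm (E0 *v x) ** E = E ** Lm x" if "P0 *v x = of_real r *s x" for x r
      by (rule matrix_eq_on_eigenvectors[OF herm(1)])
        (use 1[OF that] in \<open>simp flip: matrix_vector_mul_assoc\<close>)
    have "right_mult (E *v y) ** E0 = E ** right_mult y"
    proof (rule matrix_eq_on_eigenvectors[OF herm(2)])
      fix v r assume v: "P0 *v v = of_real r *s v"
      have "(Lm (E0 *v v) ** E) *v y = (E ** Lm v) *v y" by (simp only: 2[OF v])
      then show "(right_mult (E *v y) ** E0) *v v = (E ** right_mult y) *v v"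
        by (simp flip: matrix_vector_mul_assoc)
    qed
    then have "(right_mult (E *v y) ** E0) *v x = (E ** right_mult y) *v x" by (simp only:)
    then show ?thesis by (simp flip: matrix_vector_mul_assoc)
  qed
  ultimately have "spin_pair E0 E" by (simp add: spin_pair_def SO7_iff)
  then show ?thesis by blast
qed

lemma self_adjoint_group_Spin7: "self_adjoint_group Spin7"
proof
  fix P assume P: "P \<in> Spin7" "psd P"
  obtain E where E: "psd E" "E ** E = P" "\<And>v r. P *v v = of_real r *s v \<Longrightarrow> E *v v = of_real (sqrt r) *s v"
    using psd_sqrt[OF P(2)] by blast
  then have "E \<in> Spin7" using spin_pair_sqrt[OF _ P(2) E] P(1) by (auto simp: Spin7_iff)
  with E show "\<exists>E\<in>Spin7. psd E \<and> E ** E = P" by blast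
next
  show "g \<in> Spin7 \<Longrightarrow> g \<in> SO8" for g by (auto simp: Spin7_iff spin_pair_def)
  show "mat 1 \<in> Spin7" unfolding Spin7_iff using spin_pair_one by blast
  show "g ** h \<in> Spin7" if "g \<in> Spin7" "h \<in> Spin7" for g h
    using that spin_pair_mult unfolding Spin7_iff by blast
  show "transpose g \<in> Spin7" if "g \<in> Spin7" for g
    using that spin_pair_transpose unfolding Spin7_iff by blast
  show "mcnj g \<in> Spin7" if "g \<in> Spin7" for g
    using that spin_pair_mcnj unfolding Spin7_iff by blast
qed (rule closed_Spin7)

lemma self_adjoint_group_G2: "self_adjoint_group G2"
proof
  fix P assume P: "P \<in> G2" "psd P"
  obtain E where E: "psd E" "E ** E = P" "\<And>v r. P *v v = of_real r *s v \<Longrightarrow> E *v v = of_real (sqrt r) *s v"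
    using psd_sqrt[OF P(2)] by blast
  then have "E \<in> Spin7" using spin_pair_sqrt[OF _ P(2) E] P(1) by (auto simp: Spin7_iff G2_iff_spin_pair)
  moreover have "E *v e 0 = e 0" using E(3)[of "e 0" 1] P(1) by (simp add: G2_iff_Spin7)
  ultimately have "E \<in> G2" by (simp add: G2_iff_Spin7)
  with E show "\<exists>E\<in>G2. psd E \<and> E ** E = P" by blast
next
  show "g \<in> G2 \<Longrightarrow> g \<in> SO8" for g by (simp add: G2_def)
qed (use spin_pair_one spin_pair_mult spin_pair_transpose spin_pair_mcnj closed_G2 in
      \<open>simp_all add: G2_iff_spin_pair\<close>)

section \<open>Reduction to infinitesimal conditions\<close>

definition conjugate :: "cmat \<Rightarrow> cmat \<Rightarrow> cmat" where
  "conjugate S A = S ** A ** transpose S"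

lemma conjugate_conjugate: "conjugate S (conjugate T A) = conjugate (S ** T) A"
  by (simp add: conjugate_def matrix_transpose_mul matrix_mul_assoc)

lemma conjugate_one [simp]: "conjugate (mat 1) A = A"
  by (simp add: conjugate_def)

lemma conjugate_inverse [simp]:
  assumes "S \<in> SO8"
  shows "conjugate (transpose S) (conjugate S A) = A" "conjugate S (conjugate (transpose S) A) = A"
  using assms by (simp_all add: conjugate_conjugate SO8_D)

lemma conjugate_mult:
  assumes "S \<in> SO8" shows "conjugate S (A ** B) = conjugate S A ** conjugate S B"
proof -
  have "conjugate S A ** conjugate S B = S ** A ** (transpose S ** S) ** B ** transpose S"
    by (simp only: conjugate_def matrix_mul_assoc)
  then show ?thesis using assms by (simp add: SO8_D conjugate_def matrix_mul_assoc)
qed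

lemma conjugate_mat_1: "S \<in> SO8 \<Longrightarrow> conjugate S (mat 1) = mat 1"
  by (simp add: conjugate_def SO8_D)

lemma conjugate_mat_exp:
  "S \<in> SO8 \<Longrightarrow> conjugate S (mat_exp (t *\<^sub>R X)) = mat_exp (t *\<^sub>R conjugate S X)"
  unfolding conjugate_def by (rule mat_exp_conjugate) (rule SO8_D)

lemma conjugate_cscale: "conjugate S (cscale c A) = cscale c (conjugate S A)"
  by (rule cmat_eqI) (simp add: conjugate_def cscale_mult_vector vector_scalar_commute flip: matrix_vector_mul_assoc)

lemma conjugate_commute:
  assumes "S \<in> SO8" shows "conjugate S A = A \<longleftrightarrow> S ** A = A ** S"
proof
  assume "conjugate S A = A"
  then have "S ** A ** (transpose S ** S) = A ** S" by (simp add: conjugate_def matrix_mul_assoc)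
  then show "S ** A = A ** S" using assms by (simp add: SO8_D)
next
  assume "S ** A = A ** S"
  then have "conjugate S A = A ** (S ** transpose S)" by (simp add: conjugate_def matrix_mul_assoc)
  then show "conjugate S A = A" using assms by (simp add: SO8_D)
qed

lemma mat_exp_inject:
  assumes "\<And>s. mat_exp (s *\<^sub>R A) = mat_exp (s *\<^sub>R B)" shows "A = B"
proof (rule cmat_eqI)
  fix v
  show "A *v v = B *v v"
    using vector_derivative_unique_at[OF mat_exp_deriv_0[of A v] mat_exp_deriv_0[of B v, folded assms]] .
qed

lemma mat_exp_commutes:
  assumes "X ** Y = Y ** X" shows "X ** mat_exp (s *\<^sub>R Y) = mat_exp (s *\<^sub>R Y) ** X"
proof (rule cmat_eqI)
  fix v
  have *: "X *v (Y *v u) = Y *v (X *v u)" for u using assms by (simp add: matrix_vector_mul_assoc)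
  have "((\<lambda>s. X *v (mat_exp (s *\<^sub>R Y) *v v)) has_vector_derivative (X *v (Y *v (mat_exp (s *\<^sub>R Y) *v v)))) (at s)" for s
    by (rule bounded_linear.has_vector_derivative[OF mv.bounded_linear_right mat_exp_deriv])
  then have "((\<lambda>s. X *v (mat_exp (s *\<^sub>R Y) *v v)) has_vector_derivative (Y *v (X *v (mat_exp (s *\<^sub>R Y) *v v)))) (at s)" for s
    unfolding * .
  from mat_exp_ode[OF this, of s] show "(X ** mat_exp (s *\<^sub>R Y)) *v v = (mat_exp (s *\<^sub>R Y) ** X) *v v"
    by (simp flip: matrix_vector_mul_assoc)
qed

lemma scaleR_cscale: "r *\<^sub>R A = cscale (of_real r) A"
  by (rule cmat_eqI) (simp add: cscale_mult_vector mv.scaleR_left scaleR_vector_complex)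

lemma scaleR_cscale_right: "r *\<^sub>R cscale c A = cscale c (r *\<^sub>R A)"
  by (simp add: scaleR_cscale mult.commute)

context self_adjoint_group
begin

lemma conjugate_closed: "S \<in> G \<Longrightarrow> A \<in> G \<Longrightarrow> conjugate S A \<in> G"
  unfolding conjugate_def by (intro mult transp)

lemma group: "group (matrix_group G)"
proof (rule groupI)
  fix x assume "x \<in> carrier (matrix_group G)"
  then show "\<exists>y\<in>carrier (matrix_group G). y \<otimes>\<^bsub>matrix_group G\<^esub> x = \<one>\<^bsub>matrix_group G\<^esub>"
    using transp[of x] SO8_D(2)[OF SO8[of x]] by (auto simp: matrix_group_def)
qed (auto simp: matrix_group_def one mult matrix_mul_assoc)

lemma inv: "x \<in> G \<Longrightarrow> inv\<^bsub>matrix_group G\<^esub> x = transpose x"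
  by (rule group.inv_equality[OF group]) (use transp SO8 SO8_D in \<open>auto simp: matrix_group_def\<close>)

lemma subgroup_iff: "subgroup K (matrix_group G) \<longleftrightarrow>
   K \<subseteq> G \<and> mat 1 \<in> K \<and> (\<forall>g\<in>K. \<forall>h\<in>K. g ** h \<in> K) \<and> (\<forall>g\<in>K. transpose g \<in> K)"
proof
  assume "subgroup K (matrix_group G)"
  then interpret subgroup K "matrix_group G" .
  have KG: "K \<subseteq> G" using subset by (simp add: matrix_group_def)
  then show "K \<subseteq> G \<and> mat 1 \<in> K \<and> (\<forall>g\<in>K. \<forall>h\<in>K. g ** h \<in> K) \<and> (\<forall>g\<in>K. transpose g \<in> K)"
    using one_closed m_closed by (auto simp: matrix_group_def inv[symmetric, unfolded matrix_group_def]
        subset_iff m_inv_closed[unfolded matrix_group_def])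
next
  assume "K \<subseteq> G \<and> mat 1 \<in> K \<and> (\<forall>g\<in>K. \<forall>h\<in>K. g ** h \<in> K) \<and> (\<forall>g\<in>K. transpose g \<in> K)"
  then show "subgroup K (matrix_group G)"
    by (intro subgroup.intro) (auto simp: inv subset_iff, auto simp: matrix_group_def)
qed

definition real_form :: "cmat set" where "real_form = {g \<in> G. mcnj g = g}"

lemma compact_real_form: "compact real_form"
proof -
  have "closed {g. mcnj g = g}"
    by (rule closed_Collect_eq, rule continuous_on_mcnj, rule continuous_on_id, rule continuous_on_id)
  moreover have "real_form = G \<inter> {g. mcnj g = g}" by (auto simp: real_form_def)
  ultimately have "closed real_form" using closed by (simp add: closed_Int)
  moreover have "norm g \<le> norm (mat 1 :: cmat)" if "g \<in> real_form" for g
  proof -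
    have "madj g ** g = mat 1" using that SO8 SO8_D by (auto simp: real_form_def madj_def)
    then have "inner g g = inner (mat 1) (mat 1 :: cmat)"
      using inner_matrix_madj[of g "mat 1" g] by simp
    then show ?thesis by (simp add: norm_eq_sqrt_inner)
  qed
  then have "bounded real_form" by (auto simp: bounded_iff)
  ultimately show ?thesis by (simp add: compact_eq_bounded_closed)
qed

lemma real_form_mult: "g \<in> real_form \<Longrightarrow> h \<in> real_form \<Longrightarrow> g ** h \<in> real_form"
  by (simp add: real_form_def mult)

lemma real_form_conjugates:
  assumes "maximal_compact_subgroup K G"
  obtains E where "E \<in> G" "K = conjugate (transpose E) ` real_form"
proof -
  have K: "compact K" "K \<subseteq> G" "mat 1 \<in> K" "\<And>g h. g \<in> K \<Longrightarrow> h \<in> K \<Longrightarrow> g ** h \<in> K"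
    using assms by (auto simp: maximal_compact_subgroup_def compact_subgroup_def subgroup_iff)
  obtain E where E: "E \<in> G" "\<forall>k\<in>K. mcnj (E ** k ** transpose E) = E ** k ** transpose E"
    using compact_conjugate_real[OF K] by blast
  have E8: "E \<in> SO8" "transpose E \<in> SO8" "transpose E \<in> G" using E SO8 transp by auto
  define L where "L = conjugate (transpose E) ` real_form"
  have "continuous_on real_form (conjugate (transpose E))"
  proof -
    have "bounded_linear (conjugate (transpose E))"
      unfolding conjugate_def
      by (rule bounded_linear_compose[OF mm.bounded_linear_left mm.bounded_linear_right])
    then show ?thesis by (rule linear_continuous_on)
  qed
  then have "compact L" unfolding L_def by (intro compact_continuous_image compact_real_form)
  moreover have "subgroup L (matrix_group G)"
    unfolding subgroup_iff
  proof (intro conjI ballI)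
    show "L \<subseteq> G" using E8 conjugate_closed by (auto simp: L_def real_form_def)
    show "mat 1 \<in> L"
      using conjugate_mat_1[OF E8(2)] one by (auto simp: L_def real_form_def intro!: image_eqI[of _ _ "mat 1"])
    show "g ** h \<in> L" if "g \<in> L" "h \<in> L" for g h
      using that by (auto simp: L_def conjugate_mult[OF E8(2), symmetric] intro!: imageI real_form_mult)
    show "transpose g \<in> L" if g: "g \<in> L" for g
    proof -
      obtain u where u: "u \<in> real_form" "g = conjugate (transpose E) u" using g by (auto simp: L_def)
      then have "transpose g = conjugate (transpose E) (transpose u)"
        by (simp add: conjugate_def matrix_transpose_mul matrix_mul_assoc)
      moreover have "transpose u \<in> real_form" using u by (simp add: real_form_def transp)
      ultimately show ?thesis by (simp add: L_def)
    qed
  qed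
  moreover have "K \<subseteq> L"
  proof
    fix k assume k: "k \<in> K"
    then have "conjugate E k \<in> real_form"
      using E K(2) conjugate_closed by (auto simp: real_form_def conjugate_def[symmetric])
    then show "k \<in> L" using E8 by (auto simp: L_def intro!: image_eqI[of _ _ "conjugate E k"])
  qed
  ultimately have "L = K" using assms by (simp add: maximal_compact_subgroup_def compact_subgroup_def)
  then show ?thesis using that E(1) by (simp add: L_def)
qed

end

locale rank_one_pair = self_adjoint_group G for G +
  fixes H :: "cmat set" and X :: cmat and v w :: "complex^8" and m :: real
  assumes HG: "H \<subseteq> G" and H_one: "mat 1 \<in> H"
    and H_mult: "g \<in> H \<Longrightarrow> h \<in> H \<Longrightarrow> g ** h \<in> H"
    and H_transp: "g \<in> H \<Longrightarrow> transpose g \<in> H"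
    and lie: "lie_algebra (Lie G)"
    and X_real: "mcnj X = X" and X_Lie: "X \<in> Lie G"
    and decomposition: "g \<in> G \<Longrightarrow> \<exists>k t h. k \<in> real_form \<and> h \<in> H \<and> g = k ** mat_exp (t *\<^sub>R cscale \<i> X) ** h"
    and rigid: "c \<in> G \<Longrightarrow> (\<And>Y. Y \<in> Lie G \<Longrightarrow> mcnj Y = Y \<Longrightarrow> X ** Y = Y ** X \<Longrightarrow> c ** Y = Y ** c) \<Longrightarrow>
        (\<And>Y. Y \<in> Lie H \<Longrightarrow> mcnj Y = Y \<Longrightarrow> conjugate c Y \<in> Lie H) \<Longrightarrow> mcnj c = c"
    and rotation: "X *v v = of_real m *s w" "X *v w = - (of_real m *s v)" "vcnj v = v" "vcnj w = w" "w \<noteq> 0" "m \<noteq> 0"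
    and orth: "Y \<in> Lie H \<Longrightarrow> killing (Lie G) Y (cscale z X) = 0"
begin

definition a :: "real \<Rightarrow> cmat" where "a t = mat_exp (t *\<^sub>R cscale \<i> X)"

lemma iX_Lie: "cscale c X \<in> Lie G"
  using lie X_Lie by (simp add: lie_algebra_def cmat.subspace_scale)

lemma a_G: "a t \<in> G"
  using iX_Lie[of \<i>] by (simp add: a_def Lie_def)

lemma a_add: "a s ** a t = a (s + t)"
  by (simp add: a_def mat_exp_add)

lemma a_0: "a 0 = mat 1"
  by (simp add: a_def)

lemma transpose_a: "transpose (a t) = a (- t)"
  using transpose_mat_exp[OF SO8[OF a_G[unfolded a_def]]] by (simp add: a_def)

lemma a_real_imp_0:
  assumes "mcnj (a t) = a t" shows "t = 0"
proof -
  have av: "a t *v v = of_real (cosh (m * t)) *s v + (\<i> * of_real (sinh (m * t))) *s w"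
    unfolding a_def by (rule mat_exp_hyperbolic_rotation[OF rotation(1,2) refl])
  have "vcnj (a t *v v) = a t *v v" using assms rotation by simp
  then have "(2 * \<i> * of_real (sinh (m * t))) *s w = 0"
    unfolding av using rotation(3,4) by (simp add: vec_eq_iff algebra_simps)
  then have "sinh (m * t) = 0" using rotation(5) by (auto simp: vec_eq_iff)
  then show ?thesis using rotation(6) by simp
qed

lemma H_conjugate: "g \<in> H \<Longrightarrow> h \<in> H \<Longrightarrow> conjugate g h \<in> H"
  unfolding conjugate_def by (intro H_mult H_transp)

lemma Lie_conjugate: "S \<in> G \<Longrightarrow> Y \<in> Lie G \<Longrightarrow> conjugate S Y \<in> Lie G"
  using conjugate_closed by (simp add: Lie_def SO8 flip: conjugate_mat_exp)

lemma Lie_H_conjugate: "S \<in> H \<Longrightarrow> Y \<in> Lie H \<Longrightarrow> conjugate S Y \<in> Lie H"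
  using H_conjugate HG SO8 by (auto simp: Lie_def simp flip: conjugate_mat_exp)

lemma twist_trivial:
  assumes hom: "\<And>g. g \<in> G \<Longrightarrow> \<psi> g \<in> G" "\<And>g h. g \<in> G \<Longrightarrow> h \<in> G \<Longrightarrow> \<psi> (g ** h) = \<psi> g ** \<psi> h"
    and inv: "\<And>g. g \<in> G \<Longrightarrow> \<psi> (\<psi> g) = g"
    and fixed: "\<And>g. g \<in> G \<Longrightarrow> \<psi> g = g \<longleftrightarrow> mcnj g = g"
    and H': "\<And>h. h \<in> H \<Longrightarrow> \<exists>h'\<in>H. \<psi> (conjugate (a t) h) = conjugate (a t) h'"
  shows "t = 0"
proof -
  define b c where "b = \<psi> (a t)" and "c = a (- t) ** b"
  have bG: "b \<in> G" and cG: "c \<in> G" using hom a_G mult by (auto simp: b_def c_def)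
  have b: "b = a t ** c"
    by (simp add: c_def matrix_mul_assoc a_add a_0)
  have "b ** \<psi> (a (- t)) = \<psi> (a t ** a (- t))" using hom(2) a_G by (simp add: b_def)
  also have "\<dots> = mat 1" using fixed[OF one] by (simp add: a_add a_0)
  finally have 1: "b ** \<psi> (a (- t)) = mat 1" .
  have "\<psi> (a (- t)) = transpose b ** b ** \<psi> (a (- t))" using SO8_D(2)[OF SO8[OF bG]] by simp
  then have \<psi>_inv: "\<psi> (a (- t)) = transpose b" using 1 by (simp flip: matrix_mul_assoc)
  have c_comm: "c ** Y = Y ** c" if Y: "Y \<in> Lie G" "mcnj Y = Y" "X ** Y = Y ** X" for Y
  proof -
    define M where "M s = mat_exp (s *\<^sub>R Y)" for s
    have MG: "M s \<in> G" for s using Y by (simp add: M_def Lie_def)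
    have M_fix: "\<psi> (M s) = M s" for s
      using fixed[OF MG] Y(2) by (simp add: M_def flip: mat_exp_mcnj)
    have "cscale \<i> X ** M s = M s ** cscale \<i> X" for s
    proof -
      have "Y ** X = X ** Y" using Y(3) by simp
      from mat_exp_commutes[OF Y(3), of s] show ?thesis
        by (simp add: M_def cmat_eq_iff cscale_mult_vector vector_scalar_commute flip: matrix_vector_mul_assoc)
    qed
    from mat_exp_commutes[OF this[symmetric]] have aM: "M s ** a r = a r ** M s" for s r
      by (simp add: a_def)
    have bM: "M s ** b = b ** M s" for s
    proof -
      have "M s ** b = \<psi> (M s ** a t)" using hom(2)[OF MG a_G] by (simp add: M_fix b_def)
      also have "\<dots> = b ** M s" unfolding aM using hom(2)[OF a_G MG] by (simp add: M_fix b_def)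
      finally show ?thesis .
    qed
    have "c ** M s = M s ** c" for s
    proof -
      have "c ** M s = a (- t) ** (b ** M s)" by (simp add: c_def matrix_mul_assoc)
      also have "\<dots> = (a (- t) ** M s) ** b" by (simp add: bM[symmetric] matrix_mul_assoc)
      also have "\<dots> = M s ** c" by (simp add: aM[symmetric] c_def matrix_mul_assoc)
      finally show ?thesis .
    qed
    then have "conjugate c (M s) = M s" for s using conjugate_commute SO8[OF cG] by blast
    then have "mat_exp (s *\<^sub>R conjugate c Y) = mat_exp (s *\<^sub>R Y)" for s
      by (simp add: M_def conjugate_mat_exp SO8[OF cG])
    then have "conjugate c Y = Y" by (rule mat_exp_inject)
    then show ?thesis using conjugate_commute SO8[OF cG] by blast
  qed
  have "conjugate c Y \<in> Lie H" if Y: "Y \<in> Lie H" "mcnj Y = Y" for Y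
    unfolding Lie_def
  proof (intro CollectI allI)
    fix s
    define M where "M = mat_exp (s *\<^sub>R Y)"
    have M: "M \<in> H" "M \<in> G" using Y HG by (auto simp: M_def Lie_def)
    then have "\<psi> M = M" using fixed[of M] Y(2) by (simp add: M_def flip: mat_exp_mcnj)
    obtain h' where h': "h' \<in> H" "\<psi> (conjugate (a t) M) = conjugate (a t) h'" using H'[OF M(1)] by blast
    have "\<psi> (conjugate (a t) M) = \<psi> (a t ** M) ** \<psi> (a (- t))"
      using hom(2)[OF mult[OF a_G M(2)] a_G] by (simp add: conjugate_def transpose_a)
    also have "\<dots> = conjugate b M"
      using hom(2)[OF a_G M(2)] by (simp add: \<open>\<psi> M = M\<close> \<psi>_inv conjugate_def b_def)
    finally have "conjugate b M = conjugate (a t) h'" using h' by simp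
    then have "conjugate (a (- t)) (conjugate b M) = h'"
      using conjugate_inverse(1)[OF SO8[OF a_G[of t]]] by (simp add: transpose_a)
    then have "conjugate c M = h'" by (simp add: conjugate_conjugate c_def)
    then show "mat_exp (s *\<^sub>R conjugate c Y) \<in> H"
      using h'(1) by (simp add: M_def SO8[OF cG] flip: conjugate_mat_exp)
  qed
  with rigid[OF cG c_comm] have c_real: "mcnj c = c" by blast
  have "X ** c = c ** X" using c_comm[OF X_Lie X_real refl] by simp
  then have "c ** cscale \<i> X = cscale \<i> X ** c"
    by (simp add: cmat_eq_iff cscale_mult_vector vector_scalar_commute flip: matrix_vector_mul_assoc)
  from mat_exp_commutes[OF this] have ca: "c ** a s = a s ** c" for s by (simp add: a_def)
  have "a t = \<psi> (a t ** c)" using inv[OF a_G[of t]] by (simp add: b_def[symmetric] b[symmetric])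
  also have "\<dots> = b ** c" using hom(2)[OF a_G cG] fixed[OF cG] c_real by (simp add: b_def)
  finally have "a t = a t ** (c ** c)" by (simp add: b matrix_mul_assoc)
  then have "a (- t) ** a t = a (- t) ** a t ** (c ** c)" by (metis matrix_mul_assoc)
  then have cc: "c ** c = mat 1" by (simp add: a_add a_0)
  have "\<psi> (a t ** a t) = a t ** (c ** a t) ** c" using hom(2)[OF a_G a_G] by (simp add: b_def[symmetric] b matrix_mul_assoc)
  also have "\<dots> = a t ** a t ** (c ** c)" by (simp add: ca matrix_mul_assoc)
  finally have "\<psi> (a (t + t)) = a (t + t)" by (simp add: cc a_add)
  then have "mcnj (a (t + t)) = a (t + t)" using fixed[OF a_G] by blast
  then have "t + t = 0" by (rule a_real_imp_0)
  then show ?thesis by simp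
qed

lemma fixed_group_conjugate_real_form:
  assumes \<theta>: "cartan_involution G \<theta>" and \<theta>H: "\<theta> ` H = H"
  obtains h where "h \<in> H" "fixed_group G \<theta> = conjugate (transpose h) ` real_form"
proof -
  have \<theta>_hom: "\<theta> g \<in> G" "\<theta> (g ** h) = \<theta> g ** \<theta> h" if "g \<in> G" "h \<in> G" for g h
    using \<theta> that by (auto simp: cartan_involution_def iso_def hom_def matrix_group_def)
  have \<theta>_inv: "\<theta> (\<theta> g) = g" if "g \<in> G" for g
    using \<theta> that by (simp add: cartan_involution_def)
  obtain E where E: "E \<in> G" "fixed_group G \<theta> = conjugate (transpose E) ` real_form"
    using \<theta> real_form_conjugates[of "fixed_group G \<theta>"] by (auto simp: cartan_involution_def)
  obtain k t h where kh: "k \<in> real_form" "h \<in> H" "E = k ** a t ** h"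
    using decomposition[OF E(1)] by (auto simp: a_def)
  define q where "q = a t ** h"
  have hG: "h \<in> G" and kG: "k \<in> G" using kh HG by (auto simp: real_form_def)
  have qG: "q \<in> G" using mult a_G hG by (simp add: q_def)
  have q8: "q \<in> SO8" "transpose q \<in> SO8" "transpose q \<in> G" using SO8 transp qG by auto
  have Eq: "E = k ** q" by (simp add: kh q_def matrix_mul_assoc)
  have k_real: "conjugate k ` real_form = real_form" if "k \<in> real_form" for k
  proof -
    have k8: "k \<in> SO8" using that SO8 by (auto simp: real_form_def)
    have tk: "transpose k \<in> real_form" using that by (simp add: real_form_def transp)
    have cl: "conjugate k u \<in> real_form" if "k \<in> real_form" "u \<in> real_form" for k u
      using that by (simp add: real_form_def conjugate_closed) (simp add: conjugate_def)
    show ?thesis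
    proof (intro equalityI subsetI)
      fix u assume "u \<in> real_form"
      then have "conjugate (transpose k) u \<in> real_form" by (rule cl[OF tk])
      then show "u \<in> conjugate k ` real_form" using k8 by (intro image_eqI[of _ _ "conjugate (transpose k) u"]) auto
    qed (use cl that in auto)
  qed
  have "fixed_group G \<theta> = conjugate (transpose q) ` (conjugate (transpose k) ` real_form)"
    unfolding E(2) Eq image_image by (simp add: conjugate_conjugate matrix_transpose_mul)
  also have "conjugate (transpose k) ` real_form = real_form"
    by (rule k_real) (use kh in \<open>simp add: real_form_def transp\<close>)
  finally have Kq: "fixed_group G \<theta> = conjugate (transpose q) ` real_form" .
  define \<psi> where "\<psi> g = conjugate q (\<theta> (conjugate (transpose q) g))" for g
  have cq: "conjugate (transpose q) g \<in> G" if "g \<in> G" for g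
    using that q8 conjugate_closed by blast
  have "t = 0"
  proof (rule twist_trivial[of \<psi>])
    show "\<psi> g \<in> G" if "g \<in> G" for g
      unfolding \<psi>_def by (intro conjugate_closed qG \<theta>_hom(1)[OF _ one] cq that)
    show "\<psi> (g ** h) = \<psi> g ** \<psi> h" if "g \<in> G" "h \<in> G" for g h
      using that q8 cq by (simp add: \<psi>_def conjugate_mult \<theta>_hom(2))
    show "\<psi> (\<psi> g) = g" if "g \<in> G" for g
      using that q8 cq by (simp add: \<psi>_def \<theta>_inv)
    show "\<psi> g = g \<longleftrightarrow> mcnj g = g" if g: "g \<in> G" for g
    proof -
      have "\<psi> g = g \<longleftrightarrow> \<theta> (conjugate (transpose q) g) = conjugate (transpose q) g"
        unfolding \<psi>_def using q8(1) by (metis conjugate_inverse)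
      also have "\<dots> \<longleftrightarrow> conjugate (transpose q) g \<in> fixed_group G \<theta>"
        using cq[OF g] by (simp add: fixed_group_def)
      also have "\<dots> \<longleftrightarrow> g \<in> real_form"
        unfolding Kq using conjugate_inverse(2)[OF q8(1)] by (auto simp: image_iff) (metis)
      finally show ?thesis using g by (simp add: real_form_def)
    qed
    show "\<exists>h'\<in>H. \<psi> (conjugate (a t) h1) = conjugate (a t) h'" if h1: "h1 \<in> H" for h1
    proof -
      have "conjugate (transpose q) (conjugate (a t) h1) = conjugate (transpose h) h1"
        using SO8_D(2)[OF SO8[OF a_G[of t]]]
        by (simp add: q_def conjugate_conjugate matrix_transpose_mul) (simp flip: matrix_mul_assoc)
      moreover have "\<theta> (conjugate (transpose h) h1) \<in> H"
        using \<theta>H H_conjugate[OF H_transp[OF kh(2)] h1] by blast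
      ultimately show ?thesis
        using H_conjugate[OF kh(2)]
        by (intro bexI[of _ "conjugate h (\<theta> (conjugate (transpose h) h1))"])
          (auto simp: \<psi>_def q_def conjugate_conjugate)
    qed
  qed
  then have "q = h" by (simp add: q_def a_0)
  with Kq kh that show ?thesis by blast
qed

theorem rank_one_decomposition:
  assumes \<theta>: "cartan_involution G \<theta>" and \<theta>H: "\<theta> ` H = H"
  shows "\<exists>\<aa> :: cmat set.
           subspace \<aa> \<and> dim \<aa> = 1 \<and> (\<forall>X\<in>\<aa>. \<forall>Y\<in>\<aa>. lie_bracket X Y = 0) \<and>
           \<aa> \<subseteq> cscale \<i> ` Lie (fixed_group G \<theta>) \<inter> killing_complement (Lie G) (Lie H) \<and>
           G = {k ** a ** h | k a h. k \<in> fixed_group G \<theta> \<and> a \<in> mat_exp ` \<aa> \<and> h \<in> H}"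
proof -
  obtain h where h: "h \<in> H" and K: "fixed_group G \<theta> = conjugate (transpose h) ` real_form"
    by (rule fixed_group_conjugate_real_form[OF \<theta> \<theta>H])
  define T where "T = transpose h"
  have hG: "h \<in> G" and TG: "T \<in> G" and TH: "T \<in> H" and h8: "h \<in> SO8" and T8: "T \<in> SO8"
    using h HG transp H_transp SO8 by (auto simp: T_def)
  have hT: "h ** T = mat 1" "T ** h = mat 1" using SO8_D[OF h8] by (auto simp: T_def)
  have hT_inv: "conjugate h (conjugate T A) = A" "conjugate T (conjugate h A) = A" for A
    using hT by (simp_all add: conjugate_conjugate)
  define Z where "Z = conjugate T (cscale \<i> X)"
  define \<aa> where "\<aa> = span {Z}"
  have \<aa>: "\<aa> = {r *\<^sub>R Z | r. True}" by (auto simp: \<aa>_def span_singleton)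
  have rZ: "r *\<^sub>R Z = conjugate T (cscale (of_real r * \<i>) X)" for r
    by (simp add: Z_def scaleR_cscale flip: conjugate_cscale)
  have exp_rZ: "mat_exp (r *\<^sub>R Z) = conjugate T (a r)" for r
    by (simp add: Z_def a_def conjugate_mat_exp T8)
  have "Z \<noteq> 0"
  proof
    assume "Z = 0"
    then have "conjugate h Z = 0" by (simp add: conjugate_def)
    then have "cscale \<i> X = 0" by (simp add: Z_def hT_inv)
    then have "cscale \<i> X *v v = 0" by simp
    then show False using rotation by (simp add: cscale_mult_vector)
  qed
  show ?thesis
  proof (intro exI[of _ \<aa>] conjI ballI)
    show "subspace \<aa>" by (simp add: \<aa>_def)
    show "dim \<aa> = 1" using \<open>Z \<noteq> 0\<close> by (simp add: \<aa>_def)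
    show "lie_bracket A B = 0" if "A \<in> \<aa>" "B \<in> \<aa>" for A B
      using that by (auto simp: \<aa> lie_bracket_def mm.scaleR_left mm.scaleR_right)
    show "\<aa> \<subseteq> cscale \<i> ` Lie (fixed_group G \<theta>) \<inter> killing_complement (Lie G) (Lie H)"
    proof
      fix A assume "A \<in> \<aa>"
      then obtain r where A: "A = r *\<^sub>R Z" by (auto simp: \<aa>)
      have "A = cscale \<i> (r *\<^sub>R conjugate T X)"
        by (simp add: A Z_def conjugate_cscale scaleR_cscale_right)
      moreover have "r *\<^sub>R conjugate T X \<in> Lie (fixed_group G \<theta>)"
        unfolding Lie_def
      proof (intro CollectI allI)
        fix s
        have "mat_exp ((s * r) *\<^sub>R X) \<in> real_form"
          using X_Lie X_real by (simp add: real_form_def Lie_def flip: mat_exp_mcnj)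
        then have "conjugate T (mat_exp ((s * r) *\<^sub>R X)) \<in> fixed_group G \<theta>" by (simp add: K T_def)
        then show "mat_exp (s *\<^sub>R (r *\<^sub>R conjugate T X)) \<in> fixed_group G \<theta>"
          by (simp add: conjugate_mat_exp T8)
      qed
      moreover have "A \<in> killing_complement (Lie G) (Lie H)"
        unfolding killing_complement_def
      proof (intro CollectI conjI ballI)
        show A_Lie: "A \<in> Lie G" unfolding A rZ by (intro Lie_conjugate TG iX_Lie)
        fix Y assume Y: "Y \<in> Lie H"
        have "Y \<in> Lie G" using Y HG by (auto simp: Lie_def)
        moreover have "(\<lambda>W. h ** W ** transpose h) ` Lie G = Lie G"
        proof (intro equalityI subsetI)
          fix W assume "W \<in> Lie G"
          then have "conjugate T W \<in> Lie G" using Lie_conjugate TG by blast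
          moreover have "W = h ** conjugate T W ** transpose h" using hT_inv(1) by (simp add: conjugate_def)
          ultimately show "W \<in> (\<lambda>W. h ** W ** transpose h) ` Lie G" by blast
        qed (use Lie_conjugate[OF hG] in \<open>auto simp: conjugate_def\<close>)
        ultimately have "killing (Lie G) (conjugate h Y) (conjugate h A) = killing (Lie G) Y A"
          unfolding conjugate_def using killing_conjugate[OF lie _ A_Lie] hT by (simp add: T_def)
        moreover have "conjugate h A = cscale (of_real r * \<i>) X" by (simp add: A rZ hT_inv)
        ultimately show "killing (Lie G) Y A = 0" using orth[OF Lie_H_conjugate[OF h Y]] by simp
      qed
      ultimately show "A \<in> cscale \<i> ` Lie (fixed_group G \<theta>) \<inter> killing_complement (Lie G) (Lie H)" by blast
    qed
    show "G = {k ** a ** h | k a h. k \<in> fixed_group G \<theta> \<and> a \<in> mat_exp ` \<aa> \<and> h \<in> H}"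
    proof (intro equalityI subsetI)
      fix g assume g: "g \<in> G"
      obtain k t h1 where kh: "k \<in> real_form" "h1 \<in> H" "conjugate h g = k ** a t ** h1"
        using decomposition[OF conjugate_closed[OF hG g]] by (auto simp: a_def)
      have "g = conjugate T (k ** a t ** h1)" using kh(3) hT_inv(2)[of g] by simp
      then have "g = conjugate T k ** mat_exp (t *\<^sub>R Z) ** conjugate T h1"
        by (simp add: conjugate_mult T8 exp_rZ)
      moreover have "conjugate T k \<in> fixed_group G \<theta>" using kh by (simp add: K T_def)
      moreover have "conjugate T h1 \<in> H" using H_conjugate TH kh by blast
      moreover have "mat_exp (t *\<^sub>R Z) \<in> mat_exp ` \<aa>" by (auto simp: \<aa>)
      ultimately show "g \<in> {k ** a ** h | k a h. k \<in> fixed_group G \<theta> \<and> a \<in> mat_exp ` \<aa> \<and> h \<in> H}"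
        by blast
    next
      fix g assume "g \<in> {k ** a ** h | k a h. k \<in> fixed_group G \<theta> \<and> a \<in> mat_exp ` \<aa> \<and> h \<in> H}"
      then obtain k r h1 where "g = k ** conjugate T (a r) ** h1" "k \<in> fixed_group G \<theta>" "h1 \<in> H"
        by (auto simp: \<aa> exp_rZ)
      then show "g \<in> G"
        using HG mult conjugate_closed[OF TG a_G] by (auto simp: fixed_group_def)
    qed
  qed
qed

end

section \<open>The three pairs\<close>

text \<open>\<open>plane i j\<close> maps \<open>e\<^sub>i\<close> to \<open>e\<^sub>j\<close> and \<open>e\<^sub>j\<close> to \<open>- e\<^sub>i\<close>.\<close>

definition plane :: "8 \<Rightarrow> 8 \<Rightarrow> cmat" where
  "plane i j = (\<chi> k l. (if k = j \<and> l = i then 1 else 0) - (if k = i \<and> l = j then 1 else 0))"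

lemma plane_vector [simp]:
  "(plane i j *v x) $ k = (if k = j then x $ i else 0) - (if k = i then x $ j else 0)"
proof -
  have *: "(\<Sum>l\<in>UNIV. (if P \<and> l = i then 1 else 0) * x $ l) = (if P then x $ i else 0)" for P i
  proof (cases P)
    case True
    have "(\<Sum>l\<in>UNIV. (if l = i then 1 else 0) * x $ l) = (\<Sum>l\<in>UNIV. if l = i then x $ l else 0)"
      by (rule sum.cong) auto
    with True show ?thesis by simp
  qed simp
  show ?thesis
    by (simp only: plane_def matrix_vector_mult_def vec_lambda_beta left_diff_distrib sum_subtractf *)
qed

lemma plane_vector_axis: "plane i j *v x = x $ i *s e j - x $ j *s e i"
  by (rule vec_eq_iff[THEN iffD2], rule allI) simp

lemma plane_real [simp]: "mcnj (plane i j) = plane i j"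
proof (rule cmat_eqI)
  fix x
  have "mcnj (plane i j) *v x = vcnj (plane i j *v vcnj x)" by (simp only: vcnj_mult vcnj_simps)
  also have "\<dots> = plane i j *v x"
    by (simp only: plane_vector_axis vcnj_simps vcnj_nth complex_cnj_cnj)
  finally show "mcnj (plane i j) *v x = plane i j *v x" .
qed

lemma skew_plane: "skew (plane i j)"
  unfolding skew_iff plane_vector_axis by (simp add: mult.commute)

lemma skew_diff: "skew X \<Longrightarrow> skew Y \<Longrightarrow> skew (X - Y)"
  by (simp add: skew_def)

lemma skew_scaleR: "skew X \<Longrightarrow> skew (r *\<^sub>R X)"
  by (simp add: scaleR_cscale skew_cscale)

text \<open>If \<open>e\<^sub>i e\<^sub>j = e\<^sub>k\<close> for the three pairs \<open>(i, j)\<close> with a fixed \<open>k\<close>, then a combination of the three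
  \<open>plane i j\<close> is a derivation iff its coefficients add up to zero. All of these but \<open>der3\<close> kill
  \<open>e\<^sub>1\<close>; \<open>der1\<close>, \<open>der2\<close> span a Cartan subalgebra. \<open>X_so\<close> is the action of \<open>X_spin\<close> in the vector representation.\<close>

definition der1 where "der1 = plane 2 3 - plane 4 5"
definition der2 where "der2 = plane 4 5 - plane 6 7"
definition der3 where "der3 = 2 *\<^sub>R plane 1 2 - plane 5 6 - plane 4 7"
definition der4 where "der4 = plane 4 2 - plane 3 5"
definition der5 where "der5 = plane 5 7 - plane 6 4"
definition der6 where "der6 = plane 5 6 - plane 4 7"
definition X_spin where "X_spin = 3 *\<^sub>R plane 0 1 - plane 2 3 - plane 4 5 - plane 6 7"
definition X_so where "X_so = 2 *\<^sub>R (plane 2 3 + plane 4 5 + plane 6 7)"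

lemmas generator_defs = der1_def der2_def der3_def der4_def der5_def der6_def X_spin_def X_so_def

lemma generator_real [simp]:
  "mcnj der1 = der1" "mcnj der2 = der2" "mcnj der3 = der3" "mcnj der4 = der4" "mcnj der5 = der5" "mcnj der6 = der6"
  "mcnj X_spin = X_spin" "mcnj X_so = X_so"
  by (simp_all add: generator_defs)

lemma generator_skew: "skew der1" "skew der2" "skew der3" "skew der4" "skew der5" "skew der6" "skew X_spin" "skew X_so"
  unfolding generator_defs by (intro skew_diff skew_add skew_scaleR skew_plane)+

lemmas generator_vector = generator_defs mv.diff_left mv.add_left mv.scaleR_left

lemma generator_nth:
  "(der1 *v x) = (\<chi> k. if k = 2 then - x$3 else if k = 3 then x$2 else if k = 4 then x$5 else if k = 5 then - x$4 else 0)"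
  "(der2 *v x) = (\<chi> k. if k = 4 then - x$5 else if k = 5 then x$4 else if k = 6 then x$7 else if k = 7 then - x$6 else 0)"
  "(der3 *v x) = (\<chi> k. if k = 1 then - 2 * x$2 else if k = 2 then 2 * x$1 else if k = 5 then x$6 else if k = 6 then - x$5
      else if k = 4 then x$7 else if k = 7 then - x$4 else 0)"
  "(der4 *v x) = (\<chi> k. if k = 4 then - x$2 else if k = 2 then x$4 else if k = 3 then x$5 else if k = 5 then - x$3 else 0)"
  "(der5 *v x) = (\<chi> k. if k = 5 then - x$7 else if k = 7 then x$5 else if k = 6 then x$4 else if k = 4 then - x$6 else 0)"
  "(der6 *v x) = (\<chi> k. if k = 5 then - x$6 else if k = 6 then x$5 else if k = 4 then x$7 else if k = 7 then - x$4 else 0)"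
  "(X_spin *v x) = (\<chi> k. if k = 0 then - 3 * x$1 else if k = 1 then 3 * x$0 else if k = 2 then x$3 else if k = 3 then - x$2
      else if k = 4 then x$5 else if k = 5 then - x$4 else if k = 6 then x$7 else - x$6)"
  "(X_so *v x) = (\<chi> k. if k = 2 then - 2 * x$3 else if k = 3 then 2 * x$2
      else if k = 4 then - 2 * x$5 else if k = 5 then 2 * x$4 else if k = 6 then - 2 * x$7 else if k = 7 then 2 * x$6 else 0)"
  by (simp_all add: vec8_eq_iff generator_vector scaleR_conv_of_real[where 'a=complex])

lemma spin_derivation_X: "spin_derivation X_so X_spin"
  unfolding spin_derivation_def
  by (simp add: generator_skew) (simp add: vec8_eq_iff generator_nth cayley_mult_nth algebra_simps)

lemma spin_derivation_der:
  "spin_derivation der1 der1" "spin_derivation der2 der2" "spin_derivation der3 der3"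
  "spin_derivation der4 der4" "spin_derivation der5 der5" "spin_derivation der6 der6"
  unfolding spin_derivation_def
  by (simp_all add: generator_skew) (simp_all add: vec8_eq_iff generator_nth cayley_mult_nth algebra_simps)

lemma commute_iff_vector: "A ** B = B ** (A::cmat) \<longleftrightarrow> (\<forall>x. A *v (B *v x) = B *v (A *v x))"
  by (simp add: cmat_eq_iff flip: matrix_vector_mul_assoc)

lemma X_commutes:
  "X_so ** der1 = der1 ** X_so" "X_so ** der2 = der2 ** X_so" "X_so ** der4 = der4 ** X_so" "X_so ** der5 = der5 ** X_so"
  "X_spin ** der1 = der1 ** X_spin" "X_spin ** der2 = der2 ** X_spin" "X_spin ** der4 = der4 ** X_spin" "X_spin ** der5 = der5 ** X_spin"
  "der3 ** der2 = der2 ** der3" "der3 ** der5 = der5 ** der3" "der3 ** der6 = der6 ** der3"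
  unfolding commute_iff_vector by (simp_all add: vec8_eq_iff generator_nth)

lemma mcnj_eqI: "(\<And>i. vcnj (c *v e i) = c *v e i) \<Longrightarrow> mcnj c = c"
  by (simp add: vec_eq_iff)

lemma csquare_real: "(z::complex)\<^sup>2 = of_real r \<Longrightarrow> r \<ge> 0 \<Longrightarrow> cnj z = z"
proof -
  assume z: "z\<^sup>2 = of_real r" "r \<ge> 0"
  then have "z\<^sup>2 = (of_real (sqrt r))\<^sup>2" by (simp flip: of_real_power)
  then have "z = of_real (sqrt r) \<or> z = - of_real (sqrt r)" by (simp add: power2_eq_iff)
  then show ?thesis by auto
qed

lemma torus_block:
  assumes c: "c ** der1 = der1 ** c" "c ** der2 = der2 ** c" "c ** der4 = der4 ** c" "c ** der5 = der5 ** c"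
  obtains \<alpha> \<beta> where "c *v e 2 = \<alpha> *s e 2 + \<beta> *s e 3" "c *v e 3 = \<alpha> *s e 3 - \<beta> *s e 2"
    "c *v e 4 = \<alpha> *s e 4 + \<beta> *s e 5" "c *v e 5 = \<alpha> *s e 5 - \<beta> *s e 4"
    "c *v e 6 = \<alpha> *s e 6 + \<beta> *s e 7" "c *v e 7 = \<alpha> *s e 7 - \<beta> *s e 6"
proof -
  have comm: "c *v (A *v x) = A *v (c *v x)" if "c ** A = A ** c" for A x
    using that by (simp add: commute_iff_vector)
  have A_e: "der1 *v e 2 = e 3" "der1 *v e 3 = - e 2" "der2 *v e 2 = 0" "der4 *v e 2 = - e 4" "der4 *v e 3 = - e 5"
    "der5 *v e 4 = e 6" "der5 *v e 5 = e 7"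
    by (simp_all add: generator_nth vec8_eq_iff)
  have c3: "c *v e 3 = der1 *v (c *v e 2)" using comm[OF c(1), of "e 2"] A_e by simp
  have c2: "c *v e 2 = - (der1 *v (c *v e 3))" using comm[OF c(1), of "e 3"] A_e by (metis minus_minus matrix_vector_uminus(2))
  have "der2 *v (c *v e 2) = 0" using comm[OF c(2), of "e 2"] A_e by simp
  then have z: "c $ 4 $ 2 = 0" "c $ 5 $ 2 = 0" by (simp_all add: generator_nth vec8_eq_iff)
  define \<alpha> \<beta> where "\<alpha> = c $ 2 $ 2" and "\<beta> = c $ 3 $ 2"
  have 2: "c *v e 2 = \<alpha> *s e 2 + \<beta> *s e 3"
    using c2 z unfolding generator_nth vec8_eq_iff by (simp add: \<alpha>_def \<beta>_def)
  have 3: "c *v e 3 = \<alpha> *s e 3 - \<beta> *s e 2" unfolding c3 2 by (simp add: generator_nth vec8_eq_iff)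
  have "- (c *v e 4) = der4 *v (c *v e 2)" "- (c *v e 5) = der4 *v (c *v e 3)"
    using comm[OF c(3), of "e 2"] comm[OF c(3), of "e 3"] unfolding A_e by simp_all
  then have 45: "c *v e 4 = - (der4 *v (c *v e 2))" "c *v e 5 = - (der4 *v (c *v e 3))"
    by (metis minus_minus)+
  have 4: "c *v e 4 = \<alpha> *s e 4 + \<beta> *s e 5" "c *v e 5 = \<alpha> *s e 5 - \<beta> *s e 4"
    unfolding 45 2 3 by (simp_all add: generator_nth vec8_eq_iff)
  have 67: "c *v e 6 = der5 *v (c *v e 4)" "c *v e 7 = der5 *v (c *v e 5)"
    using comm[OF c(4), of "e 4"] comm[OF c(4), of "e 5"] unfolding A_e by simp_all
  have 6: "c *v e 6 = \<alpha> *s e 6 + \<beta> *s e 7" "c *v e 7 = \<alpha> *s e 7 - \<beta> *s e 6"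
    unfolding 67 4 by (simp_all add: generator_nth vec8_eq_iff)
  show ?thesis by (rule that[OF 2 3 4 6])
qed

lemma torus_rigid:
  assumes c: "c ** der1 = der1 ** c" "c ** der2 = der2 ** c" "c ** der4 = der4 ** c" "c ** der5 = der5 ** c" "c \<in> SO8"
    and \<epsilon>: "\<epsilon> * \<epsilon> = 1" "vcnj (c *v e 0) = c *v e 0" "c *v e 1 = \<epsilon> *s e 1"
    and prod: "(c *v e 2) \<bullet>\<^sub>C (c *v e 4) = - (\<epsilon> *s (c *v e 6))"
  shows "mcnj c = c"
proof -
  obtain \<alpha> \<beta> where ce: "c *v e 2 = \<alpha> *s e 2 + \<beta> *s e 3" "c *v e 3 = \<alpha> *s e 3 - \<beta> *s e 2"
    "c *v e 4 = \<alpha> *s e 4 + \<beta> *s e 5" "c *v e 5 = \<alpha> *s e 5 - \<beta> *s e 4"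
    "c *v e 6 = \<alpha> *s e 6 + \<beta> *s e 7" "c *v e 7 = \<alpha> *s e 7 - \<beta> *s e 6"
    by (rule torus_block[OF c(1-4)])
  have norm: "\<alpha>\<^sup>2 + \<beta>\<^sup>2 = 1"
    using SO8_bil[OF c(5), of "e 2" "e 2"] unfolding ce by (simp add: power2_eq_square)
  have "2 * (\<alpha> * \<beta>) = - (\<epsilon> * \<beta>)"
    using arg_cong[OF prod, of "\<lambda>x. x $ 7"] unfolding ce by (simp add: cayley_mult_nth algebra_simps)
  then have "\<beta> * (2 * \<alpha> + \<epsilon>) = 0" by (simp add: algebra_simps)
  then consider "\<beta> = 0" | "2 * \<alpha> + \<epsilon> = 0" by auto
  then have real: "cnj \<alpha> = \<alpha> \<and> cnj \<beta> = \<beta>"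
  proof cases
    case 1
    then show ?thesis using csquare_real[of \<alpha> 1] norm by simp
  next
    case 2
    then have "\<epsilon> = - 2 * \<alpha>" by (simp add: eq_neg_iff_add_eq_0 add.commute)
    then have "4 * \<alpha>\<^sup>2 = 1" using \<epsilon>(1) by (simp add: power2_eq_square)
    then have \<alpha>: "\<alpha>\<^sup>2 = of_real (1/4)" by (metis mult.commute nonzero_mult_div_cancel_right of_real_1 of_real_divide of_real_numeral zero_neq_numeral)
    moreover have "\<beta>\<^sup>2 = of_real (3/4)"
    proof -
      have "\<beta>\<^sup>2 = 1 - \<alpha>\<^sup>2" using norm by (simp add: eq_diff_eq add.commute)
      then show ?thesis unfolding \<alpha> by simp
    qed
    ultimately show ?thesis using csquare_real[of \<alpha> "1/4"] csquare_real[of \<beta> "3/4"] by simp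
  qed
  have "cnj \<epsilon> = \<epsilon>" using csquare_real[of \<epsilon> 1] \<epsilon>(1) by (simp add: power2_eq_square)
  show ?thesis
  proof (rule mcnj_eqI)
    fix i
    show "vcnj (c *v e i) = c *v e i"
      using exhaust_8[of i] \<epsilon>(2) real \<open>cnj \<epsilon> = \<epsilon>\<close>
      by (elim disjE; simp only: \<epsilon>(3) ce) (simp_all del: vcnj_mult)
  qed
qed

lemma mat_exp_hyperbolic_rotation_scaled:
  assumes "X *v v = of_real m *s w" "X *v w = - (of_real m *s v)" "m \<noteq> 0"
  shows "mat_exp ((t / m) *\<^sub>R cscale \<i> X) *v v = of_real (cosh t) *s v + (\<i> * of_real (sinh t)) *s w"
  using mat_exp_hyperbolic_rotation[OF assms(1,2) refl, of "t / m"] assms(3) by simp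

lemma (in self_adjoint_group) decomposition_from_frame:
  assumes g: "g \<in> G" and z: "bil v v = 1"
    and X: "cscale \<i> X \<in> Lie G" "X *v v = of_real m *s w" "X *v w = - (of_real m *s v)" "m \<noteq> 0"
    and frame: "\<And>u u'. real_vector u \<Longrightarrow> real_vector u' \<Longrightarrow> bil u u = 1 \<Longrightarrow> bil u' u' = 1 \<Longrightarrow> bil u u' = 0 \<Longrightarrow>
      ((g *v v) $ 0 = 0 \<longrightarrow> u $ 0 = 0 \<and> u' $ 0 = 0) \<Longrightarrow>
      \<exists>k\<in>G. mcnj k = k \<and> k *v v = u \<and> k *v w = u'"
  shows "\<exists>k t h. k \<in> real_form \<and> h \<in> G \<and> h *v v = v \<and> g = k ** mat_exp (t *\<^sub>R cscale \<i> X) ** h"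
proof -
  have "bil (g *v v) (g *v v) = 1" using SO8_bil[OF SO8[OF g]] z by simp
  then obtain t u u' where u: "real_vector u" "real_vector u'" "bil u u = 1" "bil u' u' = 1" "bil u u' = 0"
    "g *v v = of_real (cosh t) *s u + (\<i> * of_real (sinh t)) *s u'"
    "(g *v v) $ 0 = 0 \<Longrightarrow> u $ 0 = 0 \<and> u' $ 0 = 0"
    by (rule complex_sphere_frame) blast
  obtain k where k: "k \<in> G" "mcnj k = k" "k *v v = u" "k *v w = u'"
    using frame[OF u(1-5)] u(7) by blast
  define a where "a = mat_exp ((t / m) *\<^sub>R cscale \<i> X)"
  have a: "a \<in> G" using X(1) by (simp add: a_def Lie_def)
  have kaG: "k ** a \<in> G" using k a mult by simp
  have "a *v v = of_real (cosh t) *s v + (\<i> * of_real (sinh t)) *s w"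
    unfolding a_def by (rule mat_exp_hyperbolic_rotation_scaled[OF X(2-4)])
  then have "k *v (a *v v) = g *v v"
    using k u(6) by (simp add: matrix_vector_right_distrib vector_scalar_commute)
  then have kav: "(k ** a) *v v = g *v v" by (simp flip: matrix_vector_mul_assoc)
  define h where "h = transpose (k ** a) ** g"
  have "h *v v = transpose (k ** a) *v ((k ** a) *v v)"
    unfolding kav by (simp only: h_def matrix_vector_mul_assoc)
  then have "h *v v = v" by (simp only: SO8_cancel(1)[OF SO8[OF kaG]])
  moreover have "h \<in> G" unfolding h_def by (intro mult transp kaG g)
  moreover have "g = k ** a ** h"
    using SO8_D(3)[OF SO8[OF kaG]] by (simp add: h_def matrix_mul_assoc)
  moreover have "k \<in> real_form" using k by (simp add: real_form_def)
  ultimately show ?thesis unfolding a_def by blast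
qed

definition octonion_automorphism :: "cmat \<Rightarrow> bool" where
  "octonion_automorphism S \<longleftrightarrow> transpose S ** S = mat 1 \<and> (\<forall>x y. (S *v x) \<bullet>\<^sub>C (S *v y) = S *v (x \<bullet>\<^sub>C y))"

lemma octonion_automorphism_cancel:
  assumes "octonion_automorphism S"
  shows "S ** transpose S = mat 1" "transpose S *v (S *v x) = x" "S *v (transpose S *v x) = x" "S *v e 0 = e 0"
    "octonion_automorphism (transpose S)"
proof -
  have 1: "transpose S ** S = mat 1" using assms by (simp add: octonion_automorphism_def)
  then show 2: "S ** transpose S = mat 1" by (simp add: matrix_left_right_inverse)
  show 3: "transpose S *v (S *v x) = x" "S *v (transpose S *v x) = x" for x
    using 1 2 by (simp_all add: matrix_vector_mul_assoc)
  have hom: "(S *v x) \<bullet>\<^sub>C (S *v y) = S *v (x \<bullet>\<^sub>C y)" for x y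
    using assms by (simp add: octonion_automorphism_def)
  have "(S *v e 0) \<bullet>\<^sub>C (S *v (transpose S *v e 0)) = S *v (transpose S *v e 0)" by (simp only: hom cayley_linear)
  then show "S *v e 0 = e 0" by (simp add: 3)
  have "(transpose S *v x) \<bullet>\<^sub>C (transpose S *v y) = transpose S *v (x \<bullet>\<^sub>C y)" for x y
    using hom[of "transpose S *v x" "transpose S *v y"] 3 by metis
  with 2 show "octonion_automorphism (transpose S)" by (simp add: octonion_automorphism_def)
qed

lemma skew_conjugate: "skew X \<Longrightarrow> skew (conjugate S X)"
  by (simp add: skew_def conjugate_def matrix_transpose_mul mm.minus_left mm.minus_right matrix_mul_assoc)

lemma conjugate_vector: "conjugate S X *v v = S *v (X *v (transpose S *v v))"
  by (simp add: conjugate_def flip: matrix_vector_mul_assoc)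

lemma spin_derivation_conjugate:
  assumes S: "octonion_automorphism S" and X: "spin_derivation X0 X"
  shows "spin_derivation (conjugate S X0) (conjugate S X)"
  unfolding spin_derivation_def
proof (intro conjI allI)
  note T = octonion_automorphism_cancel[OF S] octonion_automorphism_cancel[OF octonion_automorphism_cancel(5)[OF S]]
  show "skew (conjugate S X0)" "skew (conjugate S X)" using X by (auto simp: spin_derivation_def skew_conjugate)
  show "conjugate S X0 *v e 0 = 0" using X T by (simp add: conjugate_vector spin_derivation_def)
  fix x y
  define x' y' where "x' = transpose S *v x" and "y' = transpose S *v y"
  have hom: "(S *v u) \<bullet>\<^sub>C (S *v w) = S *v (u \<bullet>\<^sub>C w)" for u w
    using S by (simp add: octonion_automorphism_def)
  have xy: "x = S *v x'" "y = S *v y'" using T by (simp_all add: x'_def y'_def)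
  have der: "(X0 *v x') \<bullet>\<^sub>C y' + x' \<bullet>\<^sub>C (X *v y') = X *v (x' \<bullet>\<^sub>C y')"
    using X by (simp add: spin_derivation_def)
  have "(conjugate S X0 *v x) \<bullet>\<^sub>C y + x \<bullet>\<^sub>C (conjugate S X *v y)
      = S *v ((X0 *v x') \<bullet>\<^sub>C y' + x' \<bullet>\<^sub>C (X *v y'))"
    unfolding xy conjugate_vector by (simp only: T(2) hom matrix_vector_right_distrib)
  also have "\<dots> = conjugate S X *v (x \<bullet>\<^sub>C y)"
    unfolding der xy conjugate_vector by (simp only: T(2) hom)
  finally show "(conjugate S X0 *v x) \<bullet>\<^sub>C y + x \<bullet>\<^sub>C (conjugate S X *v y) = conjugate S X *v (x \<bullet>\<^sub>C y)" .
qed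

lemma Lie_conjugate_automorphism:
  assumes S: "octonion_automorphism S"
  shows "Y \<in> Lie SO7 \<Longrightarrow> conjugate S Y \<in> Lie SO7" "Y \<in> Lie Spin7 \<Longrightarrow> conjugate S Y \<in> Lie Spin7"
    "Y \<in> Lie G2 \<Longrightarrow> conjugate S Y \<in> Lie G2"
proof -
  note T = octonion_automorphism_cancel(4)[OF octonion_automorphism_cancel(5)[OF S]]
  show "Y \<in> Lie SO7 \<Longrightarrow> conjugate S Y \<in> Lie SO7" by (simp add: Lie_SO7 skew_conjugate conjugate_vector T)
  show "Y \<in> Lie Spin7 \<Longrightarrow> conjugate S Y \<in> Lie Spin7"
    unfolding Lie_Spin7 using spin_derivation_conjugate[OF S] by blast
  show "Y \<in> Lie G2 \<Longrightarrow> conjugate S Y \<in> Lie G2"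
    unfolding Lie_G2 using spin_derivation_conjugate[OF S] by blast
qed

definition killing_symmetry :: "cmat set \<Rightarrow> cmat \<Rightarrow> cmat \<Rightarrow> bool" where
  "killing_symmetry V Z S \<longleftrightarrow> transpose S ** S = mat 1 \<and> conjugate S Z = Z \<and>
     (\<forall>Y\<in>V. conjugate S Y \<in> V \<and> conjugate (transpose S) Y \<in> V)"

lemma killing_symmetric:
  assumes V: "lie_algebra V" "Z \<in> V" "Y \<in> V" and S: "killing_symmetry V Z S"
  shows "conjugate S Y \<in> V" "killing V (conjugate S Y) Z = killing V Y Z"
proof -
  show "conjugate S Y \<in> V" using S V by (simp add: killing_symmetry_def)
  have ST: "transpose S ** S = mat 1" "S ** transpose S = mat 1"
    using S by (auto simp: killing_symmetry_def matrix_left_right_inverse)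
  have "(\<lambda>Z. S ** Z ** transpose S) ` V = V"
  proof (intro equalityI subsetI)
    fix W assume "W \<in> V"
    then have "conjugate (transpose S) W \<in> V" using S by (simp add: killing_symmetry_def)
    moreover have "W = conjugate S (conjugate (transpose S) W)" using ST by (simp add: conjugate_conjugate)
    ultimately show "W \<in> (\<lambda>Z. S ** Z ** transpose S) ` V" unfolding conjugate_def by blast
  qed (use S in \<open>auto simp: killing_symmetry_def conjugate_def\<close>)
  from killing_conjugate[OF V(1,3,2) ST(2) this]
  show "killing V (conjugate S Y) Z = killing V Y Z"
    using S by (simp add: killing_symmetry_def conjugate_def)
qed

lemma lie_algebra_add: "lie_algebra V \<Longrightarrow> X \<in> V \<Longrightarrow> Y \<in> V \<Longrightarrow> X + Y \<in> V"
  by (simp add: lie_algebra_def cmat.subspace_add)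

lemma killing_average:
  assumes V: "lie_algebra V" "Z \<in> V" "Y \<in> V" and S: "killing_symmetry V Z S"
  shows "Y + conjugate S Y \<in> V" "killing V (Y + conjugate S Y) Z = 2 * killing V Y Z"
  using killing_symmetric[OF assms] V by (simp_all add: lie_algebra_add killing_add)

lemma killing_zero:
  assumes "lie_algebra V" "Z \<in> V" shows "killing V 0 Z = 0"
proof -
  have "0 \<in> V" using assms by (simp add: lie_algebra_def cmat.subspace_0)
  from killing_add[OF assms(1) this this assms(2)] show ?thesis by simp
qed

text \<open>With respect to the basis: \<open>e\<^bsub>\<tau> k\<^esub> \<mapsto> s\<^sub>k e\<^sub>k\<close>.\<close>

definition signed_perm :: "(8 \<Rightarrow> complex) \<Rightarrow> (8 \<Rightarrow> 8) \<Rightarrow> cmat" where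
  "signed_perm s \<tau> = (\<chi> k l. if l = \<tau> k then s k else 0)"

lemma signed_perm_vector: "(signed_perm s \<tau> *v x) $ k = s k * x $ \<tau> k"
proof -
  have "(signed_perm s \<tau> *v x) $ k = (\<Sum>l\<in>UNIV. if l = \<tau> k then s k * x $ l else 0)"
    unfolding signed_perm_def matrix_vector_mult_def vec_lambda_beta by (rule sum.cong) auto
  then show ?thesis by simp
qed

lemma conjugate_signed_perm: "conjugate (signed_perm s \<tau>) Z $ k $ l = s k * s l * Z $ \<tau> k $ \<tau> l"
proof -
  have *: "(signed_perm s \<tau> ** A) $ k $ l = s k * A $ \<tau> k $ l" for A :: cmat and k l
    using signed_perm_vector[of s \<tau> "A *v e l" k]
    by (metis matrix_axis_nth matrix_vector_mul_assoc)
  have "conjugate (signed_perm s \<tau>) Z = transpose (signed_perm s \<tau> ** transpose (signed_perm s \<tau> ** Z))"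
    by (simp add: conjugate_def matrix_transpose_mul)
  then show ?thesis by (simp add: transpose_def *)
qed

definition aut1 where "aut1 = signed_perm (\<lambda>k. if k \<in> {0,1,2,3} then 1 else - 1) id"
definition aut2 where "aut2 = signed_perm (\<lambda>k. if k \<in> {0,1,4,5} then 1 else - 1) id"
definition aut3 where "aut3 = signed_perm (\<lambda>k. if k \<in> {0,3,5,6} then 1 else - 1) id"
definition aut4 where "aut4 = signed_perm (\<lambda>k. 1)
  (\<lambda>k. if k = 2 then 6 else if k = 3 then 7 else if k = 4 then 2 else if k = 5 then 3 else if k = 6 then 4
    else if k = 7 then 5 else k)"
definition aut5 where "aut5 = signed_perm (\<lambda>k. if k \<in> {4,7} then - 1 else 1)
  (\<lambda>k. if k = 4 then 5 else if k = 5 then 4 else if k = 6 then 7 else if k = 7 then 6 else k)"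


lemmas aut_defs = aut1_def aut2_def aut3_def aut4_def aut5_def

lemma automorphism_aut:
  "octonion_automorphism aut1" "octonion_automorphism aut2" "octonion_automorphism aut3"
  "octonion_automorphism aut4" "octonion_automorphism aut5"
  unfolding octonion_automorphism_def aut_defs
  by (auto intro!: orthogonal_of_bil simp: bil_8 signed_perm_vector)
     (simp_all add: vec8_eq_iff cayley_mult_nth signed_perm_vector)

lemma transpose_automorphism_aut: "S \<in> {aut1, aut2, aut3, aut4, aut5} \<Longrightarrow> octonion_automorphism S \<and> octonion_automorphism (transpose S)"
  using automorphism_aut octonion_automorphism_cancel(5) by blast

lemma killing_symmetry_aut:
  assumes "V \<in> {Lie SO7, Lie Spin7, Lie G2}" "S \<in> {aut1, aut2, aut3, aut4, aut5}" "conjugate S Z = Z"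
  shows "killing_symmetry V Z S"
  using assms(1,3) transpose_automorphism_aut[OF assms(2)] Lie_conjugate_automorphism[of S] Lie_conjugate_automorphism[of "transpose S"]
  unfolding killing_symmetry_def octonion_automorphism_def[of S]
  by auto

lemma conjugate_cscale_aut: 
  assumes "S \<in> {aut1, aut2, aut3, aut4, aut5}" "S ** X = X ** S" shows "conjugate S (cscale z X) = cscale z X"
proof -
  have ST: "S ** transpose S = mat 1"
    using octonion_automorphism_cancel(1) transpose_automorphism_aut[OF assms(1)] by blast
  have "conjugate S X = X ** (S ** transpose S)" unfolding conjugate_def assms(2) by (simp only: matrix_mul_assoc)
  then show ?thesis by (simp add: ST conjugate_cscale)
qed

lemma X_symmetric:
  "aut1 ** X_spin = X_spin ** aut1" "aut2 ** X_spin = X_spin ** aut2" "aut4 ** X_spin = X_spin ** aut4"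
  "aut1 ** X_so = X_so ** aut1" "aut2 ** X_so = X_so ** aut2" "aut4 ** X_so = X_so ** aut4"
  "aut1 ** der3 = der3 ** aut1" "aut3 ** der3 = der3 ** aut3" "aut5 ** der3 = der3 ** aut5"
  unfolding commute_iff_vector aut_defs by (simp_all add: vec8_eq_iff generator_nth signed_perm_vector)

lemma G2_Lie_entries:
  assumes "Y \<in> Lie G2"
  shows "Y $ k $ l = - Y $ l $ k" "Y $ k $ 0 = 0" "Y $ 0 $ k = 0" "Y $ 3 $ 2 + Y $ 5 $ 4 + Y $ 7 $ 6 = 0"
    "Y $ 2 $ 1 + Y $ 6 $ 5 + Y $ 7 $ 4 = 0"
proof -
  have Y: "skew Y" "Y *v e 0 = 0" "\<And>x y. (Y *v x) \<bullet>\<^sub>C y + x \<bullet>\<^sub>C (Y *v y) = Y *v (x \<bullet>\<^sub>C y)"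
    using assms by (auto simp: Lie_G2 spin_derivation_def)
  have sk: "Y $ k $ l = - Y $ l $ k" for k l
  proof -
    have "transpose Y $ l $ k = (- Y) $ l $ k" using Y(1) by (simp only: skew_def)
    then show ?thesis by (simp add: transpose_def)
  qed
  then show "Y $ k $ l = - Y $ l $ k" .
  have k0: "Y $ k $ 0 = 0" for k using arg_cong[OF Y(2), of "\<lambda>x. x $ k"] by simp
  then show "Y $ k $ 0 = 0" "Y $ 0 $ k = 0" using sk[of 0 k] by simp_all
  have e25: "e 2 \<bullet>\<^sub>C e 5 = e 7" and e14: "e 1 \<bullet>\<^sub>C e 4 = e 5"
    by (simp_all add: vec8_eq_iff cayley_mult_nth)
  have "Y $ 3 $ 2 - Y $ 4 $ 5 = Y $ 6 $ 7"
    using arg_cong[OF Y(3)[of "e 2" "e 5"], of "\<lambda>x. x $ 6"] unfolding e25 by (simp add: cayley_mult_nth)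
  then show "Y $ 3 $ 2 + Y $ 5 $ 4 + Y $ 7 $ 6 = 0" using sk[of 4 5] sk[of 6 7] by simp
  have "- Y $ 2 $ 1 - Y $ 7 $ 4 = Y $ 6 $ 5"
    using arg_cong[OF Y(3)[of "e 1" "e 4"], of "\<lambda>x. x $ 6"] unfolding e14 by (simp add: cayley_mult_nth)
  then show "Y $ 2 $ 1 + Y $ 6 $ 5 + Y $ 7 $ 4 = 0" by (simp flip: \<open>- Y $ 2 $ 1 - Y $ 7 $ 4 = Y $ 6 $ 5\<close>)
qed

text \<open>\<open>aut1\<close>, \<open>aut2\<close>, \<open>aut4\<close> fix \<open>Z\<close>, so \<open>Y\<close> may be averaged over them without changing its product with
  \<open>Z\<close>; the average of a derivation is zero.\<close>

lemma killing_orthogonal_G2: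
  assumes V: "lie_algebra V" "V \<in> {Lie SO7, Lie Spin7, Lie G2}" "Lie G2 \<subseteq> V" and Z: "Z \<in> V"
    and inv: "\<And>S. S \<in> {aut1, aut2, aut4} \<Longrightarrow> conjugate S Z = Z" and Y: "Y \<in> Lie G2"
  shows "killing V Y Z = 0"
proof -
  have sym: "killing_symmetry V Z S" if "S \<in> {aut1, aut2, aut4}" for S
    using killing_symmetry_aut[OF V(2), of S Z] inv that by auto
  define Y1 where "Y1 = Y + conjugate aut1 Y"
  define Y2 where "Y2 = Y1 + conjugate aut2 Y1"
  have "Y \<in> V" using V Y by blast
  then have Y1: "Y1 \<in> V" "killing V Y1 Z = 2 * killing V Y Z"
    unfolding Y1_def using killing_average[OF V(1) Z _ sym[of aut1]] by auto
  then have Y2: "Y2 \<in> V" "killing V Y2 Z = 2 * killing V Y1 Z"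
    unfolding Y2_def using killing_average[OF V(1) Z _ sym[of aut2]] by auto
  have C1: "conjugate aut4 Y2 \<in> V" "killing V (conjugate aut4 Y2) Z = killing V Y2 Z"
    using killing_symmetric[OF V(1) Z Y2(1) sym[of aut4]] by auto
  have C2: "conjugate aut4 (conjugate aut4 Y2) \<in> V" "killing V (conjugate aut4 (conjugate aut4 Y2)) Z = killing V Y2 Z"
    using killing_symmetric[OF V(1) Z C1(1) sym[of aut4]] C1(2) by auto
  have "Y2 + conjugate aut4 Y2 + conjugate aut4 (conjugate aut4 Y2) = 0"
  proof -
    have Y2_nth: "Y2 $ k $ l = (1 + (if k \<in> {0,1,4,5} then 1 else - 1) * (if l \<in> {0,1,4,5} then 1 else - 1))
        * (1 + (if k \<in> {0,1,2,3} then 1 else - 1) * (if l \<in> {0,1,2,3} then 1 else - 1)) * Y $ k $ l" for k l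
      unfolding Y2_def Y1_def aut1_def aut2_def vector_add_component conjugate_signed_perm id_apply
      by (simp only: algebra_simps mult_1)
    have d: "Y $ k $ k = 0" for k using G2_Lie_entries(1)[OF Y, of k k] by simp
    have sk: "Y $ 2 $ 3 = - Y $ 3 $ 2" "Y $ 4 $ 5 = - Y $ 5 $ 4" "Y $ 6 $ 7 = - Y $ 7 $ 6"
      by (rule G2_Lie_entries(1)[OF Y])+
    have s: "Y $ 3 $ 2 = - Y $ 5 $ 4 - Y $ 7 $ 6"
      using G2_Lie_entries(4)[OF Y] by (simp add: eq_neg_iff_add_eq_0 algebra_simps)
    show ?thesis
      unfolding vec8_eq_iff vector_add_component aut4_def conjugate_signed_perm Y2_nth
      by (simp add: d sk s G2_Lie_entries(2,3)[OF Y])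
  qed
  then have "0 = killing V (Y2 + conjugate aut4 Y2 + conjugate aut4 (conjugate aut4 Y2)) Z"
    using killing_zero[OF V(1) Z] by simp
  also have "\<dots> = 3 * killing V Y2 Z"
    using killing_add[OF V(1) lie_algebra_add[OF V(1) Y2(1) C1(1)] C2(1) Z] killing_add[OF V(1) Y2(1) C1(1) Z] C1 C2
    by simp
  finally show ?thesis using Y1 Y2 by simp
qed

lemma killing_orthogonal_SL3:
  assumes Z: "Z \<in> Lie G2" and inv: "\<And>S. S \<in> {aut1, aut3, aut5} \<Longrightarrow> conjugate S Z = Z" and Y: "Y \<in> Lie SL3"
  shows "killing (Lie G2) Y Z = 0"
proof -
  have sym: "killing_symmetry (Lie G2) Z S" if "S \<in> {aut1, aut3, aut5}" for S
    using killing_symmetry_aut[of "Lie G2" S Z] inv that by auto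
  note V = lie_algebra_G2
  define Y1 where "Y1 = Y + conjugate aut1 Y"
  define Y2 where "Y2 = Y1 + conjugate aut3 Y1"
  have YV: "Y \<in> Lie G2" "Y *v e 1 = 0" using Y by (auto simp: Lie_SL3)
  then have Y1: "Y1 \<in> Lie G2" "killing (Lie G2) Y1 Z = 2 * killing (Lie G2) Y Z"
    unfolding Y1_def using killing_average[OF V Z _ sym[of aut1]] by auto
  then have Y2: "Y2 \<in> Lie G2" "killing (Lie G2) Y2 Z = 2 * killing (Lie G2) Y1 Z"
    unfolding Y2_def using killing_average[OF V Z _ sym[of aut3]] by auto
  have Y3: "killing (Lie G2) (Y2 + conjugate aut5 Y2) Z = 2 * killing (Lie G2) Y2 Z"
    using killing_average[OF V Z Y2(1) sym[of aut5]] by auto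
  have "Y2 + conjugate aut5 Y2 = 0"
  proof -
    have Y2_nth: "Y2 $ k $ l = (1 + (if k \<in> {0,3,5,6} then 1 else - 1) * (if l \<in> {0,3,5,6} then 1 else - 1))
        * (1 + (if k \<in> {0,1,2,3} then 1 else - 1) * (if l \<in> {0,1,2,3} then 1 else - 1)) * Y $ k $ l" for k l
      unfolding Y2_def Y1_def aut1_def aut3_def vector_add_component conjugate_signed_perm id_apply
      by (simp only: algebra_simps mult_1)
    have d: "Y $ k $ k = 0" for k using G2_Lie_entries(1)[OF YV(1), of k k] by simp
    have k1: "Y $ k $ 1 = 0" "Y $ 1 $ k = 0" for k
      using arg_cong[OF YV(2), of "\<lambda>x. x $ k"] G2_Lie_entries(1)[OF YV(1), of 1 k] by simp_all
    have sk: "Y $ 5 $ 6 = - Y $ 6 $ 5" "Y $ 4 $ 7 = - Y $ 7 $ 4"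
      by (rule G2_Lie_entries(1)[OF YV(1)])+
    have s: "Y $ 6 $ 5 = - Y $ 7 $ 4"
      using G2_Lie_entries(5)[OF YV(1)] k1 by (simp add: eq_neg_iff_add_eq_0)
    show ?thesis
      unfolding vec8_eq_iff vector_add_component aut5_def conjugate_signed_perm Y2_nth
      by (simp add: d sk s k1 G2_Lie_entries(2,3)[OF YV(1)])
  qed
  then show ?thesis using Y1 Y2 Y3 killing_zero[OF V Z] by simp
qed

lemma conjugate_fix_axis:
  assumes "c \<in> SO8" "conjugate c Y *v e i = 0" shows "Y *v (transpose c *v e i) = 0"
proof -
  have "transpose c *v (conjugate c Y *v e i) = 0" using assms(2) by simp
  then show ?thesis using assms(1) by (simp add: conjugate_vector)
qed

lemma conjugate_axis_scalar:
  assumes c: "c \<in> SO8" and u: "transpose c *v e i = \<epsilon> *s e i"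
  shows "\<epsilon> * \<epsilon> = 1" "c *v e i = \<epsilon> *s e i"
proof -
  have "bil (transpose c *v e i) (transpose c *v e i) = 1"
    using SO8_bil[OF SO8_transpose[OF c]] by simp
  then show 1: "\<epsilon> * \<epsilon> = 1" unfolding u by simp
  have "c *v (transpose c *v e i) = e i" using c by simp
  then have "\<epsilon> *s (\<epsilon> *s (c *v e i)) = \<epsilon> *s e i" unfolding u vector_scalar_commute by simp
  then show "c *v e i = \<epsilon> *s e i" using 1 by (simp add: vector_smult_assoc)
qed

lemma torus_kernel:
  assumes "der1 *v u = 0" "der2 *v u = 0" shows "u = u $ 0 *s e 0 + u $ 1 *s e 1"
  using assms by (simp add: generator_nth vec8_eq_iff)

lemma der_in_Lie_G2: "Y \<in> {der1, der2, der3, der4, der5, der6} \<Longrightarrow> Y \<in> Lie G2 \<and> mcnj Y = Y"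
  using spin_derivation_der by (auto simp: Lie_G2)

lemma Lie_G2_subset: "Lie G2 \<subseteq> Lie SO7" "Lie G2 \<subseteq> Lie Spin7"
  by (auto simp: Lie_G2 Lie_SO7 Lie_Spin7 spin_derivation_def)

lemma rigid_Spin7:
  assumes c: "c \<in> Spin7"
    and comm: "\<And>Y. Y \<in> Lie Spin7 \<Longrightarrow> mcnj Y = Y \<Longrightarrow> X_spin ** Y = Y ** X_spin \<Longrightarrow> c ** Y = Y ** c"
    and conj: "\<And>Y. Y \<in> Lie G2 \<Longrightarrow> mcnj Y = Y \<Longrightarrow> conjugate c Y \<in> Lie G2"
  shows "mcnj c = c"
proof -
  obtain c0 where c0: "spin_pair c0 c" using c by (auto simp: Spin7_iff)
  then have c8: "c \<in> SO8" by (simp add: spin_pair_def)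
  have cA: "c ** der1 = der1 ** c" "c ** der2 = der2 ** c" "c ** der4 = der4 ** c" "c ** der5 = der5 ** c"
    using der_in_Lie_G2 Lie_G2_subset(2) X_commutes by (auto intro!: comm)
  have cX: "c ** X_spin = X_spin ** c"
    using spin_derivation_X by (intro comm) (auto simp: Lie_Spin7)
  define u where "u = transpose c *v e 0"
  have kill: "Y *v u = 0" if "Y \<in> {der1, der2, der3}" for Y
  proof -
    have "conjugate c Y \<in> Lie G2" using that der_in_Lie_G2[of Y] by (intro conj) auto
    then have "conjugate c Y *v e 0 = 0" by (simp add: Lie_G2 spin_derivation_def)
    then show ?thesis unfolding u_def by (rule conjugate_fix_axis[OF c8])
  qed
  have u01: "u = u $ 0 *s e 0 + u $ 1 *s e 1" using kill by (intro torus_kernel) auto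
  have "der3 *v u = 0" using kill by simp
  then have "u $ 1 = 0" by (simp add: generator_nth vec8_eq_iff)
  then have u: "transpose c *v e 0 = u $ 0 *s e 0" using u01 by (simp add: u_def[symmetric])
  define \<epsilon> where "\<epsilon> = u $ 0"
  note \<epsilon> = conjugate_axis_scalar[OF c8 u, folded \<epsilon>_def]
  have X0: "X_spin *v e 0 = 3 *s e 1" by (simp add: generator_nth vec8_eq_iff)
  have "3 *s (c *v e 1) = c *v (X_spin *v e 0)" unfolding X0 by (simp only: vector_scalar_commute)
  also have "\<dots> = X_spin *v (c *v e 0)" using cX by (simp add: commute_iff_vector)
  also have "\<dots> = 3 *s (\<epsilon> *s e 1)"
    unfolding \<epsilon>(2) by (simp only: vector_scalar_commute X0 vector_smult_assoc mult.commute)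
  finally have ce1: "c *v e 1 = \<epsilon> *s e 1" by (simp only: vector_mul_lcancel) simp
  have "cnj \<epsilon> = \<epsilon>" using csquare_real[of \<epsilon> 1] \<epsilon>(1) by (simp add: power2_eq_square)
  have "(c0 *v e 2) \<bullet>\<^sub>C (c *v e 4) = c *v (e 2 \<bullet>\<^sub>C e 4)" using c0 by (simp add: spin_pair_def)
  moreover have "c0 *v e 2 = \<epsilon> *s (c *v e 2)"
    using spin_pair_vector[OF c0, of "e 2"] u by (simp add: \<epsilon>_def vector_scalar_commute)
  moreover have "e 2 \<bullet>\<^sub>C e 4 = - e 6" by (simp add: vec8_eq_iff cayley_mult_nth)
  ultimately have "\<epsilon> *s ((c *v e 2) \<bullet>\<^sub>C (c *v e 4)) = - (c *v e 6)" by simp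
  then have "\<epsilon> *s (\<epsilon> *s ((c *v e 2) \<bullet>\<^sub>C (c *v e 4))) = \<epsilon> *s (- (c *v e 6))" by simp
  then have "(c *v e 2) \<bullet>\<^sub>C (c *v e 4) = - (\<epsilon> *s (c *v e 6))"
    by (simp only: vector_smult_assoc \<epsilon>(1) vector_smult_lid) (simp add: vec_eq_iff)
  moreover have "vcnj (c *v e 0) = c *v e 0" unfolding \<epsilon>(2) using \<open>cnj \<epsilon> = \<epsilon>\<close> by simp
  ultimately show ?thesis
    using torus_rigid[OF cA c8 \<epsilon>(1) _ ce1] by blast
qed

lemma rigid_SO7:
  assumes c: "c \<in> SO7"
    and comm: "\<And>Y. Y \<in> Lie SO7 \<Longrightarrow> mcnj Y = Y \<Longrightarrow> X_so ** Y = Y ** X_so \<Longrightarrow> c ** Y = Y ** c"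
    and conj: "\<And>Y. Y \<in> Lie G2 \<Longrightarrow> mcnj Y = Y \<Longrightarrow> conjugate c Y \<in> Lie G2"
  shows "mcnj c = c"
proof -
  have c8: "c \<in> SO8" "c *v e 0 = e 0" using c by (auto simp: SO7_iff)
  have cA: "c ** der1 = der1 ** c" "c ** der2 = der2 ** c" "c ** der4 = der4 ** c" "c ** der5 = der5 ** c"
    using der_in_Lie_G2 Lie_G2_subset(1) X_commutes by (auto intro!: comm)
  define u where "u = c *v e 1"
  have A_e1: "der1 *v e 1 = 0" "der2 *v e 1 = 0" by (simp_all add: generator_nth vec8_eq_iff)
  have "der1 *v u = c *v (der1 *v e 1)" "der2 *v u = c *v (der2 *v e 1)"
    using cA by (simp_all add: u_def commute_iff_vector)
  then have "u = u $ 0 *s e 0 + u $ 1 *s e 1" by (intro torus_kernel) (simp_all only: A_e1 matrix_vector_mult_0_right)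
  moreover have "u $ 0 = 0" unfolding u_def SO7_nth_0[OF c] by simp
  ultimately have ce1: "c *v e 1 = u $ 1 *s e 1" by (simp add: u_def[symmetric])
  define \<epsilon> where "\<epsilon> = u $ 1"
  note ce1 = ce1[folded \<epsilon>_def]
  have \<epsilon>: "\<epsilon> * \<epsilon> = 1" using SO8_bil[OF c8(1), of "e 1" "e 1"] unfolding ce1 by simp
  obtain \<alpha> \<beta> where ce: "c *v e 2 = \<alpha> *s e 2 + \<beta> *s e 3" "c *v e 3 = \<alpha> *s e 3 - \<beta> *s e 2"
    "c *v e 4 = \<alpha> *s e 4 + \<beta> *s e 5" "c *v e 5 = \<alpha> *s e 5 - \<beta> *s e 4"
    "c *v e 6 = \<alpha> *s e 6 + \<beta> *s e 7" "c *v e 7 = \<alpha> *s e 7 - \<beta> *s e 6"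
    by (rule torus_block[OF cA])
  define W where "W = conjugate c der3"
  have "W \<in> Lie G2" unfolding W_def using der_in_Lie_G2[of der3] by (intro conj) auto
  then have W: "(W *v x) \<bullet>\<^sub>C y + x \<bullet>\<^sub>C (W *v y) = W *v (x \<bullet>\<^sub>C y)" for x y
    by (simp add: Lie_G2 spin_derivation_def)
  have Wc: "W *v (c *v x) = c *v (der3 *v x)" for x
    using c8(1) by (simp add: W_def conjugate_vector)
  have A3_e: "der3 *v e 1 = 2 *s e 2" "der3 *v e 4 = - e 7" "der3 *v e 5 = - e 6"
    by (simp_all add: generator_nth vec8_eq_iff)
  have prod14: "(c *v e 1) \<bullet>\<^sub>C (c *v e 4) = \<epsilon> *s (c *v e 5)"
    and prod17: "(c *v e 1) \<bullet>\<^sub>C (c *v e 7) = - (\<epsilon> *s (c *v e 6))"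
    unfolding ce1 ce by (simp_all add: vec8_eq_iff cayley_mult_nth)
  have "(W *v (c *v e 1)) \<bullet>\<^sub>C (c *v e 4) + (c *v e 1) \<bullet>\<^sub>C (W *v (c *v e 4)) = W *v (\<epsilon> *s (c *v e 5))"
    using W[of "c *v e 1" "c *v e 4"] unfolding prod14 .
  then have "2 *s ((c *v e 2) \<bullet>\<^sub>C (c *v e 4)) - (c *v e 1) \<bullet>\<^sub>C (c *v e 7) = - (\<epsilon> *s (c *v e 6))"
    unfolding vector_scalar_commute Wc A3_e by (simp add: vector_scalar_commute)
  then have "2 *s ((c *v e 2) \<bullet>\<^sub>C (c *v e 4)) = 2 *s (- (\<epsilon> *s (c *v e 6)))"
    unfolding prod17 by (simp add: vec_eq_iff eq_neg_iff_add_eq_0 algebra_simps)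
  then have "(c *v e 2) \<bullet>\<^sub>C (c *v e 4) = - (\<epsilon> *s (c *v e 6))" by (simp add: vec_eq_iff)
  then show ?thesis
    using torus_rigid[OF cA c8(1) \<epsilon> _ ce1] c8(2) by simp
qed

lemma rigid_G2:
  assumes c: "c \<in> G2"
    and comm: "\<And>Y. Y \<in> Lie G2 \<Longrightarrow> mcnj Y = Y \<Longrightarrow> der3 ** Y = Y ** der3 \<Longrightarrow> c ** Y = Y ** c"
    and conj: "\<And>Y. Y \<in> Lie SL3 \<Longrightarrow> mcnj Y = Y \<Longrightarrow> conjugate c Y \<in> Lie SL3"
  shows "mcnj c = c"
proof -
  have c8: "c \<in> SO8" "c *v e 0 = e 0" "c \<in> SO7" "\<And>x y. (c *v x) \<bullet>\<^sub>C (c *v y) = c *v (x \<bullet>\<^sub>C y)"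
    using c by (auto simp: G2_iff_spin_pair spin_pair_def SO7_iff)
  have cA: "c *v (Y *v x) = Y *v (c *v x)" if "Y \<in> {der2, der3, der5, der6}" for Y x
  proof -
    have "c ** Y = Y ** c" using that der_in_Lie_G2[of Y] X_commutes by (intro comm) auto
    then show ?thesis by (simp add: commute_iff_vector)
  qed
  define u where "u = transpose c *v e 1"
  have kill: "Y *v u = 0" if "Y \<in> {der1, der2}" for Y
  proof -
    have "der1 *v e 1 = 0" "der2 *v e 1 = 0" by (simp_all add: generator_nth vec8_eq_iff)
    then have "Y *v e 1 = 0" using that by blast
    then have "conjugate c Y \<in> Lie SL3" using that der_in_Lie_G2[of Y] by (intro conj) (auto simp: Lie_SL3)
    then have "conjugate c Y *v e 1 = 0" by (simp add: Lie_SL3)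
    then show ?thesis unfolding u_def by (rule conjugate_fix_axis[OF c8(1)])
  qed
  have "u = u $ 0 *s e 0 + u $ 1 *s e 1" using kill by (intro torus_kernel) auto
  moreover have "u $ 0 = 0" unfolding u_def SO7_nth_0[OF SO7_transpose[OF c8(3)]] by simp
  ultimately have u: "transpose c *v e 1 = u $ 1 *s e 1" by (simp add: u_def[symmetric])
  define \<epsilon> where "\<epsilon> = u $ 1"
  note \<epsilon> = conjugate_axis_scalar[OF c8(1) u, folded \<epsilon>_def]
  have A_e: "der3 *v e 1 = 2 *s e 2" "der3 *v e 4 = - e 7" "der6 *v e 4 = - e 7" "der5 *v e 4 = e 6" "der2 *v e 4 = e 5"
    and e_prod: "e 1 \<bullet>\<^sub>C e 2 = e 3" "e 1 \<bullet>\<^sub>C e 4 = e 5"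
    by (simp_all add: generator_nth vec8_eq_iff cayley_mult_nth)
  have "2 *s (c *v e 2) = 2 *s (\<epsilon> *s e 2)"
    using cA[of der3 "e 1"] unfolding A_e \<epsilon>(2) vector_scalar_commute by (simp add: vec_eq_iff mult.left_commute)
  then have ce2: "c *v e 2 = \<epsilon> *s e 2" by (simp add: vec_eq_iff)
  have ce3: "c *v e 3 = e 3"
    using c8(4)[of "e 1" "e 2"] unfolding \<epsilon>(2) ce2 e_prod cayley_linear vector_smult_assoc \<epsilon>(1) by simp
  define w where "w = c *v e 4"
  have "\<epsilon> \<noteq> 0" using \<epsilon>(1) by auto
  have "bil w (c *v e i) = 0" if "i \<noteq> 4" for i using that SO8_bil[OF c8(1), of "e 4" "e i"] by (simp add: w_def)
  from this[of 0] this[of 1] this[of 2] this[of 3]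
  have w0: "w $ 0 = 0" "w $ 1 = 0" "w $ 2 = 0" "w $ 3 = 0"
    unfolding c8(2) \<epsilon>(2) ce2 ce3 using \<open>\<epsilon> \<noteq> 0\<close> by simp_all
  have c5: "c *v e 5 = der2 *v w" and c6: "c *v e 6 = der5 *v w"
    using cA[of der2 "e 4"] cA[of der5 "e 4"] unfolding A_e w_def by simp_all
  have "- (c *v e 7) = der6 *v w" "- (c *v e 7) = der3 *v w"
    using cA[of der6 "e 4"] cA[of der3 "e 4"] unfolding A_e w_def by simp_all
  then have c7: "c *v e 7 = - (der6 *v w)" "c *v e 7 = - (der3 *v w)" by (metis minus_minus)+
  have "der6 *v w = der3 *v w" using c7 by simp
  then have "w $ 6 = - w $ 6" "w $ 5 = - w $ 5" unfolding generator_nth vec8_eq_iff by simp_all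
  then have w56: "w $ 5 = 0" "w $ 6 = 0" by simp_all
  have "c *v e 5 = \<epsilon> *s (e 1 \<bullet>\<^sub>C w)" using c8(4)[of "e 1" "e 4"] unfolding \<epsilon>(2) e_prod by (simp add: w_def)
  then have eqs: "w $ 4 = \<epsilon> * w $ 4" "w $ 7 = - (\<epsilon> * w $ 7)"
    unfolding c5 generator_nth vec8_eq_iff using w0 w56 by (simp_all add: cayley_mult_nth)
  have norm: "w $ 4 * w $ 4 + w $ 7 * w $ 7 = 1"
    using SO8_bil[OF c8(1), of "e 4" "e 4"] w0 w56 unfolding w_def[symmetric] bil_8 by simp
  have "w $ 4 * w $ 7 = 0"
  proof -
    have "w $ 4 * w $ 7 = \<epsilon> * w $ 4 * (- (\<epsilon> * w $ 7))" using eqs by metis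
    also have "\<dots> = - (w $ 4 * w $ 7)" using \<epsilon>(1) by (simp add: algebra_simps)
    finally show ?thesis by simp
  qed
  then have "cnj (w $ 4) = w $ 4 \<and> cnj (w $ 7) = w $ 7"
    using csquare_real[of "w $ 4" 1] csquare_real[of "w $ 7" 1] norm by (auto simp: power2_eq_square)
  then have w_real: "vcnj w = w" using w0 w56 by (simp add: vec8_eq_iff)
  have "cnj \<epsilon> = \<epsilon>" using csquare_real[of \<epsilon> 1] \<epsilon>(1) by (simp add: power2_eq_square)
  show ?thesis
  proof (rule mcnj_eqI)
    fix i
    show "vcnj (c *v e i) = c *v e i"
      using exhaust_8[of i] w_real \<open>cnj \<epsilon> = \<epsilon>\<close>
      by (elim disjE; simp only: c8(2) \<epsilon>(2) ce2 ce3 c5 c6 c7(1) w_def[symmetric] vcnj_simps vcnj_mult generator_real)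
  qed
qed

lemma decomposition_Spin7:
  assumes "g \<in> Spin7"
  shows "\<exists>k t h. k \<in> Spin7 \<and> mcnj k = k \<and> h \<in> G2 \<and> g = k ** mat_exp (t *\<^sub>R cscale \<i> X_spin) ** h"
proof -
  interpret self_adjoint_group Spin7 by (rule self_adjoint_group_Spin7)
  have X: "cscale \<i> X_spin \<in> Lie Spin7"
    using spin_derivation_cscale[OF spin_derivation_X] by (auto simp: Lie_Spin7)
  have "\<exists>k t h. k \<in> real_form \<and> h \<in> Spin7 \<and> h *v e 0 = e 0 \<and> g = k ** mat_exp (t *\<^sub>R cscale \<i> X_spin) ** h"
  proof (rule decomposition_from_frame[OF assms _ X, where m = 3 and w = "e 1"])
    show "X_spin *v e 0 = of_real 3 *s e 1" "X_spin *v e 1 = - (of_real 3 *s e 0)"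
      by (simp_all add: generator_nth vec8_eq_iff)
    fix u u' assume "real_vector u" "real_vector u'" "bil u u = 1" "bil u' u' = 1" "bil u u' = 0"
    then show "\<exists>k\<in>Spin7. mcnj k = k \<and> k *v e 0 = u \<and> k *v e 1 = u'"
      using Spin7_real_frame[of u u'] by metis
  qed simp_all
  then show ?thesis by (auto simp: real_form_def G2_iff_Spin7)
qed

lemma decomposition_G2:
  assumes "g \<in> G2"
  shows "\<exists>k t h. k \<in> G2 \<and> mcnj k = k \<and> h \<in> SL3 \<and> g = k ** mat_exp (t *\<^sub>R cscale \<i> der3) ** h"
proof -
  interpret self_adjoint_group G2 by (rule self_adjoint_group_G2)
  have X: "cscale \<i> der3 \<in> Lie G2"
    using spin_derivation_cscale[OF spin_derivation_der(3)] by (auto simp: Lie_G2)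
  have "g \<in> SO7" using assms by (simp add: G2_iff_spin_pair spin_pair_def)
  have "\<exists>k t h. k \<in> real_form \<and> h \<in> G2 \<and> h *v e 1 = e 1 \<and> g = k ** mat_exp (t *\<^sub>R cscale \<i> der3) ** h"
  proof (rule decomposition_from_frame[OF assms _ X, where m = 2 and w = "e 2"])
    show "der3 *v e 1 = of_real 2 *s e 2" "der3 *v e 2 = - (of_real 2 *s e 1)"
      by (simp_all add: generator_nth vec8_eq_iff)
    fix u u' assume u: "real_vector u" "real_vector u'" "bil u u = 1" "bil u' u' = 1" "bil u u' = 0"
      "(g *v e 1) $ 0 = 0 \<longrightarrow> u $ 0 = 0 \<and> u' $ 0 = 0"
    have "u $ 0 = 0" "u' $ 0 = 0" using u(6) SO7_nth_0[OF \<open>g \<in> SO7\<close>, of "e 1"] by simp_all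
    then have "imaginary_unit u" "imaginary_unit u'" using u by (simp_all add: imaginary_unit_def)
    then show "\<exists>k\<in>G2. mcnj k = k \<and> k *v e 1 = u \<and> k *v e 2 = u'"
      using G2_real_frame[of u u'] u by metis
  qed simp_all
  then show ?thesis by (auto simp: real_form_def SL3_def)
qed

lemma decomposition_SO7:
  assumes "g \<in> SO7"
  shows "\<exists>k t h. k \<in> SO7 \<and> mcnj k = k \<and> h \<in> G2 \<and> g = k ** mat_exp (t *\<^sub>R cscale \<i> X_so) ** h"
proof -
  obtain g' where g': "spin_pair g g'" by (rule SO7_lift[OF assms])
  then have "g' \<in> Spin7" by (auto simp: Spin7_iff)
  then obtain k t h where k: "k \<in> Spin7" "mcnj k = k" "h \<in> G2" "g' = k ** mat_exp (t *\<^sub>R cscale \<i> X_spin) ** h"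
    using decomposition_Spin7 by blast
  obtain k0 where k0: "spin_pair k0 k" using k(1) by (auto simp: Spin7_iff)
  have "spin_pair (mat_exp (t *\<^sub>R cscale \<i> X_so)) (mat_exp (t *\<^sub>R cscale \<i> X_spin))"
    by (intro spin_derivation_mat_exp spin_derivation_cscale spin_derivation_X)
  then have "spin_pair (k0 ** mat_exp (t *\<^sub>R cscale \<i> X_so) ** h) g'"
    unfolding k(4) using k(3) by (intro spin_pair_mult k0) (auto simp: G2_iff_spin_pair)
  then have "g = k0 ** mat_exp (t *\<^sub>R cscale \<i> X_so) ** h" by (rule spin_pair_unique[OF g'])
  moreover have "k0 \<in> SO7" using k0 by (simp add: spin_pair_def)
  moreover have "mcnj k0 = k0" by (rule spin_pair_real[OF k0 k(2)])
  ultimately show ?thesis using k(3) by blast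
qed

lemma G2_subgroup: "G2 \<subseteq> SO7" "G2 \<subseteq> Spin7" "mat 1 \<in> G2"
  "g \<in> G2 \<Longrightarrow> h \<in> G2 \<Longrightarrow> g ** h \<in> G2" "g \<in> G2 \<Longrightarrow> transpose g \<in> G2"
  by (auto simp: G2_iff_spin_pair Spin7_iff spin_pair_one spin_pair_mult spin_pair_transpose)
     (simp add: spin_pair_def)

lemma SL3_subgroup: "SL3 \<subseteq> G2" "mat 1 \<in> SL3"
  "g \<in> SL3 \<Longrightarrow> h \<in> SL3 \<Longrightarrow> g ** h \<in> SL3" "g \<in> SL3 \<Longrightarrow> transpose g \<in> SL3"
proof -
  show "g \<in> SL3 \<Longrightarrow> transpose g \<in> SL3"
    using SO8_cancel(1)[of g "e 1"] G2_subgroup(5) by (auto simp: SL3_def G2_def)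
qed (auto simp: SL3_def G2_subgroup simp flip: matrix_vector_mul_assoc)

lemma rank_one_pair_SO7: "rank_one_pair SO7 G2 X_so (e 2) (e 3) 2"
proof -
  interpret self_adjoint_group SO7 by (rule self_adjoint_group_SO7)
  have X: "X_so \<in> Lie SO7" using spin_derivation_X by (simp add: Lie_SO7 spin_derivation_def)
  show ?thesis
  proof (intro rank_one_pair.intro rank_one_pair_axioms.intro self_adjoint_group_SO7)
    show "killing (Lie SO7) Y (cscale z X_so) = 0" if "Y \<in> Lie G2" for Y z
    proof (rule killing_orthogonal_G2[OF lie_algebra_SO7 _ Lie_G2_subset(1) _ _ that])
      show "cscale z X_so \<in> Lie SO7" using X lie_algebra_SO7 by (simp add: lie_algebra_def cmat.subspace_scale)
      show "conjugate S (cscale z X_so) = cscale z X_so" if "S \<in> {aut1, aut2, aut4}" for S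
        using that X_symmetric by (intro conjugate_cscale_aut) auto
    qed simp
    show "G2 \<subseteq> SO7" "mat 1 \<in> G2" using G2_subgroup by simp_all
    show "g ** h \<in> G2" if "g \<in> G2" "h \<in> G2" for g h using that G2_subgroup by blast
    show "transpose g \<in> G2" if "g \<in> G2" for g using that G2_subgroup by blast
    show "\<exists>k t h. k \<in> real_form \<and> h \<in> G2 \<and> g = k ** mat_exp (t *\<^sub>R cscale \<i> X_so) ** h" if "g \<in> SO7" for g
      unfolding real_form_def using decomposition_SO7[OF that] by blast
    show "mcnj c = c" if "c \<in> SO7"
      "\<And>Y. Y \<in> Lie SO7 \<Longrightarrow> mcnj Y = Y \<Longrightarrow> X_so ** Y = Y ** X_so \<Longrightarrow> c ** Y = Y ** c"
      "\<And>Y. Y \<in> Lie G2 \<Longrightarrow> mcnj Y = Y \<Longrightarrow> conjugate c Y \<in> Lie G2" for c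
      using that by (rule rigid_SO7)
    show "X_so *v e 2 = of_real 2 *s e 3" "X_so *v e 3 = - (of_real 2 *s e 2)" "e 3 \<noteq> 0"
      by (simp_all add: generator_nth vec8_eq_iff)
  qed (simp_all add: X lie_algebra_SO7)
qed

lemma rank_one_pair_Spin7: "rank_one_pair Spin7 G2 X_spin (e 0) (e 1) 3"
proof -
  interpret self_adjoint_group Spin7 by (rule self_adjoint_group_Spin7)
  have X: "X_spin \<in> Lie Spin7" using spin_derivation_X by (auto simp: Lie_Spin7)
  show ?thesis
  proof (intro rank_one_pair.intro rank_one_pair_axioms.intro self_adjoint_group_Spin7)
    show "killing (Lie Spin7) Y (cscale z X_spin) = 0" if "Y \<in> Lie G2" for Y z
    proof (rule killing_orthogonal_G2[OF lie_algebra_Spin7 _ Lie_G2_subset(2) _ _ that])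
      show "cscale z X_spin \<in> Lie Spin7" using X lie_algebra_Spin7 by (simp add: lie_algebra_def cmat.subspace_scale)
      show "conjugate S (cscale z X_spin) = cscale z X_spin" if "S \<in> {aut1, aut2, aut4}" for S
        using that X_symmetric by (intro conjugate_cscale_aut) auto
    qed simp
    show "G2 \<subseteq> Spin7" "mat 1 \<in> G2" using G2_subgroup by simp_all
    show "g ** h \<in> G2" if "g \<in> G2" "h \<in> G2" for g h using that G2_subgroup by blast
    show "transpose g \<in> G2" if "g \<in> G2" for g using that G2_subgroup by blast
    show "\<exists>k t h. k \<in> real_form \<and> h \<in> G2 \<and> g = k ** mat_exp (t *\<^sub>R cscale \<i> X_spin) ** h" if "g \<in> Spin7" for g
      unfolding real_form_def using decomposition_Spin7[OF that] by blast
    show "mcnj c = c" if "c \<in> Spin7"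
      "\<And>Y. Y \<in> Lie Spin7 \<Longrightarrow> mcnj Y = Y \<Longrightarrow> X_spin ** Y = Y ** X_spin \<Longrightarrow> c ** Y = Y ** c"
      "\<And>Y. Y \<in> Lie G2 \<Longrightarrow> mcnj Y = Y \<Longrightarrow> conjugate c Y \<in> Lie G2" for c
      using that by (rule rigid_Spin7)
    show "X_spin *v e 0 = of_real 3 *s e 1" "X_spin *v e 1 = - (of_real 3 *s e 0)" "e 1 \<noteq> 0"
      by (simp_all add: generator_nth vec8_eq_iff)
  qed (simp_all add: X lie_algebra_Spin7)
qed

lemma rank_one_pair_G2: "rank_one_pair G2 SL3 der3 (e 1) (e 2) 2"
proof -
  interpret self_adjoint_group G2 by (rule self_adjoint_group_G2)
  have X: "der3 \<in> Lie G2" using spin_derivation_der by (simp add: Lie_G2)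
  show ?thesis
  proof (intro rank_one_pair.intro rank_one_pair_axioms.intro self_adjoint_group_G2)
    show "killing (Lie G2) Y (cscale z der3) = 0" if "Y \<in> Lie SL3" for Y z
    proof (rule killing_orthogonal_SL3[OF _ _ that])
      show "cscale z der3 \<in> Lie G2" using X lie_algebra_G2 by (simp add: lie_algebra_def cmat.subspace_scale)
      show "conjugate S (cscale z der3) = cscale z der3" if "S \<in> {aut1, aut3, aut5}" for S
        using that X_symmetric by (intro conjugate_cscale_aut) auto
    qed
    show "SL3 \<subseteq> G2" "mat 1 \<in> SL3" using SL3_subgroup by simp_all
    show "g ** h \<in> SL3" if "g \<in> SL3" "h \<in> SL3" for g h using that SL3_subgroup by blast
    show "transpose g \<in> SL3" if "g \<in> SL3" for g using that SL3_subgroup by blast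
    show "\<exists>k t h. k \<in> real_form \<and> h \<in> SL3 \<and> g = k ** mat_exp (t *\<^sub>R cscale \<i> der3) ** h" if "g \<in> G2" for g
      unfolding real_form_def using decomposition_G2[OF that] by blast
    show "mcnj c = c" if "c \<in> G2"
      "\<And>Y. Y \<in> Lie G2 \<Longrightarrow> mcnj Y = Y \<Longrightarrow> der3 ** Y = Y ** der3 \<Longrightarrow> c ** Y = Y ** c"
      "\<And>Y. Y \<in> Lie SL3 \<Longrightarrow> mcnj Y = Y \<Longrightarrow> conjugate c Y \<in> Lie SL3" for c
      using that by (rule rigid_G2)
    show "der3 *v e 1 = of_real 2 *s e 2" "der3 *v e 2 = - (of_real 2 *s e 1)" "e 2 \<noteq> 0"
      by (simp_all add: generator_nth vec8_eq_iff)
  qed (simp_all add: X lie_algebra_G2)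
qed

theorem theorem1p1:
  fixes G H :: "(complex^8^8) set"
    and \<theta> :: "complex^8^8 \<Rightarrow> complex^8^8"
  assumes "(G, H) \<in> rank_one_spherical_pairs"
    and "cartan_involution G \<theta>"
    and "\<theta> ` H = H"
  shows "\<exists>\<aa> :: (complex^8^8) set.
           subspace \<aa> \<and> dim \<aa> = 1 \<and> (\<forall>X\<in>\<aa>. \<forall>Y\<in>\<aa>. lie_bracket X Y = 0) \<and>
           \<aa> \<subseteq> cscale \<i> ` Lie (fixed_group G \<theta>) \<inter> killing_complement (Lie G) (Lie H) \<and>
           G = {k ** a ** h | k a h. k \<in> fixed_group G \<theta> \<and> a \<in> mat_exp ` \<aa> \<and> h \<in> H}"
proof -
  obtain X v w m where "rank_one_pair G H X v w m"
    using assms(1) rank_one_pair_SO7 rank_one_pair_Spin7 rank_one_pair_G2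
    unfolding rank_one_spherical_pairs_def by blast
  from rank_one_pair.rank_one_decomposition[OF this assms(2,3)] show ?thesis .
qed

end
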